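(* Let $X\subset\mathbf R^m$ and $Y\subset\mathbf R^n$ with $m\ge n$, and let $s,D_ys\in C^{r,1}_{loc}(X\times Y)$ for some integer $r\ge0$. If $s$ does not degenerate at $(\bar x,\bar y)\in X\times Y$, then $\bar x$ admits a neighbourhood $U\subset\mathbf R^m$ such that $X(\bar y,D_ys(\bar x,\bar y))\cap U$ coincides with the intersection of $X$ with a $C^{r,1}$-smooth, codimension $n$ submanifold of $U$.
   Context: For $y\in Y$ and $k\in\mathbf R^n$, $X(y,k):=\{x\in X: D_ys(x,y)=k\}$. $C^{r,1}_{loc}$ denotes functions that are locally $r$ times continuously differentiable with Lipschitz $r$-th derivatives; on a set which is not open, this is understood in the sense of local $C^{r,1}$ extensions to neighbourhoods in $\mathbf R^m\times\mathbf R^n$. A $C^{0,1}$ submanifold is a Lipschitz submanifold. For a Lipschitz map $F$ from an open subset of $\mathbf R^m$ to $\mathbf R^n$, the Clarke subdifferential (generalized Jacobian) $\partial F(x)$ is the convex hull of limits of the derivatives $DF(x_i)$ along sequences $x_i\to x$ of points of differentiability, viewed as $m\times n$ matrices $M$ with $M_{ij}=\partial F_j/\partial x_i$. Degeneracy: if $s\in C^2(X\times Y)$, $s$ degenerates at $(\bar x,\bar y)$ if $\operatorname{rank}(D^2_{xy}s(\bar x,\bar y))<n$. If $s\in C^{0,1}_{loc}(X\times Y)$ and $D_ys$ is locally Lipschitz, $s$ degenerates at $(\bar x,\bar y)$ if for every Lipschitz extension of $D_ys$ to a neighbourhood of $(\bar x,\bar y)$ and every choice of orthonormal basis for $\mathbf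 R^m$, setting $F(x)=D_ys(x,\bar y)$ yields some $m\times n$ matrix $M\in\partial F(\bar x)$ with $\det[M_{ij}]_{1\le i,j\le n}=0$. Otherwise $s$ is non-degenerate (does not degenerate) at $(\bar x,\bar y)$.
   Formalization: Degeneracy is tested on C^{r,1} (not merely Lipschitz) extensions of D_ys, with the rank test used when X×Y is open and s is C²; for r≥1 the literal claim fails, e.g. X={(t,|t|)}, D_ys=0. Nothing changes for r=0 or when x̄ lies in the closure of the interior of X. *)

theory Defs
  imports "HOL-Analysis.Analysis"
begin

definition locally_lipschitz_on ::
  "'a::metric_space set \<Rightarrow> ('a \<Rightarrow> 'b::metric_space) \<Rightarrow> bool" where
  "locally_lipschitz_on W f \<longleftrightarrow>
     (\<forall>x\<in>W. \<exists>V L. open V \<and> x \<in> V \<and> L-lipschitz_on (V \<inter> W) f)"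

(* The next two predicates are meant for open W. Derivatives of order k are reached by
   iterating directional derivatives in arbitrary directions. *)

primrec C_k_on ::
  "nat \<Rightarrow> 'a::euclidean_space set \<Rightarrow> ('a \<Rightarrow> 'b::euclidean_space) \<Rightarrow> bool" where
  "C_k_on 0 W f \<longleftrightarrow> continuous_on W f"
| "C_k_on (Suc k) W f \<longleftrightarrow>
     (\<forall>x\<in>W. f differentiable at x) \<and>
     (\<forall>v. C_k_on k W (\<lambda>x. frechet_derivative f (at x) v))"

primrec C_lip_on ::
  "nat \<Rightarrow> 'a::euclidean_space set \<Rightarrow> ('a \<Rightarrow> 'b::euclidean_space) \<Rightarrow> bool" where
  "C_lip_on 0 W f \<longleftrightarrow> locally_lipschitz_on W f"
| "C_lip_on (Suc r) W f \<longleftrightarrow>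
     (\<forall>x\<in>W. f differentiable at x) \<and>
     (\<forall>v. C_lip_on r W (\<lambda>x. frechet_derivative f (at x) v))"

(* C^{r,1}_loc on an arbitrary set A, via local extensions to open sets. *)

definition C_lip_loc ::
  "nat \<Rightarrow> 'a::euclidean_space set \<Rightarrow> ('a \<Rightarrow> 'b::euclidean_space) \<Rightarrow> bool" where
  "C_lip_loc r A f \<longleftrightarrow>
     (\<forall>p\<in>A. \<exists>W g. open W \<and> p \<in> W \<and> C_lip_on r W g \<and> (\<forall>q\<in>W \<inter> A. g q = f q))"

(* Dys is a y-gradient of s on X \<times> Y. It is a relation because the derivative within Y
   need not be unique when Y is not open. *)

definition y_gradient_on ::
  "(real^'m) set \<Rightarrow> (real^'n) set \<Rightarrow> ((real^'m) \<times> (real^'n) \<Rightarrow> real) \<Rightarrow>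
   ((real^'m) \<times> (real^'n) \<Rightarrow> real^'n) \<Rightarrow> bool" where
  "y_gradient_on X Y s Dys \<longleftrightarrow>
     (\<forall>x\<in>X. \<forall>y\<in>Y. ((\<lambda>y. s (x, y)) has_derivative (\<lambda>h. Dys (x, y) \<bullet> h)) (at y within Y))"

(* X(y,k) *)

definition indifference_set ::
  "(real^'m) set \<Rightarrow> ((real^'m) \<times> (real^'n) \<Rightarrow> real^'n) \<Rightarrow> real^'n \<Rightarrow> real^'n \<Rightarrow> (real^'m) set" where
  "indifference_set X Dys y k = {x\<in>X. Dys (x, y) = k}"

(* Matrices M with M $ i $ j = dF_j/dx_i, the transpose of the usual Jacobian. *)

definition clarke_subdifferential ::
  "((real^'m) \<Rightarrow> (real^'n)) \<Rightarrow> real^'m \<Rightarrow> (real^'n^'m) set" where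
  "clarke_subdifferential F x =
     convex hull {M. \<exists>u. u \<longlonglongrightarrow> x \<and> (\<forall>i. F differentiable at (u i)) \<and>
                        (\<lambda>i. transpose (jacobian F (at (u i)))) \<longlonglongrightarrow> M}"

(* The rows of an orthogonal matrix B are an orthonormal basis of R^m, and B ** M is M
   with its rows taken with respect to that basis. An injection \<iota> picks the n basis
   vectors that are numbered 1, ..., n.

   If s is C^2 on an open X \<times> Y the criterion is the rank of D^2_{xy} s. Otherwise
   D^2_{xy} s need not be determined by s, and the criterion ranges over the local C^{r,1}
   extensions of D_y s. The index r is the class in which D_y s is extended; r = 0 is the
   criterion with Lipschitz extensions. By degenerates_index_irrelevant below, the index
   matters only where xb is not in the closure of the interior of X. There a function in
   C^{r,1} may have a Lipschitz extension that is far from C^1: on the graph X of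
   x2 = \<bar>x1\<bar> the function 0 is extended by x2 - \<bar>x1\<bar>. *)

definition degenerates ::
  "nat \<Rightarrow> (real^'m) set \<Rightarrow> (real^'n) set \<Rightarrow> ((real^'m) \<times> (real^'n) \<Rightarrow> real) \<Rightarrow>
   ((real^'m) \<times> (real^'n) \<Rightarrow> real^'n) \<Rightarrow> real^'m \<Rightarrow> real^'n \<Rightarrow> bool" where
  "degenerates r X Y s Dys xb yb \<longleftrightarrow>
     (if open (X \<times> Y) \<and> C_k_on 2 (X \<times> Y) s
      then rank (transpose (jacobian (\<lambda>x. Dys (x, yb)) (at xb))) < CARD('n)
      else \<forall>W G B (\<iota> :: 'n \<Rightarrow> 'm).
             open W \<and> (xb, yb) \<in> W \<and> C_lip_on r W G \<and>
             (\<forall>q\<in>W \<inter> (X \<times> Y). G q = Dys q) \<and>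
             orthogonal_matrix B \<and> inj \<iota> \<longrightarrow>
             (\<exists>M\<in>clarke_subdifferential (\<lambda>x. G (x, yb)) xb.
                det (\<chi> i j. (B ** M) $ \<iota> i $ j) = 0))"

(* N is locally straightened by homeomorphisms that are C^{r,1} in both directions;
   for r = 0 these are locally bi-Lipschitz. *)

definition C_lip_submanifold ::
  "nat \<Rightarrow> nat \<Rightarrow> 'a::euclidean_space set \<Rightarrow> 'a set \<Rightarrow> bool" where
  "C_lip_submanifold r codim U N \<longleftrightarrow>
     N \<subseteq> U \<and>
     (\<forall>p\<in>N. \<exists>W V T (\<Phi> :: 'a \<Rightarrow> 'a) \<Psi>.
        open W \<and> p \<in> W \<and> W \<subseteq> U \<and> open V \<and> homeomorphism W V \<Phi> \<Psi> \<and>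
        C_lip_on r W \<Phi> \<and> C_lip_on r V \<Psi> \<and>
        subspace T \<and> dim T + codim = DIM('a) \<and> \<Phi> ` (W \<inter> N) = V \<inter> T)"

lemma locally_lipschitz_on_imp_isCont:
  assumes "locally_lipschitz_on W f" "open W" "x \<in> W"
  shows "isCont f x"
proof -
  obtain V L where V: "open V" "x \<in> V" "L-lipschitz_on (V \<inter> W) f"
    using assms unfolding locally_lipschitz_on_def by blast
  have "continuous_on (V \<inter> W) f" using V(3) lipschitz_on_continuous_on by blast
  then show ?thesis
    using V assms by (meson IntI continuous_on_eq_continuous_at open_Int)
qed

lemma C_lip_on_imp_isCont:
  assumes "C_lip_on r W f" "open W" "x \<in> W"
  shows "isCont f x"
proof (cases r)
  case 0
  then show ?thesis using assms locally_lipschitz_on_imp_isCont by auto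
next
  case (Suc k)
  then show ?thesis using assms differentiable_imp_continuous_within by auto
qed

lemma locally_lipschitz_on_if_derivs:
  fixes f :: "'a::euclidean_space \<Rightarrow> 'b::euclidean_space"
  assumes W: "open W"
    and d: "\<And>x. x \<in> W \<Longrightarrow> f differentiable at x"
    and c: "\<And>v x. x \<in> W \<Longrightarrow> isCont (\<lambda>x. frechet_derivative f (at x) v) x"
  shows "locally_lipschitz_on W f"
  unfolding locally_lipschitz_on_def
proof
  fix x assume x: "x \<in> W"
  define g where "g = (\<lambda>y. \<Sum>b\<in>Basis. norm (frechet_derivative f (at y) b))"
  have "isCont g x" unfolding g_def using c[OF x] by (intro continuous_intros) auto
  then have "\<forall>\<^sub>F y in nhds x. g y < g x + 1"
    by (intro order_tendstoD) (auto simp: continuous_at tendsto_at_iff_tendsto_nhds)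
  moreover have "\<forall>\<^sub>F y in nhds x. y \<in> W" using W x by (simp add: eventually_nhds_in_open)
  ultimately have "\<forall>\<^sub>F y in nhds x. y \<in> W \<and> g y < g x + 1" by eventually_elim auto
  then obtain e where e: "e > 0" "\<And>y. dist y x < e \<Longrightarrow> y \<in> W \<and> g y < g x + 1"
    unfolding eventually_nhds_metric by blast
  have g0: "g x \<ge> 0" unfolding g_def by (simp add: sum_nonneg)
  have on: "onorm (frechet_derivative f (at y)) \<le> g x + 1" if "y \<in> ball x e" for y
  proof -
    have y: "y \<in> W" "g y < g x + 1" using e(2) that by (auto simp: dist_commute)
    have lin: "linear (frechet_derivative f (at y))"
      using d[OF y(1)] by (rule linear_frechet_derivative)
    have "norm (frechet_derivative f (at y) v) \<le> g y * norm v" for v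
    proof -
      have "frechet_derivative f (at y) v
            = (\<Sum>b\<in>Basis. (v \<bullet> b) *\<^sub>R frechet_derivative f (at y) b)"
        by (subst (1) euclidean_representation[symmetric])
           (simp add: linear_sum[OF lin] linear_cmul[OF lin])
      also have "norm \<dots> \<le> (\<Sum>b\<in>Basis. norm v * norm (frechet_derivative f (at y) b))"
        by (rule sum_norm_le) (auto intro!: mult_right_mono simp: Basis_le_norm)
      also have "\<dots> = g y * norm v" by (simp add: g_def sum_distrib_left mult.commute)
      finally show ?thesis .
    qed
    then have "onorm (frechet_derivative f (at y)) \<le> g y"
      by (intro onorm_le)
    with y show ?thesis by simp
  qed
  have "(g x + 1)-lipschitz_on (ball x e) f"
  proof (rule lipschitz_onI)
    fix y z assume yz: "y \<in> ball x e" "z \<in> ball x e"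
    have "norm (f y - f z) \<le> (g x + 1) * norm (y - z)"
    proof (rule differentiable_bound[where S = "ball x e"])
      fix w assume "w \<in> ball x e"
      then have "w \<in> W" using e(2) by (auto simp: dist_commute)
      then show "(f has_derivative frechet_derivative f (at w)) (at w within ball x e)"
        using d frechet_derivative_works has_derivative_at_withinI by blast
    qed (use yz on in auto)
    then show "dist (f y) (f z) \<le> (g x + 1) * dist y z" by (simp add: dist_norm)
  qed (use g0 in simp)
  then have "(g x + 1)-lipschitz_on (ball x e \<inter> W) f"
    by (rule lipschitz_on_subset) auto
  then show "\<exists>V L. open V \<and> x \<in> V \<and> L-lipschitz_on (V \<inter> W) f"
    using e(1) by (meson centre_in_ball open_ball)
qed

lemma C_lip_on_Suc_imp:
  fixes f :: "'a::euclidean_space \<Rightarrow> 'b::euclidean_space"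
  assumes "open W" "C_lip_on (Suc r) W f"
  shows "C_lip_on r W f"
  using assms(2)
proof (induction r arbitrary: f)
  case 0
  then have "\<And>v x. x \<in> W \<Longrightarrow> isCont (\<lambda>x. frechet_derivative f (at x) v) x"
    using locally_lipschitz_on_imp_isCont[OF _ assms(1)] by (metis C_lip_on.simps)
  then show ?case using 0 assms(1) locally_lipschitz_on_if_derivs[of W f] by auto
next
  case (Suc r)
  have "f differentiable at x" if "x \<in> W" for x
    using Suc.prems that unfolding C_lip_on.simps(2)[of "Suc r"] by blast
  moreover have "C_lip_on r W (\<lambda>x. frechet_derivative f (at x) v)" for v
    using Suc.prems Suc.IH unfolding C_lip_on.simps(2)[of "Suc r" W f] by blast
  ultimately show ?case by simp
qed

lemma C_lip_on_imp_zero: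
  fixes f :: "'a::euclidean_space \<Rightarrow> 'b::euclidean_space"
  assumes "open W" "C_lip_on r W f"
  shows "C_lip_on 0 W f"
  using assms(2) by (induction r) (use C_lip_on_Suc_imp[OF assms(1)] in blast)+

lemma slice_derivative:
  fixes G :: "(real^'m) \<times> (real^'n) \<Rightarrow> real^'n"
  assumes "G differentiable at (x, y)"
  shows "((\<lambda>x. G (x, y)) has_derivative (\<lambda>h. frechet_derivative G (at (x, y)) (h, 0))) (at x)"
proof -
  have "(G has_derivative frechet_derivative G (at (x, y))) (at (x, y))"
    using assms frechet_derivative_works by blast
  moreover have "((\<lambda>x. (x, y)) has_derivative (\<lambda>h. (h, 0))) (at x)"
    by (auto intro!: derivative_eq_intros)
  ultimately show ?thesis
    using diff_chain_at[of "\<lambda>x. (x, y)" "\<lambda>h. (h, 0)" x G] by (simp add: o_def)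
qed

lemma slice_jacobian_tendsto:
  fixes G :: "(real^'m) \<times> (real^'n) \<Rightarrow> real^'n"
  assumes W: "open W" "(xb, yb) \<in> W" and G: "C_lip_on (Suc k) W G" and u: "u \<longlonglongrightarrow> xb"
  shows "(\<lambda>i. transpose (jacobian (\<lambda>x. G (x, yb)) (at (u i))))
           \<longlonglongrightarrow> transpose (jacobian (\<lambda>x. G (x, yb)) (at xb))"
proof -
  have J: "transpose (jacobian (\<lambda>x. G (x, yb)) (at x)) $ i $ j
           = frechet_derivative G (at (x, yb)) (axis i 1, 0) $ j" if "(x, yb) \<in> W" for x i j
  proof -
    have "G differentiable at (x, yb)" using G that by auto
    from slice_derivative[OF this] show ?thesis
      by (simp add: jacobian_def transpose_def matrix_def frechet_derivative_at[symmetric])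
  qed
  have uW: "(\<lambda>i. (u i, yb)) \<longlonglongrightarrow> (xb, yb)" using u by (intro tendsto_intros)
  then have ev: "\<forall>\<^sub>F i in sequentially. (u i, yb) \<in> W"
    using W topological_tendstoD by blast
  show ?thesis
  proof (intro vec_tendstoI)
    fix i j
    have "isCont (\<lambda>q. frechet_derivative G (at q) (axis i 1, 0)) (xb, yb)"
      using G W by (intro C_lip_on_imp_isCont[of k W]) auto
    then have "(\<lambda>l. frechet_derivative G (at (u l, yb)) (axis i 1, 0))
               \<longlonglongrightarrow> frechet_derivative G (at (xb, yb)) (axis i 1, 0)"
      using isCont_tendsto_compose[OF _ uW] by blast
    then have "(\<lambda>l. frechet_derivative G (at (u l, yb)) (axis i 1, 0) $ j)
               \<longlonglongrightarrow> frechet_derivative G (at (xb, yb)) (axis i 1, 0) $ j"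
      by (rule tendsto_vec_nth)
    then show "(\<lambda>l. transpose (jacobian (\<lambda>x. G (x, yb)) (at (u l))) $ i $ j)
               \<longlonglongrightarrow> transpose (jacobian (\<lambda>x. G (x, yb)) (at xb)) $ i $ j"
      unfolding J[OF W(2)]
      by (rule Lim_transform_eventually) (use ev in eventually_elim, simp add: J)
  qed
qed

lemma clarke_slice_subset:
  fixes G :: "(real^'m) \<times> (real^'n) \<Rightarrow> real^'n"
  assumes "open W" "(xb, yb) \<in> W" "C_lip_on (Suc k) W G"
  shows "clarke_subdifferential (\<lambda>x. G (x, yb)) xb
           \<subseteq> {transpose (jacobian (\<lambda>x. G (x, yb)) (at xb))}"
  unfolding clarke_subdifferential_def
proof (rule hull_minimal)
  show "{M. \<exists>u. u \<longlonglongrightarrow> xb \<and> (\<forall>i. (\<lambda>x. G (x, yb)) differentiable at (u i)) \<and>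
              (\<lambda>i. transpose (jacobian (\<lambda>x. G (x, yb)) (at (u i)))) \<longlonglongrightarrow> M}
        \<subseteq> {transpose (jacobian (\<lambda>x. G (x, yb)) (at xb))}"
    using LIMSEQ_unique[OF _ slice_jacobian_tendsto[OF assms]] by auto
qed simp

lemma clarke_slice_mem:
  fixes G H :: "(real^'m) \<times> (real^'n) \<Rightarrow> real^'n"
  assumes W: "open W" "(xb, yb) \<in> W" "C_lip_on (Suc k) W G"
    and cl: "xb \<in> closure (interior X)"
    and eq: "\<And>x. x \<in> X \<Longrightarrow> (x, yb) \<in> W \<Longrightarrow> H (x, yb) = G (x, yb)"
  shows "transpose (jacobian (\<lambda>x. G (x, yb)) (at xb))
           \<in> clarke_subdifferential (\<lambda>x. H (x, yb)) xb"
proof -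
  define S where "S = {x. (x, yb) \<in> W}"
  have S: "open S" "xb \<in> S"
  proof -
    have "S = (\<lambda>x. (x, yb)) -` W" by (auto simp: S_def)
    then show "open S" using W(1) by (auto intro!: open_vimage continuous_intros)
  qed (use W in \<open>simp add: S_def\<close>)
  have "xb \<in> closure (S \<inter> interior X)"
    using open_Int_closure_subset[OF S(1), of "interior X"] S(2) cl by blast
  then obtain u where u: "\<And>i. u i \<in> S \<inter> interior X" "u \<longlonglongrightarrow> xb"
    unfolding closure_sequential by blast
  have "((\<lambda>x. H (x, yb)) has_derivative D) (at (u i)) \<longleftrightarrow>
        ((\<lambda>x. G (x, yb)) has_derivative D) (at (u i))" for i D
  proof -
    have o: "open (S \<inter> interior X)" using S(1) by auto
    have e: "H (x, yb) = G (x, yb)" if "x \<in> S \<inter> interior X" for x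
      using that eq interior_subset by (auto simp: S_def)
    show ?thesis
      by (rule iffI; erule has_derivative_transform_within_open[OF _ o u(1)])
         (simp_all only: e)
  qed
  note HG = this
  have dG: "(\<lambda>x. G (x, yb)) differentiable at (u i)" for i
    using slice_derivative[of G "u i" yb] W(3) u(1)[of i]
    by (auto simp: S_def differentiable_def)
  have dH: "(\<lambda>x. H (x, yb)) differentiable at (u i)" for i
    using dG[of i] HG unfolding differentiable_def by blast
  have "frechet_derivative (\<lambda>x. H (x, yb)) (at (u i))
        = frechet_derivative (\<lambda>x. G (x, yb)) (at (u i))" for i
    unfolding frechet_derivative_def HG ..
  then have J: "jacobian (\<lambda>x. H (x, yb)) (at (u i)) = jacobian (\<lambda>x. G (x, yb)) (at (u i))" for i
    by (simp add: jacobian_def)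
  have "(\<lambda>i. transpose (jacobian (\<lambda>x. H (x, yb)) (at (u i))))
          \<longlonglongrightarrow> transpose (jacobian (\<lambda>x. G (x, yb)) (at xb))"
    unfolding J by (rule slice_jacobian_tendsto[OF W u(2)])
  then show ?thesis
    unfolding clarke_subdifferential_def
    by (intro hull_inc CollectI exI[of _ u] conjI allI u(2) dH)
qed

theorem degenerates_index_irrelevant:
  fixes X :: "(real^'m) set" and Y :: "(real^'n) set"
  assumes D: "C_lip_loc r (X \<times> Y) Dys" and mem: "xb \<in> X" "yb \<in> Y"
    and cl: "xb \<in> closure (interior X)"
  shows "degenerates r X Y s Dys xb yb \<longleftrightarrow> degenerates 0 X Y s Dys xb yb"
proof (cases "open (X \<times> Y) \<and> C_k_on 2 (X \<times> Y) s")
  case True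
  then show ?thesis by (simp add: degenerates_def)
next
  case False
  note defs = degenerates_def if_not_P[OF False]
  show ?thesis
  proof
    assume "degenerates 0 X Y s Dys xb yb"
    then show "degenerates r X Y s Dys xb yb"
      unfolding defs using C_lip_on_imp_zero by blast
  next
    assume deg: "degenerates r X Y s Dys xb yb"
    show "degenerates 0 X Y s Dys xb yb"
    proof (cases r)
      case 0
      then show ?thesis using deg by simp
    next
      case (Suc k)
      obtain W2 G where G: "open W2" "(xb, yb) \<in> W2" "C_lip_on r W2 G"
          "\<forall>q\<in>W2 \<inter> (X \<times> Y). G q = Dys q"
        using D mem unfolding C_lip_loc_def by (metis SigmaI)
      show ?thesis
        unfolding defs
      proof (intro allI impI, elim conjE)
        fix W H and B :: "real^'m^'m" and \<iota> :: "'n \<Rightarrow> 'm"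
        assume H: "open W" "(xb, yb) \<in> W" "\<forall>q\<in>W \<inter> (X \<times> Y). H q = Dys q"
          and B: "orthogonal_matrix B" "inj \<iota>"
        have "C_lip_on (Suc k) W2 G" using G Suc by simp
        have CW: "C_lip_on (Suc k) (W \<inter> W2) G"
        proof -
          have "C_lip_on r' (W \<inter> W2) g" if "C_lip_on r' W2 g"
            for r' and g :: "(real^'m) \<times> (real^'n) \<Rightarrow> real^'n"
            using that
          proof (induction r' arbitrary: g)
            case 0
            then show ?case
              unfolding C_lip_on.simps locally_lipschitz_on_def
              by (meson IntE Int_mono Int_lower2 lipschitz_on_subset order_refl)
          qed auto
          from this[OF \<open>C_lip_on (Suc k) W2 G\<close>] show ?thesis .
        qed
        have "\<exists>M\<in>clarke_subdifferential (\<lambda>x. G (x, yb)) xb.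
                det (\<chi> i j. (B ** M) $ \<iota> i $ j) = 0"
          using deg G B unfolding defs by blast
        then have "det (\<chi> i j. (B ** transpose (jacobian (\<lambda>x. G (x, yb)) (at xb))) $ \<iota> i $ j) = 0"
          using clarke_slice_subset[OF G(1,2) \<open>C_lip_on (Suc k) W2 G\<close>] by blast
        moreover have "transpose (jacobian (\<lambda>x. G (x, yb)) (at xb))
                       \<in> clarke_subdifferential (\<lambda>x. H (x, yb)) xb"
          by (rule clarke_slice_mem[OF _ _ CW cl]) (use G H mem in auto)
        ultimately show "\<exists>M\<in>clarke_subdifferential (\<lambda>x. H (x, yb)) xb.
                det (\<chi> i j. (B ** M) $ \<iota> i $ j) = 0" by blast
      qed
    qed
  qed
qed

end

theory Submission
  imports Defs
begin

text \<open>After an orthogonal change of basis some \<open>n\<close> of the coordinates of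
  \<open>x\<close> can be replaced by the components of the \<open>y\<close>-gradient \<open>F\<close> of
  \<open>s\<close> at fixed \<open>y\<close>; the resulting map \<open>\<Phi>\<close> sends level sets of
  \<open>F\<close> to parallel subspaces, and nondegeneracy of \<open>F\<close> says that every generalized
  Jacobian of \<open>\<Phi>\<close> is invertible. By Clarke's argument \<open>\<Phi>\<close> then expands
  distances by at least a constant factor: Rademacher's theorem makes increments of a Lipschitz map
  averages of its derivatives, and a separating functional bounds these averages away from zero. Invariance
  of domain turns \<open>\<Phi>\<close> into a local homeomorphism, and Cramer's rule for the derivative of
  the inverse carries the regularity of \<open>\<Phi>\<close> over to the inverse, one derivative at a
  time.\<close>

subsection \<open>Differentiability of Lipschitz functions along lines\<close>

text \<open>The generalized Jacobian records \<open>F\<close> only at points of differentiability,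
  so it controls nothing until these points are known to have full measure. Even then a given
  segment may lie entirely in the exceptional null set, and the increment of \<open>F\<close> along
  it cannot be recovered from derivatives on the segment itself; averaging over parallel segments
  avoids this, because translates of a null set are null. A vector-valued map obeys no mean value
  theorem with a single intermediate point, so the increment is tested by a scalar functional, and
  this functional has to vary with the direction of the increment. What must not vary is the
  expansion constant, which compactness therefore fixes beforehand. All classes \<open>r\<close>
  share this Lipschitz construction, and only the regularity of the maps is treated class by class.
  If \<open>s\<close> is twice continuously differentiable, non-degeneracy is a rank condition; the
  generalized Jacobian of an extension then has at most one element, and a nonzero minor of it
  restores the general situation with the standard basis.\<close>

text \<open>This is a Vitali covering argument. Short intervals with an endpoint in \<open>E\<close>
  on which \<open>f\<close> grows by at most \<open>r\<close> times the length cover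
  \<open>E\<close> finely; a countable disjoint subfamily misses only a null set, whose Lipschitz
  image is null. Monotonicity confines the image of each interval to one of at most \<open>r\<close>
  times its length, and all the intervals stay in an open set barely larger than
  \<open>E\<close>.\<close>

lemma emeasure_image_le_slope:
  fixes f :: "real \<Rightarrow> real"
  assumes mono: "strict_mono f" and lip: "L-lipschitz_on UNIV f"
    and E: "E \<in> sets lebesgue" and r: "0 < r"
    and slope: "\<And>x d. x \<in> E \<Longrightarrow> 0 < d \<Longrightarrow> \<exists>h. h \<noteq> 0 \<and> \<bar>h\<bar> < d \<and> (f (x + h) - f x) / h < r"
  shows "emeasure lebesgue (f ` E) \<le> ennreal r * emeasure lebesgue E"
proof (rule ennreal_le_epsilon)
  fix e :: real assume e: "0 < e"
  \<comment> \<open>The excess \<open>e / r\<close> becomes \<open>e\<close> after the final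
    multiplication by \<open>r\<close>.\<close>
  obtain O' where O': "open O'" "E \<subseteq> O'" "(O' - E) \<in> lmeasurable"
      "emeasure lebesgue (O' - E) < ennreal (e / r)"
    using sets_lebesgue_outer_open[OF E, of "e / r"] e r by auto
  define K where
    "K = {(c, \<rho>). 0 < \<rho> \<and> cball c \<rho> \<subseteq> O' \<and> f (c + \<rho>) - f (c - \<rho>) \<le> r * (2 * \<rho>)}"
  have cov: "\<exists>i. i \<in> K \<and> x \<in> cball (fst i) (snd i) \<and> snd i < d" if x: "x \<in> E" and d: "0 < d" for x d
  proof -
    obtain b where b: "0 < b" "ball x b \<subseteq> O'"
      using O' x by (meson openE subsetD)
    obtain h where h: "h \<noteq> 0" "\<bar>h\<bar> < min b d" "(f (x + h) - f x) / h < r"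
      using slope[OF x, of "min b d"] b d by auto
    \<comment> \<open>The ball with this centre and radius is the interval between \<open>x\<close>
      and \<open>x + h\<close>, whichever the sign of \<open>h\<close>.\<close>
    have "cball (x + h / 2) (\<bar>h\<bar> / 2) \<subseteq> ball x b"
    proof
      fix z assume "z \<in> cball (x + h / 2) (\<bar>h\<bar> / 2)"
      then have "\<bar>x + h / 2 - z\<bar> \<le> \<bar>h\<bar> / 2" by (simp add: dist_real_def)
      then show "z \<in> ball x b" using h(2) unfolding mem_ball dist_real_def min_less_iff_conj abs_less_iff abs_le_iff by (auto simp: abs_less_iff; linarith)
    qed
    moreover have "f (x + h / 2 + \<bar>h\<bar> / 2) - f (x + h / 2 - \<bar>h\<bar> / 2) \<le> r * (2 * (\<bar>h\<bar> / 2))"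
    proof (cases "h > 0")
      case True
      then have "f (x + h) - f x < r * h" using h(3) by (simp add: divide_less_eq)
      then show ?thesis using True by (simp add: add.commute)
    next
      case False
      then have "h < 0" using h(1) by simp
      then have "f (x + h) - f x > r * h" using h(3) by (simp add: divide_less_eq)
      then show ?thesis using \<open>h < 0\<close> by (simp add: add.commute)
    qed
    moreover have "x \<in> cball (x + h / 2) (\<bar>h\<bar> / 2)" by (simp add: dist_real_def)
    moreover have "\<bar>h\<bar> / 2 < d" using h(2) by linarith
    ultimately show ?thesis
      using b(2) h(1) by (intro exI[of _ "(x + h / 2, \<bar>h\<bar> / 2)"]) (auto simp: K_def)
  qed
  obtain C where C: "countable C" "C \<subseteq> K"
      "pairwise (\<lambda>i j. disjnt (cball (fst i) (snd i)) (cball (fst j) (snd j))) C"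
      "negligible (E - (\<Union>i\<in>C. cball (fst i) (snd i)))"
    using Vitali_covering_theorem_cballs[where K=K and a=fst and r=snd and S=E] cov
    by (metis (no_types, lifting) K_def case_prodE fst_conv mem_Collect_eq snd_conv)
  define B where "B i = cball (fst i) (snd i)" for i :: "real \<times> real"
  define J where "J i = {f (fst i - snd i)..f (fst i + snd i)}" for i :: "real \<times> real"
  define N where "N = f ` (E - (\<Union>i\<in>C. B i))"
  have "negligible N"
    unfolding N_def
  proof (rule negligible_locally_Lipschitz_image)
    show "negligible (E - (\<Union>i\<in>C. B i))" using C(4) by (simp add: B_def)
    show "\<exists>T B. open T \<and> x \<in> T \<and>
        (\<forall>y\<in>(E - (\<Union>i\<in>C. B' i)) \<inter> T. norm (f y - f x) \<le> B * norm (y - x))" for x B'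
      using lipschitz_onD[OF lip] by (intro exI[of _ UNIV] exI[of _ L]) (auto simp: dist_norm)
  qed simp
  then have N: "N \<in> null_sets lebesgue" by (simp add: negligible_iff_null_sets)
  have sub: "f ` B i \<subseteq> J i" for i
    using strict_mono_mono[OF mono]
    by (auto simp: B_def J_def cball_eq_atLeastAtMost mono_def)
  have JB: "emeasure lebesgue (J i) \<le> ennreal r * emeasure lebesgue (B i)" if "i \<in> C" for i
  proof -
    have K: "0 < snd i" "f (fst i + snd i) - f (fst i - snd i) \<le> r * (2 * snd i)"
      using that C(2) by (auto simp: K_def)
    then have "f (fst i - snd i) \<le> f (fst i + snd i)"
      using strict_mono_mono[OF mono] by (auto simp: mono_def)
    then have "emeasure lebesgue (J i) = ennreal (f (fst i + snd i) - f (fst i - snd i))"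
      by (simp add: J_def)
    also have "\<dots> \<le> ennreal (r * (2 * snd i))" using K by (intro ennreal_leI)
    also have "\<dots> = ennreal r * emeasure lebesgue (B i)"
      using K r by (simp add: B_def cball_eq_atLeastAtMost ennreal_mult)
    finally show ?thesis .
  qed
  have disj: "disjoint_family_on B C"
    using C(3) by (auto simp: disjoint_family_on_def B_def pairwise_def disjnt_def)
  have disjJ: "disjoint_family_on J C"
  proof (unfold disjoint_family_on_def, intro ballI impI)
    fix i j assume ij: "i \<in> C" "j \<in> C" "i \<noteq> j"
    then have d: "disjnt {fst i - snd i..fst i + snd i} {fst j - snd j..fst j + snd j}"
      using C(3) by (auto simp: pairwise_def cball_eq_atLeastAtMost)
    have pos: "0 < snd i" "0 < snd j" using ij C(2) by (auto simp: K_def)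
    have "fst i + snd i < fst j - snd j \<or> fst j + snd j < fst i - snd i"
    proof (rule ccontr)
      assume "\<not> ?thesis"
      then have "max (fst i - snd i) (fst j - snd j) \<in>
         {fst i - snd i..fst i + snd i} \<inter> {fst j - snd j..fst j + snd j}"
        using pos by auto
      then show False using d unfolding disjnt_def by blast
    qed
    then have "f (fst i + snd i) < f (fst j - snd j) \<or> f (fst j + snd j) < f (fst i - snd i)"
      using mono by (auto simp: strict_mono_less)
    then show "J i \<inter> J j = {}" by (auto simp: J_def)
  qed
  have "f ` E \<subseteq> N \<union> (\<Union>i\<in>C. J i)"
    using sub by (fastforce simp: N_def)
  then have "emeasure lebesgue (f ` E) \<le> emeasure lebesgue (N \<union> (\<Union>i\<in>C. J i))"
    using N C(1) by (intro emeasure_mono) (auto simp: J_def null_setsD2 intro!: sets.countable_UN')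
  also have "\<dots> \<le> emeasure lebesgue N + emeasure lebesgue (\<Union>i\<in>C. J i)"
    using N C(1) by (intro emeasure_subadditive) (auto simp: J_def null_setsD2 intro!: sets.countable_UN')
  also have "\<dots> = emeasure lebesgue (\<Union>i\<in>C. J i)" using N by (simp add: null_setsD1)
  also have "\<dots> = (\<integral>\<^sup>+i. emeasure lebesgue (J i) \<partial>count_space C)"
    by (rule emeasure_UN_countable[OF _ C(1) disjJ]) (auto simp: J_def)
  also have "\<dots> \<le> (\<integral>\<^sup>+i. ennreal r * emeasure lebesgue (B i) \<partial>count_space C)"
    by (intro nn_integral_mono) (use JB in auto)
  also have "\<dots> = ennreal r * (\<integral>\<^sup>+i. emeasure lebesgue (B i) \<partial>count_space C)"
    by (rule nn_integral_cmult) auto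
  also have "\<dots> = ennreal r * emeasure lebesgue (\<Union>i\<in>C. B i)"
    by (subst emeasure_UN_countable[OF _ C(1) disj]) (auto simp: B_def)
  also have "\<dots> \<le> ennreal r * emeasure lebesgue O'"
  proof (intro mult_left_mono emeasure_mono)
    show "(\<Union>i\<in>C. B i) \<subseteq> O'" using C(2) by (auto simp: B_def K_def subset_iff)
  qed (use O' in auto)
  also have "emeasure lebesgue O' = emeasure lebesgue (E \<union> (O' - E))"
    using O'(2) by (simp add: Un_absorb1)
  also have "\<dots> \<le> emeasure lebesgue E + emeasure lebesgue (O' - E)"
    using E O' by (intro emeasure_subadditive) auto
  also have "\<dots> \<le> emeasure lebesgue E + ennreal (e / r)"
    using O'(4) by (intro add_left_mono) auto
  also have "ennreal r * (emeasure lebesgue E + ennreal (e / r)) =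
             ennreal r * emeasure lebesgue E + ennreal e"
    using r e by (simp add: distrib_left ennreal_mult[symmetric])
  finally show "emeasure lebesgue (f ` E) \<le> ennreal r * emeasure lebesgue E + ennreal e"
    by (simp add: mult_left_mono)
qed

text \<open>Strict inequalities make this a countable intersection of open sets when
  \<open>f\<close> is continuous. The difference quotients of a Lipschitz \<open>f\<close> are
  bounded, so they can fail to converge at \<open>x\<close> only if \<open>x\<close> lies in one of
  these sets for some rational \<open>r < R\<close>.\<close>

definition osc :: "('a::real_normed_vector \<Rightarrow> real) \<Rightarrow> 'a \<Rightarrow> real \<Rightarrow> real \<Rightarrow> 'a set" where
  "osc f v r R = {x. \<forall>d>0. (\<exists>h. h \<noteq> 0 \<and> \<bar>h\<bar> < d \<and> (f (x + h *\<^sub>R v) - f x) / h < r) \<and>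
                          (\<exists>h. h \<noteq> 0 \<and> \<bar>h\<bar> < d \<and> R < (f (x + h *\<^sub>R v) - f x) / h)}"

text \<open>For each fixed \<open>h\<close> the quotient is continuous in \<open>x\<close>, so the
  uncountable unions over \<open>h\<close> are open; letting \<open>d\<close> run through the
  numbers \<open>inverse (real (Suc n))\<close> makes the intersection countable.\<close>

lemma osc_borel:
  assumes "continuous_on UNIV f"
  shows "osc f v r R \<in> sets borel"
proof -
  define A where "A n = (\<Union>h\<in>{h. h \<noteq> 0 \<and> \<bar>h\<bar> < inverse (real (Suc n))}. {x. (f (x + h *\<^sub>R v) - f x) / h < r})" for n
  define B where "B n = (\<Union>h\<in>{h. h \<noteq> 0 \<and> \<bar>h\<bar> < inverse (real (Suc n))}. {x. R < (f (x + h *\<^sub>R v) - f x) / h})" for n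
  have cont: "continuous_on UNIV (\<lambda>x. (f (x + h *\<^sub>R v) - f x) / h)" for h
    by (cases "h = 0") (auto intro!: continuous_intros continuous_on_compose2[OF assms])
  have "open (A n)" "open (B n)" for n
    unfolding A_def B_def
    by (intro open_UN ballI open_Collect_less cont continuous_intros)+
  moreover have "osc f v r R = (\<Inter>n. A n \<inter> B n)"
  proof (intro equalityI subsetI)
    fix x assume "x \<in> osc f v r R"
    then show "x \<in> (\<Inter>n. A n \<inter> B n)" unfolding osc_def A_def B_def
      by (auto dest!: spec[where x="inverse (real (Suc _))"])
  next
    fix x assume x: "x \<in> (\<Inter>n. A n \<inter> B n)"
    show "x \<in> osc f v r R"
      unfolding osc_def
    proof (intro CollectI allI impI)
      fix d :: real assume "0 < d"
      then obtain n where "inverse (real (Suc n)) < d" using reals_Archimedean by blast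
      moreover have "x \<in> A n" "x \<in> B n" using x by auto
      ultimately show "(\<exists>h. h \<noteq> 0 \<and> \<bar>h\<bar> < d \<and> (f (x + h *\<^sub>R v) - f x) / h < r) \<and>
            (\<exists>h. h \<noteq> 0 \<and> \<bar>h\<bar> < d \<and> R < (f (x + h *\<^sub>R v) - f x) / h)"
        unfolding A_def B_def using less_trans by (auto; blast)
    qed
  qed
  ultimately show ?thesis by (auto intro!: sets.countable_INT' sets.Int borel_open)
qed

lemma frequently_at_0_iff:
  "frequently P (at (0::real)) \<longleftrightarrow> (\<forall>d>0. \<exists>h. h \<noteq> 0 \<and> \<bar>h\<bar> < d \<and> P h)"
  by (auto simp: frequently_def eventually_at dist_real_def)

text \<open>The limit is the lower limit, obtained as the supremum \<open>l\<close> of the eventual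
  lower bounds. If the quotients did not eventually stay below some \<open>a > l\<close>, two
  rationals between \<open>l\<close> and \<open>a\<close> would put \<open>x\<close> into a set
  \<open>osc\<close>.\<close>

lemma osc_empty_imp_tendsto:
  fixes f :: "'a::real_normed_vector \<Rightarrow> real"
  assumes lip: "L-lipschitz_on UNIV f"
    and no: "\<And>r R. r \<in> \<rat> \<Longrightarrow> R \<in> \<rat> \<Longrightarrow> r < R \<Longrightarrow> x \<notin> osc f v r R"
  shows "\<exists>l. ((\<lambda>h. (f (x + h *\<^sub>R v) - f x) / h) \<longlongrightarrow> l) (at 0)"
proof -
  define q where "q h = (f (x + h *\<^sub>R v) - f x) / h" for h
  define M where "M = L * norm v"
  have bnd: "\<bar>q h\<bar> \<le> M" if "h \<noteq> 0" for h
  proof -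
    have "\<bar>f (x + h *\<^sub>R v) - f x\<bar> \<le> L * (\<bar>h\<bar> * norm v)"
      using lipschitz_onD[OF lip, of "x + h *\<^sub>R v" x] by (simp add: dist_norm)
    then show ?thesis using that by (simp add: q_def M_def divide_le_eq abs_divide mult_ac)
  qed
  define S where "S = {r. eventually (\<lambda>h. r \<le> q h) (at 0)}"
  define l where "l = Sup S"
  have evM: "eventually (\<lambda>h. - M \<le> q h \<and> q h \<le> M) (at 0)"
    using bnd by (auto simp: eventually_at abs_le_iff intro!: exI[of _ 1]) (smt (verit) bnd)+
  have "- M \<in> S" using evM by (auto simp: S_def elim: eventually_mono)
  have ub: "r \<le> M" if "r \<in> S" for r
  proof -
    have "eventually (\<lambda>h. r \<le> M) (at (0::real))"
      using that evM unfolding S_def mem_Collect_eq by eventually_elim simp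
    then show ?thesis by (simp add: eventually_const_iff)
  qed
  have bdd: "bdd_above S" by (rule bdd_aboveI[OF ub])
  have "(q \<longlongrightarrow> l) (at 0)"
  proof (rule order_tendstoI)
    fix a assume "a < l"
    then obtain r where "r \<in> S" "a < r"
      using \<open>- M \<in> S\<close> unfolding l_def by (metis empty_iff less_cSup_iff bdd)
    then show "eventually (\<lambda>h. a < q h) (at 0)"
      unfolding S_def by (auto elim: eventually_mono)
  next
    fix a assume "l < a"
    then obtain r where r: "r \<in> \<rat>" "l < r" "r < a" using Rats_dense_in_real by blast
    obtain R where R: "R \<in> \<rat>" "r < R" "R < a" using r(3) Rats_dense_in_real by blast
    have "r \<notin> S" using r(2) cSup_upper[OF _ bdd] unfolding l_def by fastforce
    then have f1: "frequently (\<lambda>h. q h < r) (at 0)"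
      unfolding S_def frequently_def by (auto simp: not_less)
    have "\<not> frequently (\<lambda>h. R < q h) (at 0)"
      using no[OF r(1) R(1,2)] f1 unfolding osc_def frequently_at_0_iff q_def by blast
    then have "eventually (\<lambda>h. q h \<le> R) (at 0)" by (simp add: not_frequently not_less)
    then show "eventually (\<lambda>h. q h < a) (at 0)" using R(3) by (auto elim: eventually_mono)
  qed
  then show ?thesis unfolding q_def by blast
qed

text \<open>The covering estimate is applied to \<open>f\<close> with factor \<open>r\<close> and
  then to its inverse \<open>g\<close> with factor \<open>1 / R\<close>, since slopes of
  \<open>f\<close> above \<open>R\<close> are slopes of \<open>g\<close> below \<open>1 / R\<close>.
  Going there and back bounds the measure of \<open>E\<close> by \<open>r / R\<close> times itself;
  cutting by a box makes that measure finite, so it is zero.\<close>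

lemma negligible_osc_expanding:
  fixes f :: "real \<Rightarrow> real"
  assumes lip: "L-lipschitz_on UNIV f" and exp: "\<And>x y. x \<le> y \<Longrightarrow> y - x \<le> f y - f x" and rR: "r < R"
  shows "negligible (osc f 1 r R)"
proof -
  have mono: "strict_mono f"
  proof (rule strict_monoI)
    fix x y :: real assume "x < y" then show "f x < f y" using exp[of x y] by linarith
  qed
  have cont: "continuous_on UNIV f" using lip lipschitz_on_continuous_on by blast
  have surj: "\<exists>x. f x = y" for y
  proof -
    define b where "b = \<bar>y - f 0\<bar>"
    have "f (-b) \<le> y" "y \<le> f b" using exp[of "-b" 0] exp[of 0 b] by (auto simp: b_def)
    then show ?thesis using IVT'[of f "-b" y b] continuous_on_subset[OF cont]
      by (auto simp: b_def)
  qed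
  have inj: "inj f" using mono strict_mono_imp_inj_on by blast
  define g where "g = inv f"
  have fg: "f (g y) = y" for y unfolding g_def using surj by (metis f_inv_into_f rangeI)
  have gf: "g (f x) = x" for x unfolding g_def using inj by simp
  have gmono: "strict_mono g"
    by (rule strict_monoI) (metis fg mono strict_mono_less)
  have glip: "1-lipschitz_on UNIV g"
  proof (rule lipschitz_onI)
    fix x y show "dist (g x) (g y) \<le> 1 * dist x y"
      using exp[of "g x" "g y"] exp[of "g y" "g x"] unfolding fg dist_real_def by (cases "g x \<le> g y") auto
  qed simp
  have gcont: "continuous_on UNIV g" using glip lipschitz_on_continuous_on by blast
  have slope1: "1 \<le> (f (x + h) - f x) / h" if "h \<noteq> 0" for x h
  proof (cases "h > 0")
    case True then show ?thesis using exp[of x "x + h"] by (simp add: le_divide_eq)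
  next
    case False then show ?thesis using that exp[of "x + h" x] by (simp add: le_divide_eq)
  qed
  define A where "A = osc f 1 r R"
  have A: "A \<in> sets borel" unfolding A_def by (rule osc_borel[OF cont])
  \<comment> \<open>All slopes are at least 1, so a point of \<open>A\<close> forces
    \<open>1 < r\<close>; the factors \<open>r\<close> and \<open>1 / R\<close> are then positive,
    as the covering estimate demands.\<close>
  have r1: "1 < r" if "A \<noteq> {}"
  proof -
    obtain x where "x \<in> A" using \<open>A \<noteq> {}\<close> by blast
    then obtain h where "h \<noteq> 0" "(f (x + h) - f x) / h < r"
      unfolding A_def osc_def by (auto dest: spec[of _ 1])
    then show ?thesis using slope1[of h x] by linarith
  qed
  have "negligible (A \<inter> cbox a b)" for a b
  proof (cases "A = {}")
    case False
    then have r: "1 < r" by (rule r1)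
    define E where "E = A \<inter> cbox a b"
    have E: "E \<in> sets borel" using A by (auto simp: E_def)
    have fE: "f ` E = g -` E" using fg gf by (auto simp: image_iff) metis
    have fEb: "f ` E \<in> sets borel"
      unfolding fE using measurable_sets[OF borel_measurable_continuous_onI[OF gcont] E] by simp
    have "emeasure lebesgue (f ` E) \<le> ennreal r * emeasure lebesgue E"
    proof (rule emeasure_image_le_slope[OF mono lip])
      show "E \<in> sets lebesgue" using E by auto
      show "\<exists>h. h \<noteq> 0 \<and> \<bar>h\<bar> < d \<and> (f (x + h) - f x) / h < r" if "x \<in> E" "0 < d" for x d
        using that by (auto simp: E_def A_def osc_def)
    qed (use r in simp)
    moreover have "emeasure lebesgue (g ` (f ` E)) \<le> ennreal (1 / R) * emeasure lebesgue (f ` E)"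
    proof (rule emeasure_image_le_slope[OF gmono glip])
      show "f ` E \<in> sets lebesgue" using fEb by auto
      show "\<exists>k. k \<noteq> 0 \<and> \<bar>k\<bar> < d \<and> (g (y + k) - g y) / k < 1 / R"
        if y: "y \<in> f ` E" and d: "0 < d" for y d
      proof -
        obtain x where x: "x \<in> E" "y = f x" using y by auto
        \<comment> \<open>The increment \<open>k\<close> of \<open>f\<close> is at most
          \<open>L\<close> times as long as \<open>h\<close> and has to remain below
          \<open>d\<close>; adding 1 keeps the denominator positive.\<close>
        have "0 < d / (\<bar>L\<bar> + 1)" using d by (simp add: add_nonneg_pos)
        then obtain h where h: "h \<noteq> 0" "\<bar>h\<bar> < d / (\<bar>L\<bar> + 1)" "R < (f (x + h) - f x) / h"
          using x(1) by (auto simp: E_def A_def osc_def)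
        define k where "k = f (x + h) - f x"
        have k0: "k \<noteq> 0" using h(1) inj by (auto simp: k_def inj_eq)
        have "\<bar>k\<bar> \<le> L * \<bar>h\<bar>" using lipschitz_onD[OF lip, of "x + h" x] by (simp add: k_def dist_real_def)
        also have "\<dots> \<le> (\<bar>L\<bar> + 1) * \<bar>h\<bar>" by (intro mult_right_mono) auto
        also have "\<dots> < d" using h(2) by (simp add: less_divide_eq add_nonneg_pos mult.commute)
        finally have "\<bar>k\<bar> < d" .
        moreover have "(g (y + k) - g y) / k = h / k" by (simp add: x(2) k_def gf)
        moreover have "h / k < 1 / R"
        proof -
          have "R < k / h" "0 < R" using h(3) r rR by (auto simp: k_def)
          then have "1 / (k / h) < 1 / R" by (intro divide_strict_left_mono mult_pos_pos) auto
          then show ?thesis by simp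
        qed
        ultimately show ?thesis using k0 by metis
      qed
    qed (use r rR in simp)
    moreover have "g ` (f ` E) = E" using gf by (auto simp: image_iff)
    ultimately have "emeasure lebesgue E \<le> ennreal (1 / R) * (ennreal r * emeasure lebesgue E)"
      by (metis (no_types, lifting) mult_left_mono order_trans zero_le)
    also have "\<dots> = ennreal (r / R) * emeasure lebesgue E"
      using r rR by (simp add: mult.assoc[symmetric] ennreal_mult[symmetric])
    finally have le: "emeasure lebesgue E \<le> ennreal (r / R) * emeasure lebesgue E" .
    have fin: "emeasure lebesgue E < \<infinity>"
    proof -
      have "emeasure lebesgue E \<le> emeasure lebesgue (cbox a b)"
        by (rule emeasure_mono) (auto simp: E_def)
      also have "\<dots> < \<infinity>" using emeasure_lborel_cbox_finite[of a b] by simp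
      finally show ?thesis .
    qed
    then obtain m where m: "emeasure lebesgue E = ennreal m" "0 \<le> m"
      by (cases "emeasure lebesgue E") auto
    have "m \<le> r / R * m" using le r rR m by (simp add: ennreal_mult[symmetric])
    moreover have "r / R < 1" using r rR by simp
    ultimately have "m = 0" using m(2) mult_right_less_imp_less by (smt (verit) mult_less_cancel_right2)
    then show ?thesis using m E by (auto simp: E_def negligible_iff_null_sets null_sets_def)
  qed auto
  then have "negligible A"
    by (subst negligible_on_intervals) blast
  then show ?thesis by (simp add: A_def)
qed

text \<open>Adding \<open>(L + 1) * x\<close> raises every difference quotient by
  \<open>L + 1\<close>: slopes that were at least \<open>- L\<close> become at least 1, and the
  oscillation set stays the same once both thresholds are raised alike.\<close>

lemma negligible_osc_real:
  fixes f :: "real \<Rightarrow> real"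
  assumes lip: "L-lipschitz_on UNIV f" and rR: "r < R"
  shows "negligible (osc f 1 r R)"
proof -
  define F where "F x = f x + (L + 1) * x" for x
  have L: "0 \<le> L" using lip lipschitz_on_nonneg by blast
  have d: "\<bar>f y - f x\<bar> \<le> L * \<bar>y - x\<bar>" for x y
    using lipschitz_onD[OF lip, of y x] by (simp add: dist_real_def)
  have "(L + (L + 1))-lipschitz_on UNIV F"
    unfolding F_def
  proof (intro lipschitz_intros lip)
    show "(L + 1)-lipschitz_on UNIV ((*) (L + 1))"
      using L by (auto intro!: lipschitz_onI simp: dist_real_def right_diff_distrib[symmetric] abs_mult simp del: right_diff_distrib)
  qed
  moreover have "y - x \<le> F y - F x" if "x \<le> y" for x y
    using d[of y x] that by (simp add: F_def abs_le_iff algebra_simps)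
  ultimately have "negligible (osc F 1 (r + (L + 1)) (R + (L + 1)))"
    using rR by (intro negligible_osc_expanding) auto
  moreover have "(F (x + h) - F x) / h = (f (x + h) - f x) / h + (L + 1)" if "h \<noteq> 0" for x h
    using that by (simp add: F_def field_simps)
  then have "osc F 1 (r + (L + 1)) (R + (L + 1)) = osc f 1 r R"
    unfolding osc_def by (auto; smt (verit))
  ultimately show ?thesis by simp
qed

text \<open>Translation invariance makes the measure of \<open>N\<close> equal to the average
  measure of its translates along \<open>v\<close>, with \<open>t\<close> in the unit interval.
  Exchanging the integrals leaves, for each \<open>x\<close>, the measure of a set of parameters
  \<open>t\<close> that is null by hypothesis. No coordinates adapted to \<open>v\<close> have to be
  chosen.\<close>

lemma null_set_if_null_on_lines:
  fixes N :: "'a::euclidean_space set"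
  assumes N: "N \<in> sets borel" and line: "\<And>x. {t. x + t *\<^sub>R v \<in> N} \<in> null_sets lborel"
  shows "N \<in> null_sets lborel"
proof -
  have shift: "(\<integral>\<^sup>+x. indicator N (x + t *\<^sub>R v) \<partial>lborel) = emeasure lborel N" for t
  proof -
    have "emeasure lborel N = (\<integral>\<^sup>+x. indicator N x \<partial>lborel)" using N by simp
    also have "\<dots> = (\<integral>\<^sup>+x. indicator N x \<partial>distr lborel borel ((+) (t *\<^sub>R v)))"
      by (simp only: lborel_distr_plus)
    also have "\<dots> = (\<integral>\<^sup>+x. indicator N (t *\<^sub>R v + x) \<partial>lborel)"
      using N by (intro nn_integral_distr) auto
    finally show ?thesis by (simp add: add.commute)
  qed
  have meas: "(\<lambda>(x, t). indicator N (x + t *\<^sub>R v) * indicator {0..1::real} t :: ennreal)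
      \<in> borel_measurable (lborel \<Otimes>\<^sub>M lborel)"
  proof -
    have "(\<lambda>p. fst p + snd p *\<^sub>R v) \<in> (lborel \<Otimes>\<^sub>M lborel) \<rightarrow>\<^sub>M (borel :: 'a measure)" by measurable
    then have "(\<lambda>p. indicator N (fst p + snd p *\<^sub>R v) :: ennreal) \<in> borel_measurable (lborel \<Otimes>\<^sub>M lborel)"
      by (rule measurable_compose) (use N in measurable)
    then show ?thesis by (simp add: case_prod_beta)
  qed
  have "emeasure lborel N = (\<integral>\<^sup>+t. (\<integral>\<^sup>+x. indicator N (x + t *\<^sub>R v) \<partial>lborel) * indicator {0..1::real} t \<partial>lborel)"
    by (simp add: shift nn_integral_cmult_indicator)
  also have "\<dots> = (\<integral>\<^sup>+t. (\<integral>\<^sup>+x. indicator N (x + t *\<^sub>R v) * indicator {0..1::real} t \<partial>lborel) \<partial>lborel)"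
    by (intro nn_integral_cong nn_integral_multc[symmetric])
       (auto intro!: measurable_compose[OF _ borel_measurable_indicator[OF N]])
  also have "\<dots> = (\<integral>\<^sup>+x. (\<integral>\<^sup>+t. indicator N (x + t *\<^sub>R v) * indicator {0..1::real} t \<partial>lborel) \<partial>lborel)"
    by (rule lborel_pair.Fubini'[OF meas])
  also have "\<dots> = (\<integral>\<^sup>+(x::'a). 0 \<partial>lborel)"
  proof (rule nn_integral_cong)
    fix x :: 'a
    have "AE t in lborel. t \<notin> {t. x + t *\<^sub>R v \<in> N}" using line by (rule AE_not_in)
    then show "(\<integral>\<^sup>+t. indicator N (x + t *\<^sub>R v) * indicator {0..1::real} t \<partial>lborel) = 0"
      by (subst nn_integral_cong_AE[where v="\<lambda>_. 0"]) (auto elim!: eventually_mono)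
  qed
  finally show ?thesis using N by (simp add: null_sets_def)
qed

text \<open>On a line in direction \<open>v\<close> the function depends on one real variable and is
  again Lipschitz; the trace of \<open>osc f v r R\<close> on the line is the oscillation set of
  this restriction, hence null.\<close>

lemma AE_directional_derivative:
  fixes f :: "'a::euclidean_space \<Rightarrow> real"
  assumes lip: "L-lipschitz_on UNIV f"
  shows "AE x in lborel. \<exists>l. ((\<lambda>h. (f (x + h *\<^sub>R v) - f x) / h) \<longlongrightarrow> l) (at 0)"
proof -
  have cont: "continuous_on UNIV f" using lip lipschitz_on_continuous_on by blast
  have null: "osc f v r R \<in> null_sets lborel" if "r < R" for r R
  proof (rule null_set_if_null_on_lines[OF osc_borel[OF cont], of v])
    fix x
    define k where "k t = f (x + t *\<^sub>R v)" for t
    have "(L * norm v)-lipschitz_on UNIV k"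
    proof (rule lipschitz_onI)
      fix s t
      have "dist (k s) (k t) \<le> L * norm ((s - t) *\<^sub>R v)"
        using lipschitz_onD[OF lip, of "x + s *\<^sub>R v" "x + t *\<^sub>R v"]
        by (simp add: k_def dist_norm scaleR_diff_left)
      then show "dist (k s) (k t) \<le> L * norm v * dist s t" by (simp add: dist_norm mult_ac)
    qed (use lipschitz_on_nonneg[OF lip] in simp)
    then have "negligible (osc k 1 r R)" "osc k 1 r R \<in> sets borel"
      using negligible_osc_real[OF _ that] osc_borel lipschitz_on_continuous_on by blast+
    moreover have "osc k 1 r R = {t. x + t *\<^sub>R v \<in> osc f v r R}"
      by (simp add: osc_def k_def algebra_simps)
    ultimately show "{t. x + t *\<^sub>R v \<in> osc f v r R} \<in> null_sets lborel"
      by (simp add: negligible_iff_null_sets null_sets_completion_iff)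
  qed
  \<comment> \<open>Rational thresholds leave only countably many null sets to discard.\<close>
  have "AE x in lborel. \<forall>r\<in>\<rat>. \<forall>R\<in>\<rat>. r < R \<longrightarrow> x \<notin> osc f v r R"
    by (intro AE_ball_countable[THEN iffD2] countable_rat ballI AE_impI AE_not_in null)
  then show ?thesis
    by eventually_elim (use osc_empty_imp_tendsto[OF lip] in blast)
qed

subsection \<open>Rademacher's theorem\<close>

lemma AE_lborel_translate:
  fixes c :: "'a::euclidean_space"
  assumes "AE x in lborel. P x"
  shows "AE x in lborel. P (c + x)"
proof -
  have "AE x in distr lborel borel ((+) c). P x" using assms by (simp only: lborel_distr_plus)
  then show ?thesis by (rule AE_distrD[rotated]) simp
qed

text \<open>Since \<open>K\<close> exceeds the bound on \<open>g\<close>, the function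
  \<open>1 + g / K\<close> is almost everywhere a nonnegative density. The measure it defines agrees
  with Lebesgue measure on boxes, hence everywhere, and densities are unique almost everywhere. The
  shift by 1 turns a question about a signed function into one about positive measures.\<close>

lemma AE_zero_if_box_integrals_zero:
  fixes g :: "'a::euclidean_space \<Rightarrow> real"
  assumes g[measurable]: "g \<in> borel_measurable borel" and bnd: "AE x in lborel. \<bar>g x\<bar> \<le> M"
    and zero: "\<And>l u. (LINT x:box l u|lborel. g x) = 0"
  shows "AE x in lborel. g x = 0"
proof -
  define K where "K = \<bar>M\<bar> + 1"
  have K: "K > 0" by (simp add: K_def)
  have bK: "AE x in lborel. \<bar>g x\<bar> \<le> K" using bnd by eventually_elim (simp add: K_def)
  define D where "D = density lborel (\<lambda>x. ennreal (1 + g x / K))"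
  have "lborel = D"
  proof (rule lborel_eqI)
    fix l u :: 'a assume lu: "\<And>b. b \<in> Basis \<Longrightarrow> l \<bullet> b \<le> u \<bullet> b"
    have fin: "emeasure lborel (box l u) < \<infinity>" by (rule emeasure_bounded_finite[OF bounded_box])
    have int1: "integrable lborel (\<lambda>x. indicator (box l u) x :: real)"
      by (rule integrable_real_indicator[OF _ fin]) simp
    have intg: "integrable lborel (\<lambda>x. indicator (box l u) x * g x)"
    proof (rule Bochner_Integration.integrable_bound)
      show "integrable lborel (\<lambda>x. K * indicator (box l u) x)" using int1 by simp
      show "AE x in lborel. norm (indicator (box l u) x * g x) \<le> norm (K * indicator (box l u) x)"
        using bK by eventually_elim (auto simp: indicator_def)
    qed simp
    have eq: "indicator (box l u) x * (1 + g x / K)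
               = indicator (box l u) x + (indicator (box l u) x * g x) / K" for x
      by (simp add: algebra_simps)
    have "emeasure D (box l u) = (\<integral>\<^sup>+x. ennreal (1 + g x / K) * indicator (box l u) x \<partial>lborel)"
      by (simp add: D_def emeasure_density)
    also have "\<dots> = (\<integral>\<^sup>+x. ennreal (indicator (box l u) x * (1 + g x / K)) \<partial>lborel)"
      by (intro nn_integral_cong) (auto simp: indicator_def)
    also have "\<dots> = ennreal (LINT x|lborel. indicator (box l u) x * (1 + g x / K))"
    proof (rule nn_integral_eq_integral)
      show "integrable lborel (\<lambda>x. indicator (box l u) x * (1 + g x / K))"
        unfolding eq using int1 intg by simp
      show "AE x in lborel. 0 \<le> indicator (box l u) x * (1 + g x / K)"
        using bK by eventually_elim (use K in \<open>auto simp: indicator_def field_simps abs_le_iff\<close>)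
    qed
    also have "(LINT x|lborel. indicator (box l u) x * (1 + g x / K)) = measure lborel (box l u)"
      unfolding eq using int1 intg zero[of l u] by (simp add: set_lebesgue_integral_def)
    also have "ennreal (measure lborel (box l u)) = (\<Prod>b\<in>Basis. (u - l) \<bullet> b)"
      using lu by (simp add: measure_lborel_box_eq)
    finally show "emeasure D (box l u) = ennreal (\<Prod>b\<in>Basis. (u - l) \<bullet> b)" .
  qed (simp add: D_def)
  then have "density lborel (\<lambda>x. 1 :: ennreal) = density lborel (\<lambda>x. ennreal (1 + g x / K))"
    by (simp add: D_def density_1)
  then have "AE x in lborel. (1 :: ennreal) = ennreal (1 + g x / K)"
    by (subst (asm) sigma_finite_measure.density_unique_iff[OF sigma_finite_lborel]) auto
  with bK show ?thesis
  proof eventually_elim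
    case (elim x)
    then have "1 + g x / K = 1"
      by (metis ennreal_1 ennreal_inj ennreal_neg linorder_le_cases zero_le_one zero_neq_one)
    then show ?case using K by simp
  qed
qed

text \<open>Taking the limit along one sequence makes this a total function that is Borel measurable
  for continuous \<open>f\<close>. It has an arbitrary value where the sequence diverges and equals
  the directional derivative wherever that exists.\<close>

definition dir_deriv :: "('a::real_normed_vector \<Rightarrow> real) \<Rightarrow> 'a \<Rightarrow> 'a \<Rightarrow> real" where
  "dir_deriv f v x = lim (\<lambda>n. (f (x + inverse (real (Suc n)) *\<^sub>R v) - f x) / inverse (real (Suc n)))"

lemma inverse_Suc_at_0: "filterlim (\<lambda>n. inverse (real (Suc n))) (at 0) sequentially"
  using LIMSEQ_inverse_real_of_nat by (auto simp: filterlim_at)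

lemma dir_deriv_eqI:
  assumes "((\<lambda>h. (f (x + h *\<^sub>R v) - f x) / h) \<longlongrightarrow> l) (at 0)"
  shows "dir_deriv f v x = l"
  unfolding dir_deriv_def
  by (rule limI) (use filterlim_compose[OF assms inverse_Suc_at_0] in \<open>simp add: o_def\<close>)

lemma lipschitz_quotient_bound:
  fixes f :: "'a::real_normed_vector \<Rightarrow> real"
  assumes "L-lipschitz_on UNIV f"
  shows "\<bar>(f (x + h *\<^sub>R v) - f x) / h\<bar> \<le> L * norm v"
proof (cases "h = 0")
  case False
  have "\<bar>f (x + h *\<^sub>R v) - f x\<bar> \<le> L * (\<bar>h\<bar> * norm v)"
    using lipschitz_onD[OF assms, of "x + h *\<^sub>R v" x] by (simp add: dist_norm)
  then show ?thesis using False by (simp add: divide_le_eq abs_divide mult_ac)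
qed (use lipschitz_on_nonneg[OF assms] in simp)

locale lipschitz_function =
  fixes f :: "'a::euclidean_space \<Rightarrow> real" and L :: real
  assumes lip: "L-lipschitz_on UNIV f"
begin

lemma cont: "continuous_on UNIV f"
  using lip lipschitz_on_continuous_on by blast

lemma f_measurable[measurable]: "f \<in> borel_measurable borel"
  using cont by (rule borel_measurable_continuous_onI)

lemma dir_deriv_measurable[measurable]: "dir_deriv f v \<in> borel_measurable borel"
  unfolding dir_deriv_def by measurable

lemma AE_dir_deriv: "AE x in lborel. ((\<lambda>h. (f (x + h *\<^sub>R v) - f x) / h) \<longlongrightarrow> dir_deriv f v x) (at 0)"
  using AE_directional_derivative[OF lip, of v] by eventually_elim (use dir_deriv_eqI in blast)

lemma AE_dir_deriv_bound: "AE x in lborel. \<bar>dir_deriv f v x\<bar> \<le> L * norm v"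
  using AE_dir_deriv[of v]
proof eventually_elim
  case (elim x)
  then have "((\<lambda>h. \<bar>(f (x + h *\<^sub>R v) - f x) / h\<bar>) \<longlongrightarrow> \<bar>dir_deriv f v x\<bar>) (at 0)"
    by (rule tendsto_rabs)
  then show ?case
    by (rule tendsto_upperbound) (use lipschitz_quotient_bound[OF lip] in auto)
qed

text \<open>Dominated convergence with the constant \<open>L * norm v\<close> on \<open>Q\<close> as
  majorant. The translation \<open>c\<close> is carried along so that the result also covers
  averages over a moving copy of \<open>Q\<close>.\<close>

lemma set_integral_quotient_tendsto:
  assumes Q[measurable]: "Q \<in> sets borel" and fin: "emeasure lborel Q < \<infinity>"
    and h: "\<And>n. h n \<noteq> 0" "h \<longlonglongrightarrow> 0"
  shows "(\<lambda>n. LINT x:Q|lborel. (f (c + x + h n *\<^sub>R v) - f (c + x)) / h n)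
           \<longlonglongrightarrow> (LINT x:Q|lborel. dir_deriv f v (c + x))"
  unfolding set_lebesgue_integral_def
proof (rule integral_dominated_convergence[where w="\<lambda>x. indicator Q x *\<^sub>R (L * norm v)"])
  show "integrable lborel (\<lambda>x. indicator Q x *\<^sub>R (L * norm v))" using fin by simp
  have lim: "filterlim h (at 0) sequentially" using h by (simp add: filterlim_at)
  show "AE x in lborel. (\<lambda>n. indicator Q x *\<^sub>R ((f (c + x + h n *\<^sub>R v) - f (c + x)) / h n))
          \<longlonglongrightarrow> indicator Q x *\<^sub>R dir_deriv f v (c + x)"
    using AE_lborel_translate[OF AE_dir_deriv[of v], of c]
    by eventually_elim (intro tendsto_intros filterlim_compose[OF _ lim])
  show "AE x in lborel. norm (indicator Q x *\<^sub>R ((f (c + x + h n *\<^sub>R v) - f (c + x)) / h n))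
          \<le> indicator Q x *\<^sub>R (L * norm v)" for n
    using lipschitz_quotient_bound[OF lip] by (auto simp: indicator_def)
qed measurable

end

lemma box_integrable:
  fixes g :: "'a::euclidean_space \<Rightarrow> real"
  assumes "g \<in> borel_measurable borel" "AE x in lborel. \<bar>g x\<bar> \<le> M"
  shows "set_integrable lborel (box l u) g"
  unfolding set_integrable_def
proof (rule Bochner_Integration.integrable_bound)
  show "integrable lborel (\<lambda>x. M * indicator (box l u) x)"
    by (intro integrable_mult_right integrable_real_indicator emeasure_bounded_finite bounded_box) simp
  show "AE x in lborel. norm (indicator (box l u) x *\<^sub>R g x) \<le> norm (M * indicator (box l u) x)"
    using assms(2) by eventually_elim (auto simp: indicator_def)
qed (use assms(1) in simp)

text \<open>The integrand tends to 0 off the frontier of \<open>Q\<close>, which is null because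
  \<open>Q\<close> is convex. As \<open>\<bar>h n\<bar> \<le> 1\<close>, all translates stay in one
  ball, whose indicator is the majorant.\<close>

lemma box_translate_integral_tendsto_0:
  fixes Q :: "'a::euclidean_space set"
  assumes Q: "Q = box l u" and h: "h \<longlonglongrightarrow> (0::real)" and h1: "\<And>n. \<bar>h n\<bar> \<le> 1"
  shows "(\<lambda>n. LINT x|lborel. \<bar>indicator Q (x - h n *\<^sub>R v) - indicator Q x :: real\<bar>) \<longlonglongrightarrow> 0"
proof -
  obtain b where b: "\<And>x. x \<in> Q \<Longrightarrow> norm x \<le> b"
    using bounded_box[of l u] unfolding Q bounded_iff by blast
  have [measurable]: "Q \<in> sets borel" by (simp add: Q)
  define B where "B = cball (0::'a) (b + norm v)"
  have B: "B \<in> sets borel" "emeasure lborel B < \<infinity>"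
    using emeasure_bounded_finite[OF bounded_cball] by (auto simp: B_def)
  have "(\<lambda>n. LINT x|lborel. \<bar>indicator Q (x - h n *\<^sub>R v) - indicator Q x :: real\<bar>)
          \<longlonglongrightarrow> (LINT (x::'a)|lborel. (0::real))"
  proof (rule integral_dominated_convergence[where w="\<lambda>x. indicator B x"])
    show "integrable lborel (\<lambda>x. indicator B x :: real)" using B by simp
    have "frontier Q \<in> null_sets lborel"
      using negligible_convex_frontier[of Q] by (simp add: Q negligible_iff_null_sets null_sets_completion_iff)
    then have "AE x in lborel. x \<notin> frontier Q" by (rule AE_not_in)
    then show "AE x in lborel. (\<lambda>n. \<bar>indicator Q (x - h n *\<^sub>R v) - indicator Q x :: real\<bar>) \<longlonglongrightarrow> 0"
    proof eventually_elim
      case (elim x)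
      have lim: "(\<lambda>n. x - h n *\<^sub>R v) \<longlonglongrightarrow> x"
        using tendsto_diff[OF tendsto_const tendsto_scaleR[OF h tendsto_const], of x v] by simp
      have "isCont (indicator Q :: 'a \<Rightarrow> real) x"
        using elim by (simp add: isCont_indicator)
      then have "(\<lambda>n. indicator Q (x - h n *\<^sub>R v) :: real) \<longlonglongrightarrow> indicator Q x"
        using lim isCont_tendsto_compose by blast
      then show ?case
        using tendsto_rabs_zero tendsto_diff[OF _ tendsto_const[of "indicator Q x"]] by fastforce
    qed
    show "AE x in lborel. norm \<bar>indicator Q (x - h n *\<^sub>R v) - indicator Q x :: real\<bar> \<le> indicator B x" for n
    proof (intro AE_I2)
      fix x
      have "x \<in> B" if "x - h n *\<^sub>R v \<in> Q \<or> x \<in> Q"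
      proof -
        have "norm x \<le> norm (x - h n *\<^sub>R v) + norm (h n *\<^sub>R v)" using norm_triangle_sub by (metis add.commute norm_minus_commute)
        moreover have "norm (h n *\<^sub>R v) \<le> norm v" using h1[of n] by (simp add: mult_left_le_one_le)
        ultimately have "norm x \<le> b + norm v"
          using that b[of x] b[of "x - h n *\<^sub>R v"] norm_ge_zero[of v] by linarith
        then show ?thesis by (simp add: B_def)
      qed
      then show "norm \<bar>indicator Q (x - h n *\<^sub>R v) - indicator Q x :: real\<bar> \<le> indicator B x"
        by (auto simp: indicator_def split: if_splits)
    qed
  qed measurable
  then show ?thesis by simp
qed

context lipschitz_function
begin

text \<open>Directional derivatives of a Lipschitz function need not be additive at a given point,
  but their integrals are. The increment along \<open>v + w\<close> is one along \<open>v\<close>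
  followed by one along \<open>w\<close> from a shifted base point; moving that shift from the
  function to the box costs at most \<open>L * norm w\<close> times the measure of a symmetric
  difference of \<open>Q\<close> with its translate, which tends to 0.\<close>

lemma box_integral_dir_deriv_add:
  "(LINT x:box l u|lborel. dir_deriv f (v + w) x) =
   (LINT x:box l u|lborel. dir_deriv f v x) + (LINT x:box l u|lborel. dir_deriv f w x)"
proof -
  define Q where "Q = box l u"
  have Q[measurable]: "Q \<in> sets borel" "emeasure lborel Q < \<infinity>" using emeasure_bounded_finite[OF bounded_box] by (simp_all add: Q_def)
  define h where "h n = inverse (real (Suc n))" for n
  have h: "h n \<noteq> 0" "h \<longlonglongrightarrow> 0" "\<bar>h n\<bar> \<le> 1" for n
    using LIMSEQ_inverse_real_of_nat by (auto simp: h_def[abs_def] inverse_le_1_iff)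
  define q where "q v n x = (f (x + h n *\<^sub>R v) - f x) / h n" for v n x
  have qm[measurable]: "q v n \<in> borel_measurable borel" for v n unfolding q_def by measurable
  have qb: "\<bar>q v n x\<bar> \<le> L * norm v" for v n x
    unfolding q_def by (rule lipschitz_quotient_bound[OF lip])
  have lim: "(\<lambda>n. LINT x:Q|lborel. q v n x) \<longlonglongrightarrow> (LINT x:Q|lborel. dir_deriv f v x)" for v
    using set_integral_quotient_tendsto[OF Q h(1,2), of 0 v] by (simp add: q_def)
  have qint: "set_integrable lborel Q (q v n)" for v n
    unfolding Q_def by (rule box_integrable[of _ "L * norm v"]) (use qb in auto)
  have qint': "integrable lborel (\<lambda>x. indicator Q (x + c) * q w n x)" for n c
  proof (rule Bochner_Integration.integrable_bound)
    have "Q' \<in> sets borel" "emeasure lborel Q' < \<infinity>" if "Q' = (\<lambda>x. x + c) -` Q" for Q'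
    proof -
      have e: "Q' = box (l - c) (u - c)"
        by (auto simp: that Q_def mem_box algebra_simps)
      show "Q' \<in> sets borel" "emeasure lborel Q' < \<infinity>" unfolding e by (simp, rule emeasure_bounded_finite[OF bounded_box])
    qed
    note Q' = this[OF refl]
    show "integrable lborel (\<lambda>x. (L * norm w) * indicator ((\<lambda>x. x + c) -` Q) x)"
      using Q' by (intro integrable_mult_right integrable_real_indicator) auto
    show "AE x in lborel. norm (indicator Q (x + c) * q w n x)
            \<le> norm (L * norm w * indicator ((\<lambda>x. x + c) -` Q) x)"
      using qb[of w n] lipschitz_on_nonneg[OF lip] by (auto simp: indicator_def)
  qed measurable
  define E where "E n = (LINT x|lborel. \<bar>indicator Q (x - h n *\<^sub>R v) - indicator Q x :: real\<bar>)" for n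
  have E: "E \<longlonglongrightarrow> 0"
    unfolding E_def by (rule box_translate_integral_tendsto_0[OF Q_def h(2,3)])
  have step: "\<bar>(LINT x:Q|lborel. q (v + w) n x) - (LINT x:Q|lborel. q v n x) - (LINT x:Q|lborel. q w n x)\<bar>
        \<le> L * norm w * E n" for n
  proof -
    have qe: "q (v + w) n x = q v n x + q w n (x + h n *\<^sub>R v)" for x
      using h(1) by (simp add: q_def field_simps scaleR_right_distrib)
    have shift: "(LINT x|lborel. indicator Q x * q w n (x + h n *\<^sub>R v)) =
                 (LINT x|lborel. indicator Q (x - h n *\<^sub>R v) * q w n x)"
    proof -
      have "(LINT x|lborel. indicator Q (x - h n *\<^sub>R v) * q w n x) =
            (LINT x|distr lborel borel ((+) (h n *\<^sub>R v)). indicator Q (x - h n *\<^sub>R v) * q w n x)"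
        by (simp only: lborel_distr_plus)
      also have "\<dots> = (LINT x|lborel. indicator Q (h n *\<^sub>R v + x - h n *\<^sub>R v) * q w n (h n *\<^sub>R v + x))"
        by (rule integral_distr) measurable
      finally show ?thesis by (simp add: add.commute)
    qed
    have int2: "integrable lborel (\<lambda>x. indicator Q x * q w n (x + h n *\<^sub>R v))"
    proof -
      have "set_integrable lborel Q (\<lambda>x. q w n (x + h n *\<^sub>R v))"
        unfolding Q_def by (rule box_integrable[of _ "L * norm w"]) (use qb in auto)
      then show ?thesis by (simp add: set_integrable_def)
    qed
    have i1: "integrable lborel (\<lambda>x. indicator Q x * q v n x)" for v
      using qint[of v n] by (simp add: set_integrable_def)
    have i3: "integrable lborel (\<lambda>x. indicator Q (x - h n *\<^sub>R v) * q w n x)"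
      using qint'[of "- (h n *\<^sub>R v)" n] by simp
    have "(LINT x:Q|lborel. q (v + w) n x) - (LINT x:Q|lborel. q v n x) - (LINT x:Q|lborel. q w n x)
        = (LINT x|lborel. indicator Q (x - h n *\<^sub>R v) * q w n x) - (LINT x|lborel. indicator Q x * q w n x)"
      using i1 int2 by (simp add: set_lebesgue_integral_def qe distrib_left shift[symmetric])
    also have "\<dots> = (LINT x|lborel. (indicator Q (x - h n *\<^sub>R v) - indicator Q x) * q w n x)"
      using i1[of w] i3 by (simp add: left_diff_distrib)
    also have "\<bar>\<dots>\<bar> \<le> (LINT x|lborel. L * norm w * \<bar>indicator Q (x - h n *\<^sub>R v) - indicator Q x\<bar>)"
    proof -
      have int: "integrable lborel (\<lambda>x. (indicator Q (x - h n *\<^sub>R v) - indicator Q x) * q w n x)"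
        using i1[of w] i3 by (simp add: left_diff_distrib)
      have "\<bar>LINT x|lborel. (indicator Q (x - h n *\<^sub>R v) - indicator Q x) * q w n x\<bar>
         \<le> (LINT x|lborel. \<bar>(indicator Q (x - h n *\<^sub>R v) - indicator Q x) * q w n x\<bar>)"
        by (rule integral_abs_bound)
      also have "\<dots> \<le> (LINT x|lborel. L * norm w * \<bar>indicator Q (x - h n *\<^sub>R v) - indicator Q x\<bar>)"
      proof (rule integral_mono)
        have "integrable lborel (\<lambda>x. indicator Q (x - h n *\<^sub>R v) - indicator Q x :: real)"
        proof (rule Bochner_Integration.integrable_diff)
          show "integrable lborel (\<lambda>x. indicator Q x :: real)" using Q by simp
          have "(\<lambda>x. indicator Q (x - h n *\<^sub>R v) :: real) = indicator (box (l + h n *\<^sub>R v) (u + h n *\<^sub>R v))"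
            by (auto simp: fun_eq_iff indicator_def Q_def mem_box algebra_simps)
          then show "integrable lborel (\<lambda>x. indicator Q (x - h n *\<^sub>R v) :: real)"
            by (simp, intro integrable_real_indicator emeasure_bounded_finite bounded_box) simp
        qed
        then show "integrable lborel (\<lambda>x. L * norm w * \<bar>indicator Q (x - h n *\<^sub>R v) - indicator Q x\<bar>)"
          by simp
        show "\<bar>(indicator Q (x - h n *\<^sub>R v) - indicator Q x) * q w n x\<bar>
            \<le> L * norm w * \<bar>indicator Q (x - h n *\<^sub>R v) - indicator Q x\<bar>" for x
          unfolding abs_mult by (subst mult.commute) (intro mult_right_mono qb abs_ge_zero)
      qed (use int in simp)
      finally show ?thesis .
    qed
    also have "\<dots> = L * norm w * E n" by (simp add: E_def)
    finally show ?thesis .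
  qed
  have "(\<lambda>n. (LINT x:Q|lborel. q (v + w) n x) - (LINT x:Q|lborel. q v n x) - (LINT x:Q|lborel. q w n x)) \<longlonglongrightarrow> 0"
    by (rule Lim_null_comparison[OF _ tendsto_mult_right_zero[OF E, of "L * norm w"]])
       (use step in auto)
  moreover have "(\<lambda>n. (LINT x:Q|lborel. q (v + w) n x) - (LINT x:Q|lborel. q v n x) - (LINT x:Q|lborel. q w n x))
     \<longlonglongrightarrow> (LINT x:Q|lborel. dir_deriv f (v + w) x) - (LINT x:Q|lborel. dir_deriv f v x) - (LINT x:Q|lborel. dir_deriv f w x)"
    by (intro tendsto_diff lim)
  ultimately show ?thesis using LIMSEQ_unique unfolding Q_def by fastforce
qed

lemma AE_dir_deriv_scaleR: "AE x in lborel. dir_deriv f (c *\<^sub>R v) x = c * dir_deriv f v x"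
  using AE_dir_deriv[of v]
proof eventually_elim
  case (elim x)
  show ?case
  proof (cases "c = 0")
    case True
    then show ?thesis by (simp add: dir_deriv_def)
  next
    case False
    have "filterlim (\<lambda>h. h * c) (at 0) (at 0)"
      using False by (auto simp: filterlim_at eventually_at_filter intro!: tendsto_eq_intros)
    from filterlim_compose[OF elim this]
    have "((\<lambda>h. c * ((f (x + (h * c) *\<^sub>R v) - f x) / (h * c))) \<longlongrightarrow> c * dir_deriv f v x) (at 0)"
      by (intro tendsto_mult_left)
    then show ?thesis using False by (intro dir_deriv_eqI) simp
  qed
qed

text \<open>The integral of \<open>dir_deriv f v\<close> over a fixed box is linear in
  \<open>v\<close>, so the defect of linearity has integral zero over every box; being bounded, it
  vanishes almost everywhere. The exceptional null set depends on \<open>v\<close>.\<close>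

lemma AE_dir_deriv_linear:
  "AE x in lborel. dir_deriv f v x = (\<Sum>b\<in>Basis. (v \<bullet> b) * dir_deriv f b x)"
proof -
  define g where "g x = dir_deriv f v x - (\<Sum>b\<in>Basis. (v \<bullet> b) * dir_deriv f b x)" for x
  have gm: "g \<in> borel_measurable borel" unfolding g_def by measurable
  have gb: "AE x in lborel. \<bar>g x\<bar> \<le> L * norm v + (\<Sum>b\<in>Basis. \<bar>v \<bullet> b\<bar> * (L * norm b))"
  proof -
    have "AE x in lborel. \<forall>b\<in>Basis. \<bar>dir_deriv f b x\<bar> \<le> L * norm b"
      by (intro AE_finite_allI finite_Basis AE_dir_deriv_bound)
    with AE_dir_deriv_bound[of v] show ?thesis
    proof eventually_elim
      case (elim x)
      have "\<bar>\<Sum>b\<in>Basis. (v \<bullet> b) * dir_deriv f b x\<bar> \<le> (\<Sum>b\<in>Basis. \<bar>v \<bullet> b\<bar> * (L * norm b))"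
        using elim by (intro order_trans[OF sum_abs] sum_mono) (auto simp: abs_mult intro!: mult_left_mono)
      then show ?case using elim unfolding g_def by linarith
    qed
  qed
  have "(LINT x:box l u|lborel. g x) = 0" for l u
  proof -
    define I where "I v = (LINT x:box l u|lborel. dir_deriv f v x)" for v
    have int: "set_integrable lborel (box l u) (dir_deriv f v)" for v
      by (rule box_integrable[OF _ AE_dir_deriv_bound]) simp
    have "linear I"
    proof (rule linearI)
      show "I (v + w) = I v + I w" for v w
        unfolding I_def by (rule box_integral_dir_deriv_add)
      show "I (c *\<^sub>R v) = c *\<^sub>R I v" for c v
      proof -
        have "I (c *\<^sub>R v) = (LINT x:box l u|lborel. c * dir_deriv f v x)"
          unfolding I_def set_lebesgue_integral_def
          by (rule integral_cong_AE) (use AE_dir_deriv_scaleR[of c v] in \<open>auto elim!: eventually_mono\<close>)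
        then show ?thesis by (simp add: I_def)
      qed
    qed
    then have "I v = (\<Sum>b\<in>Basis. (v \<bullet> b) * I b)"
      by (subst (1) euclidean_representation[of v, symmetric]) (simp add: linear_sum linear_cmul)
    moreover have "(LINT x:box l u|lborel. g x) = I v - (\<Sum>b\<in>Basis. (v \<bullet> b) * I b)"
    proof -
      have "(LINT x:box l u|lborel. (\<Sum>b\<in>Basis. (v \<bullet> b) * dir_deriv f b x)) = (\<Sum>b\<in>Basis. (v \<bullet> b) * I b)"
        using int unfolding I_def set_lebesgue_integral_def set_integrable_def
        by (simp add: sum_distrib_left mult.left_commute)
      moreover have "set_integrable lborel (box l u) (\<lambda>x. \<Sum>b\<in>Basis. (v \<bullet> b) * dir_deriv f b x)"
        using int unfolding set_integrable_def
        by (simp add: sum_distrib_left mult.left_commute)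
      ultimately show ?thesis unfolding g_def using int by (simp add: I_def set_integral_diff)
    qed
    ultimately show ?thesis by simp
  qed
  from AE_zero_if_box_integrals_zero[OF gm gb this] show ?thesis
    by eventually_elim (simp add: g_def)
qed

end

text \<open>By compactness of the unit sphere, finitely many directions from \<open>D\<close> come
  close to every unit vector, so the convergence along them is uniform. Lipschitz continuity of
  \<open>f\<close> and of \<open>A\<close> carries the estimate over to the remaining
  directions.\<close>

lemma has_derivative_if_dense_directions:
  fixes f :: "'a::euclidean_space \<Rightarrow> real"
  assumes lip: "L-lipschitz_on UNIV f" and A: "linear A" and D: "closure D = UNIV"
    and dir: "\<And>v. v \<in> D \<Longrightarrow> ((\<lambda>h. (f (x + h *\<^sub>R v) - f x) / h) \<longlongrightarrow> A v) (at 0)"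
  shows "(f has_derivative A) (at x)"
  unfolding has_derivative_at_alt
proof (intro conjI allI impI)
  show "bounded_linear A" using A by (simp add: linear_conv_bounded_linear)
  obtain K where K: "0 < K" "\<And>v. norm (A v) \<le> K * norm v"
    using linear_bounded_pos[OF A] by blast
  have L: "0 \<le> L" using lip lipschitz_on_nonneg by blast
  fix e :: real assume e: "0 < e"
  \<comment> \<open>Replacing a unit vector by one at distance \<eta> costs
    \<open>L * \<eta>\<close> in \<open>f\<close> and \<open>K * \<eta>\<close> in \<open>A\<close>,
    together \<open>e / 2\<close>; the other half is spent on the quotients along the finite
    set.\<close>
  define \<eta> where "\<eta> = e / (2 * (L + K))"
  have \<eta>: "0 < \<eta>" "(L + K) * \<eta> = e / 2" using e L K by (auto simp: \<eta>_def field_simps)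
  have "sphere 0 1 \<subseteq> (\<Union>v\<in>D. ball v \<eta>)"
  proof
    fix u :: 'a
    have "u \<in> closure D" using D by simp
    then obtain v where "v \<in> D" "dist v u < \<eta>" using \<eta>(1) closure_approachable by blast
    then show "u \<in> (\<Union>v\<in>D. ball v \<eta>)" by auto
  qed
  then obtain F where F: "F \<subseteq> D" "finite F" "sphere 0 1 \<subseteq> (\<Union>v\<in>F. ball v \<eta>)"
    using compactE_image[OF compact_sphere, of D "\<lambda>v. ball v \<eta>" 0 1] by blast
  have "\<forall>v\<in>F. eventually (\<lambda>h. \<bar>(f (x + h *\<^sub>R v) - f x) / h - A v\<bar> < e / 2) (at 0)"
  proof
    fix v assume "v \<in> F"
    then have "((\<lambda>h. (f (x + h *\<^sub>R v) - f x) / h) \<longlongrightarrow> A v) (at 0)" using F dir by blast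
    from tendstoD[OF this, of "e / 2"] e
    show "eventually (\<lambda>h. \<bar>(f (x + h *\<^sub>R v) - f x) / h - A v\<bar> < e / 2) (at 0)"
      by (simp add: dist_real_def)
  qed
  then have "eventually (\<lambda>h. \<forall>v\<in>F. \<bar>(f (x + h *\<^sub>R v) - f x) / h - A v\<bar> < e / 2) (at 0)"
    using F(2) by (simp add: eventually_ball_finite_distrib)
  then obtain d where d: "0 < d"
      "\<And>h v. h \<noteq> 0 \<Longrightarrow> \<bar>h\<bar> < d \<Longrightarrow> v \<in> F \<Longrightarrow> \<bar>(f (x + h *\<^sub>R v) - f x) / h - A v\<bar> < e / 2"
    unfolding eventually_at by (auto simp: dist_real_def)
  show "\<exists>d>0. \<forall>y. norm (y - x) < d \<longrightarrow> norm (f y - f x - A (y - x)) \<le> e * norm (y - x)"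
  proof (intro exI[of _ d] conjI allI impI d(1))
    fix y assume y: "norm (y - x) < d"
    show "norm (f y - f x - A (y - x)) \<le> e * norm (y - x)"
    proof (cases "y = x")
      case False
      define t where "t = norm (y - x)"
      define u where "u = (y - x) /\<^sub>R t"
      have t: "0 < t" "t < d" using False y by (auto simp: t_def)
      have yx: "y = x + t *\<^sub>R u" using t by (simp add: u_def)
      have "u \<in> sphere 0 1" using t(1) by (simp add: u_def t_def)
      then obtain v where v: "v \<in> F" "norm (v - u) < \<eta>" using F(3) by (auto simp: dist_norm)
      have "\<bar>f (x + t *\<^sub>R u) - f (x + t *\<^sub>R v)\<bar> \<le> L * norm (t *\<^sub>R (v - u))"
        using lipschitz_onD[OF lip, of "x + t *\<^sub>R u" "x + t *\<^sub>R v"]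
        by (simp add: dist_norm scaleR_diff_right norm_minus_commute)
      also have "\<dots> \<le> L * (t * \<eta>)" using v(2) t(1) L by (intro mult_left_mono) auto
      finally have 1: "\<bar>f (x + t *\<^sub>R u) - f (x + t *\<^sub>R v)\<bar> \<le> L * (t * \<eta>)" .
      have "\<bar>f (x + t *\<^sub>R v) - f x - t * A v\<bar> = t * \<bar>(f (x + t *\<^sub>R v) - f x) / t - A v\<bar>"
      proof -
        have "f (x + t *\<^sub>R v) - f x - t * A v = t * ((f (x + t *\<^sub>R v) - f x) / t - A v)"
          using t(1) by (simp add: field_simps)
        then show ?thesis using t(1) by (simp add: abs_mult)
      qed
      also have "\<dots> \<le> t * (e / 2)" using d(2)[of t v] t v by (intro mult_left_mono) auto
      finally have 2: "\<bar>f (x + t *\<^sub>R v) - f x - t * A v\<bar> \<le> t * (e / 2)" .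
      have "\<bar>t * A v - t * A u\<bar> = t * \<bar>A (v - u)\<bar>"
        using t(1) by (simp add: linear_diff[OF A] right_diff_distrib[symmetric] abs_mult)
      also have "\<dots> \<le> t * (K * norm (v - u))" using K(2)[of "v - u"] t(1) by (intro mult_left_mono) auto
      also have "\<dots> \<le> t * (K * \<eta>)" using K(1) v(2) t(1) by (intro mult_left_mono) auto
      finally have 3: "\<bar>t * A v - t * A u\<bar> \<le> t * (K * \<eta>)" .
      have "\<bar>f y - f x - t * A u\<bar> \<le> L * (t * \<eta>) + t * (e / 2) + t * (K * \<eta>)"
        unfolding yx using 1 2 3 by linarith
      also have "\<dots> = t * ((L + K) * \<eta>) + t * (e / 2)" by (simp add: algebra_simps)
      also have "\<dots> = e * t" unfolding \<eta>(2) by (simp add: algebra_simps)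
      also have "t * A u = A (y - x)" by (simp add: yx linear_cmul[OF A])
      finally show ?thesis by (simp add: t_def)
    qed (use A in \<open>simp add: linear_0\<close>)
  qed
qed

lemma rademacher_real:
  fixes f :: "'a::euclidean_space \<Rightarrow> real"
  assumes lip: "L-lipschitz_on UNIV f"
  shows "AE x in lborel. f differentiable at x"
proof -
  interpret lipschitz_function f L by standard (rule lip)
  \<comment> \<open>Each direction has its own exceptional null set and only countably many may be
    discarded, whence a countable dense set of directions.\<close>
  obtain D :: "'a set" where D: "countable D" "closure D = UNIV"
  proof -
    obtain D :: "'a set" where D: "countable D" "\<And>X. open X \<Longrightarrow> X \<noteq> {} \<Longrightarrow> \<exists>d\<in>D. d \<in> X"
      using countable_dense_setE by metis
    have "x \<in> closure D" for x
      using D(2)[OF open_ball, of x] by (auto simp: closure_approachable dist_commute)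
    then show ?thesis using that D(1) by blast
  qed
  have "AE x in lborel. \<forall>v\<in>D. ((\<lambda>h. (f (x + h *\<^sub>R v) - f x) / h) \<longlongrightarrow> dir_deriv f v x) (at 0) \<and>
      dir_deriv f v x = (\<Sum>b\<in>Basis. (v \<bullet> b) * dir_deriv f b x)"
    using D(1) by (intro AE_ball_countable[THEN iffD2] ballI AE_conjI AE_dir_deriv AE_dir_deriv_linear)
  then show ?thesis
  proof eventually_elim
    case (elim x)
    define A where "A v = (\<Sum>b\<in>Basis. (v \<bullet> b) * dir_deriv f b x)" for v
    have "linear A"
      unfolding A_def by (rule linearI) (simp_all add: inner_left_distrib distrib_right sum.distrib sum_distrib_left mult.assoc)
    then have "(f has_derivative A) (at x)"
    proof (rule has_derivative_if_dense_directions[OF lip _ D(2)])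
      fix v assume "v \<in> D"
      then have "((\<lambda>h. (f (x + h *\<^sub>R v) - f x) / h) \<longlongrightarrow> dir_deriv f v x) (at 0)" "dir_deriv f v x = A v"
        using elim unfolding A_def by blast+
      then show "((\<lambda>h. (f (x + h *\<^sub>R v) - f x) / h) \<longlongrightarrow> A v) (at 0)" by (simp only:)
    qed
    then show ?case by (auto simp: differentiable_def)
  qed
qed

theorem rademacher:
  fixes f :: "'a::euclidean_space \<Rightarrow> 'b::euclidean_space"
  assumes "L-lipschitz_on UNIV f"
  shows "AE x in lborel. f differentiable at x"
proof -
  have "AE x in lborel. (\<lambda>x. f x \<bullet> i) differentiable at x" if "i \<in> Basis" for i
  proof (rule rademacher_real[of L], rule lipschitz_onI)
    fix x y
    have "dist (f x \<bullet> i) (f y \<bullet> i) \<le> dist (f x) (f y)"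
      using Basis_le_norm[OF that, of "f x - f y"] by (simp add: dist_norm inner_diff_left)
    also have "\<dots> \<le> L * dist x y" using lipschitz_onD[OF assms] by simp
    finally show "dist (f x \<bullet> i) (f y \<bullet> i) \<le> L * dist x y" .
  qed (use lipschitz_on_nonneg[OF assms] in simp)
  then have "AE x in lborel. \<forall>i\<in>Basis. (\<lambda>x. f x \<bullet> i) differentiable at x"
    by (intro AE_finite_allI) auto
  then show ?thesis by eventually_elim (use differentiable_componentwise_within in blast)
qed

subsection \<open>Mean value inequality\<close>

text \<open>The average \<open>\<psi> t\<close> of \<open>f\<close> over \<open>Q + t v\<close> is differentiable in \<open>t\<close> for a box \<open>Q\<close>, so the
  classical mean value theorem applies to \<open>\<psi>\<close>; then \<open>Q\<close> shrinks to \<open>a\<close>.\<close>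

lemma lipschitz_increment_ge:
  fixes f :: "'a::euclidean_space \<Rightarrow> real"
  assumes lip: "L-lipschitz_on UNIV f" and S: "open S" "convex S" "a \<in> S" "a + v \<in> S"
    and ge: "AE x in lborel. x \<in> S \<longrightarrow> \<alpha> \<le> dir_deriv f v x"
  shows "\<alpha> \<le> f (a + v) - f a"
proof (rule field_le_epsilon)
  interpret lipschitz_function f L by standard (rule lip)
  have L: "0 \<le> L" using lip lipschitz_on_nonneg by blast
  fix e :: real assume e: "0 < e"
  obtain \<eta>1 where \<eta>1: "0 < \<eta>1" "ball a \<eta>1 \<subseteq> S" using S openE by blast
  obtain \<eta>2 where \<eta>2: "0 < \<eta>2" "ball (a + v) \<eta>2 \<subseteq> S" using S openE by blast
  \<comment> \<open>The box has to be so small that its copies at both ends of the segment lie in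
    \<open>S\<close>, and that moving either endpoint within its copy changes \<open>f\<close> by at
    most \<open>e / 2\<close>.\<close>
  define \<eta> where "\<eta> = min (min \<eta>1 \<eta>2) (e / (2 * (L + 1)))"
  have \<eta>: "0 < \<eta>" using \<eta>1 \<eta>2 e L by (simp add: \<eta>_def)
  have "\<exists>l u. a \<in> box l u \<and> box l u \<subseteq> ball a \<eta>"
    using open_contains_box[OF open_ball, of a a \<eta>] \<eta> by (metis centre_in_ball subset_eq)
  then obtain l u where lu: "a \<in> box l u" "box l u \<subseteq> ball a \<eta>" by blast
  define Q where "Q = box l u"
  have Q[measurable]: "Q \<in> sets borel" "emeasure lborel Q < \<infinity>"
    using emeasure_bounded_finite[OF bounded_box] by (simp_all add: Q_def)
  define m where "m = measure lborel Q"
  have m: "0 < m"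
  proof -
    have "\<forall>b\<in>Basis. l \<bullet> b < u \<bullet> b" using lu(1) by (auto simp: mem_box intro: less_trans)
    then show ?thesis
      unfolding m_def Q_def by (auto simp: measure_lborel_box_eq inner_diff_left less_imp_le intro!: prod_pos)
  qed
  \<comment> \<open>\<open>Q\<close> and its translate by \<open>v\<close> lie in \<open>S\<close>,
    so convexity puts all intermediate translates there, and the bound \<open>ge\<close> is
    available on each of them.\<close>
  have seg: "y + t *\<^sub>R v \<in> S" if "y \<in> Q" "0 \<le> t" "t \<le> 1" for y t
  proof -
    have "dist a y < \<eta>" using that lu by (auto simp: Q_def)
    then have "y \<in> S" "y + v \<in> S"
      using \<eta>1 \<eta>2 by (auto simp: \<eta>_def dist_norm subset_iff)
    then have "(1 - t) *\<^sub>R y + t *\<^sub>R (y + v) \<in> S" using S(2) that by (intro convexD) auto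
    then show ?thesis by (simp add: algebra_simps)
  qed
  define \<psi> where "\<psi> t = (LINT y:Q|lborel. f (y + t *\<^sub>R v))" for t
  define \<psi>' where "\<psi>' t = (LINT y:Q|lborel. dir_deriv f v (t *\<^sub>R v + y))" for t
  have int: "set_integrable lborel Q (\<lambda>y. f (y + t *\<^sub>R v))" for t
  proof -
    have "continuous_on (cbox l u) (\<lambda>y. f (y + t *\<^sub>R v))"
      by (intro continuous_on_compose2[OF cont] continuous_intros) auto
    then have "set_integrable lborel (cbox l u) (\<lambda>y. f (y + t *\<^sub>R v))"
      unfolding set_integrable_def by (rule borel_integrable_compact[OF compact_cbox])
    then show ?thesis by (rule set_integrable_subset) (auto simp: Q_def box_subset_cbox)
  qed
  \<comment> \<open>The derivative exists at every \<open>t\<close>, not just at almost every one: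
    translation by \<open>t *\<^sub>R v\<close> takes the exceptional set to another null set, which
    the integral ignores.\<close>
  have der: "(\<psi> has_real_derivative \<psi>' t) (at t)" for t
    unfolding DERIV_def tendsto_at_iff_sequentially
  proof (intro allI impI)
    fix X :: "nat \<Rightarrow> real" assume X: "\<forall>i. X i \<in> UNIV - {0}" "X \<longlonglongrightarrow> 0"
    have "(\<psi> (t + X n) - \<psi> t) / X n = (LINT y:Q|lborel. (f (t *\<^sub>R v + y + X n *\<^sub>R v) - f (t *\<^sub>R v + y)) / X n)" for n
      unfolding \<psi>_def
      using int[of "t + X n"] int[of t] by (simp add: set_integral_diff algebra_simps)
    then show "((\<lambda>h. (\<psi> (t + h) - \<psi> t) / h) \<circ> X) \<longlonglongrightarrow> \<psi>' t"
      using set_integral_quotient_tendsto[OF Q, of X "t *\<^sub>R v" v] X by (simp add: o_def \<psi>'_def)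
  qed
  have \<psi>'_ge: "\<alpha> * m \<le> \<psi>' t" if "0 \<le> t" "t \<le> 1" for t
  proof -
    have "(LINT y:Q|lborel. \<alpha>) \<le> \<psi>' t"
      unfolding \<psi>'_def set_lebesgue_integral_def
    proof (rule integral_mono_AE)
      show "integrable lborel (\<lambda>x. indicat_real Q x *\<^sub>R \<alpha>)" using Q by simp
      have "set_integrable lborel Q (\<lambda>x. dir_deriv f v (t *\<^sub>R v + x))"
        unfolding Q_def
        by (rule box_integrable[OF _ AE_lborel_translate[OF AE_dir_deriv_bound]]) measurable
      then show "integrable lborel (\<lambda>x. indicat_real Q x *\<^sub>R dir_deriv f v (t *\<^sub>R v + x))"
        by (simp add: set_integrable_def)
      show "AE x in lborel. indicat_real Q x *\<^sub>R \<alpha> \<le> indicat_real Q x *\<^sub>R dir_deriv f v (t *\<^sub>R v + x)"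
        using AE_lborel_translate[OF ge, of "t *\<^sub>R v"]
        by eventually_elim (use seg that in \<open>auto simp: indicator_def add.commute\<close>)
    qed
    then show ?thesis by (simp add: set_lebesgue_integral_def m_def mult.commute)
  qed
  obtain z where z: "0 < z" "z < 1" "\<psi> 1 - \<psi> 0 = (1 - 0) * \<psi>' z"
    using MVT2[of 0 1 \<psi> \<psi>'] der by auto
  have "\<alpha> * m \<le> \<psi> 1 - \<psi> 0" using z \<psi>'_ge[of z] by simp
  also have "\<psi> 1 - \<psi> 0 = (LINT y:Q|lborel. f (y + v) - f y)"
    using int[of 1] int[of 0] by (simp add: \<psi>_def set_integral_diff)
  also have "\<dots> \<le> (LINT y:Q|lborel. f (a + v) - f a + e)"
  proof (rule set_integral_mono)
    show "set_integrable lborel Q (\<lambda>y. f (y + v) - f y)"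
      using int[of 1] int[of 0] by simp
    show "set_integrable lborel Q (\<lambda>y. f (a + v) - f a + e)" using Q by (simp add: set_integrable_def)
    fix y assume "y \<in> Q"
    then have y: "norm (y - a) < \<eta>" using lu by (auto simp: Q_def dist_norm norm_minus_commute)
    have "\<bar>f (y + v) - f (a + v)\<bar> \<le> L * norm (y - a)" "\<bar>f y - f a\<bar> \<le> L * norm (y - a)"
      using lipschitz_onD[OF lip, of "y + v" "a + v"] lipschitz_onD[OF lip, of y a] by (simp_all add: dist_norm)
    moreover have "L * norm (y - a) \<le> e / 2"
    proof -
      have "L * norm (y - a) \<le> (L + 1) * (e / (2 * (L + 1)))"
        using y L by (intro mult_mono) (auto simp: \<eta>_def)
      also have "\<dots> = e / 2" using L by (simp add: field_simps)
      finally show ?thesis .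
    qed
    ultimately show "f (y + v) - f y \<le> f (a + v) - f a + e" by linarith
  qed
  also have "\<dots> = (f (a + v) - f a + e) * m" by (simp add: set_lebesgue_integral_def m_def mult.commute)
  finally show "\<alpha> \<le> f (a + v) - f a + e" using m by simp
qed

text \<open>Pairing with \<open>c\<close> reduces this to the scalar inequality, which expects a
  Lipschitz function on the whole space. Composing \<open>F\<close> with the nearest-point
  projection onto the closed ball gives one with the same constant, and on the open ball it has the
  same derivatives as \<open>F\<close>.\<close>

lemma lipschitz_mean_value_ge:
  fixes F :: "'a::euclidean_space \<Rightarrow> 'b::euclidean_space"
  assumes lip: "L-lipschitz_on (cball x0 \<epsilon>) F" and xy: "x \<in> ball x0 \<epsilon>" "y \<in> ball x0 \<epsilon>"
    and ge: "\<And>z. z \<in> ball x0 \<epsilon> \<Longrightarrow> F differentiable at z \<Longrightarrow> \<alpha> \<le> c \<bullet> frechet_derivative F (at z) (y - x)"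
  shows "\<alpha> \<le> c \<bullet> (F y - F x)"
proof -
  define S where "S = cball x0 \<epsilon>"
  have S: "closed S" "convex S" "S \<noteq> {}" using xy zero_le_dist[of x0 x] by (auto simp: S_def simp del: zero_le_dist)
  define G where "G = F \<circ> closest_point S"
  have GF: "G z = F z" if "z \<in> S" for z using that by (simp add: G_def closest_point_self)
  have lG: "L-lipschitz_on UNIV G"
  proof (rule lipschitz_onI)
    fix x y
    have "dist (G x) (G y) \<le> L * dist (closest_point S x) (closest_point S y)"
      unfolding G_def o_def
      by (intro lipschitz_onD[OF lip]) (use closest_point_in_set[OF S(1,3)] in \<open>simp_all only: S_def\<close>)
    also have "\<dots> \<le> L * dist x y"
      using closest_point_lipschitz[OF S(2,1,3)] lipschitz_on_nonneg[OF lip] by (intro mult_left_mono)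
    finally show "dist (G x) (G y) \<le> L * dist x y" .
  qed (use lipschitz_on_nonneg[OF lip] in simp)
  define f where "f z = c \<bullet> G z" for z
  have lf: "(norm c * L)-lipschitz_on UNIV f"
  proof (rule lipschitz_onI)
    fix x y
    have "dist (f x) (f y) = \<bar>c \<bullet> (G x - G y)\<bar>" by (simp add: f_def dist_real_def inner_diff_right)
    also have "\<dots> \<le> norm c * dist (G x) (G y)" by (simp add: Cauchy_Schwarz_ineq2 dist_norm)
    also have "\<dots> \<le> norm c * (L * dist x y)" using lipschitz_onD[OF lG] by (intro mult_left_mono) auto
    finally show "dist (f x) (f y) \<le> norm c * L * dist x y" by simp
  qed (use lipschitz_on_nonneg[OF lip] in simp)
  have "AE z in lborel. z \<in> ball x0 \<epsilon> \<longrightarrow> \<alpha> \<le> dir_deriv f (y - x) z"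
    using rademacher[OF lG]
  proof eventually_elim
    case (elim z)
    show ?case
    proof
      assume z: "z \<in> ball x0 \<epsilon>"
      have G': "(G has_derivative frechet_derivative G (at z)) (at z)"
        using elim frechet_derivative_works by blast
      then have F': "(F has_derivative frechet_derivative G (at z)) (at z)"
        by (rule has_derivative_transform_within_open[OF _ open_ball z]) (simp add: GF S_def)
      then have eq: "frechet_derivative F (at z) = frechet_derivative G (at z)"
        using frechet_derivative_at by metis
      have f': "(f has_derivative (\<lambda>h. c \<bullet> frechet_derivative G (at z) h)) (at z)"
        unfolding f_def by (intro derivative_intros G')
      have "((\<lambda>h. (f (z + h *\<^sub>R (y - x)) - f z) / h) \<longlongrightarrow> c \<bullet> frechet_derivative G (at z) (y - x)) (at 0)"
      proof -
        have "((\<lambda>h. f (z + h *\<^sub>R (y - x))) has_derivative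
                (\<lambda>h. c \<bullet> frechet_derivative G (at z) (h *\<^sub>R (y - x)))) (at 0)"
          by (rule has_derivative_compose[where g=f and f="\<lambda>h. z + h *\<^sub>R (y - x)"])
             (auto intro!: derivative_eq_intros simp: f')
        moreover have "frechet_derivative G (at z) (h *\<^sub>R (y - x)) = h *\<^sub>R frechet_derivative G (at z) (y - x)" for h
          using has_derivative_linear[OF G'] by (rule linear_cmul)
        ultimately have "((\<lambda>h. f (z + h *\<^sub>R (y - x))) has_real_derivative
                c \<bullet> frechet_derivative G (at z) (y - x)) (at 0)"
          by (simp add: has_field_derivative_def mult.commute[of _ "c \<bullet> _"] mult_commute_abs)
        then show ?thesis by (simp add: DERIV_def)
      qed
      then have "dir_deriv f (y - x) z = c \<bullet> frechet_derivative G (at z) (y - x)"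
        by (rule dir_deriv_eqI)
      moreover have "F differentiable at z" using F' differentiable_def by blast
      ultimately show "\<alpha> \<le> dir_deriv f (y - x) z" using ge[OF z] eq by simp
    qed
  qed
  then have "\<alpha> \<le> f (x + (y - x)) - f x"
    using xy by (intro lipschitz_increment_ge[OF lf open_ball convex_ball]) auto
  then show ?thesis using xy by (simp add: f_def GF S_def inner_diff_right)
qed

subsection \<open>Clarke's lower bound\<close>

lemma norm_derivative_le_lipschitz:
  assumes lip: "L-lipschitz_on S f" and S: "open S" "z \<in> S" and d: "(f has_derivative D) (at z)"
  shows "norm (D h) \<le> L * norm h"
proof (cases "h = 0")
  case False
  have "norm (D h) \<le> (L + e) * norm h" if e: "0 < e" for e
  proof -
    obtain d where d: "0 < d" "\<And>y. norm (y - z) < d \<Longrightarrow> norm (f y - f z - D (y - z)) \<le> e * norm (y - z)"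
      using d e unfolding has_derivative_at_alt by blast
    obtain b where b: "0 < b" "ball z b \<subseteq> S" using S openE by blast
    define t where "t = min b d / (2 * norm h)"
    have t: "0 < t" "t * norm h < b" "t * norm h < d" using False b(1) d(1) by (auto simp: t_def min_def)
    have "z + t *\<^sub>R h \<in> S" using t b(2) by (auto simp: subset_iff dist_norm)
    then have "norm (f (z + t *\<^sub>R h) - f z) \<le> L * (t * norm h)"
      using lipschitz_onD[OF lip _ S(2), of "z + t *\<^sub>R h"] t(1) by (simp add: dist_norm)
    moreover have "norm (f (z + t *\<^sub>R h) - f z - t *\<^sub>R D h) \<le> e * (t * norm h)"
      using d(2)[of "z + t *\<^sub>R h"] t linear_cmul[OF has_derivative_linear[OF assms(4)]] by simp
    moreover have "norm (t *\<^sub>R D h) \<le> norm (f (z + t *\<^sub>R h) - f z) + norm (f (z + t *\<^sub>R h) - f z - t *\<^sub>R D h)"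
      by (metis add.commute norm_minus_commute norm_triangle_sub)
    ultimately have "t * norm (D h) \<le> t * ((L + e) * norm h)"
      using t(1) by (simp add: algebra_simps)
    then show ?thesis using t(1) by simp
  qed
  note le = this
  show ?thesis
  proof (rule field_le_epsilon)
    fix e :: real assume "0 < e"
    then show "norm (D h) \<le> L * norm h + e"
      using le[of "e / norm h"] False by (simp add: distrib_right)
  qed
qed (use has_derivative_linear[OF d] in \<open>simp add: linear_0\<close>)

text \<open>The functional is the point of \<open>C\<close> nearest to the origin, normalized: its
  variational inequality says that no point of \<open>C\<close> projects onto it with less than its
  own length, and that length is at least \<open>d\<close>. For empty \<open>C\<close> any unit
  vector serves.\<close>

lemma separate_from_ball:
  fixes C :: "'a::euclidean_space set"
  assumes "convex C" "closed C" "0 < d" and d: "\<And>w. w \<in> C \<Longrightarrow> d \<le> norm w"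
  obtains c where "norm c = 1" "\<And>w. w \<in> C \<Longrightarrow> d \<le> c \<bullet> w"
proof (cases "C = {}")
  case True
  obtain b :: 'a where "b \<in> Basis" using nonempty_Basis by blast
  then show thesis using that[of b] True by simp
next
  case False
  define p where "p = closest_point C 0"
  have p: "p \<in> C" "d \<le> norm p" using closest_point_in_set[OF assms(2) False] d by (auto simp: p_def)
  then have p0: "0 < norm p" using assms(3) by linarith
  have "d \<le> (p /\<^sub>R norm p) \<bullet> w" if "w \<in> C" for w
  proof -
    have "(0 - p) \<bullet> (w - p) \<le> 0"
      using closest_point_dot[OF assms(1,2) that, of 0] by (simp add: p_def)
    then have "norm p * norm p \<le> p \<bullet> w"
      by (simp add: inner_diff_right power2_norm_eq_inner[symmetric] power2_eq_square)
    then have "norm p \<le> (p /\<^sub>R norm p) \<bullet> w" using p0 by (simp add: divide_simps)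
    then show ?thesis using p(2) by simp
  qed
  then show thesis using that[of "p /\<^sub>R norm p"] p0 by simp
qed

section \<open>Limiting Jacobians: closedness, boundedness and semicontinuity\<close>

definition limiting_jacobians :: "((real^'m) \<Rightarrow> (real^'n)) \<Rightarrow> real^'m \<Rightarrow> (real^'n^'m) set" where
  "limiting_jacobians F x =
     {M. \<exists>u. u \<longlonglongrightarrow> x \<and> (\<forall>i. F differentiable at (u i)) \<and>
             (\<lambda>i. transpose (jacobian F (at (u i)))) \<longlonglongrightarrow> M}"

lemma clarke_subdifferential_eq: "clarke_subdifferential F x = convex hull (limiting_jacobians F x)"
  by (simp add: clarke_subdifferential_def limiting_jacobians_def)

lemma frechet_derivative_eq_vector_matrix:
  fixes F :: "(real^'m) \<Rightarrow> (real^'n)"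
  assumes "F differentiable at z"
  shows "frechet_derivative F (at z) h = h v* transpose (jacobian F (at z))"
  using assms jacobian_works[of F "at z"] frechet_derivative_at[of F "(*v) (jacobian F (at z))" z] by simp

text \<open>Without sequences, closedness of the set of limits becomes an application of the
  triangle inequality instead of a diagonal argument.\<close>

lemma limiting_jacobians_iff:
  "M \<in> limiting_jacobians F x \<longleftrightarrow>
     (\<forall>e>0. \<exists>z. dist z x < e \<and> F differentiable at z \<and> dist (transpose (jacobian F (at z))) M < e)"
  (is "_ = ?R")
proof
  assume "M \<in> limiting_jacobians F x"
  then obtain u where u: "u \<longlonglongrightarrow> x" "\<And>i. F differentiable at (u i)"
      "(\<lambda>i. transpose (jacobian F (at (u i)))) \<longlonglongrightarrow> M"
    by (auto simp: limiting_jacobians_def)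
  show ?R
  proof (intro allI impI)
    fix e :: real assume "0 < e"
    from tendstoD[OF u(1) this] tendstoD[OF u(3) this]
    have "\<forall>\<^sub>F i in sequentially. dist (u i) x < e \<and> dist (transpose (jacobian F (at (u i)))) M < e"
      by eventually_elim simp
    then obtain i where "dist (u i) x < e" "dist (transpose (jacobian F (at (u i)))) M < e"
      by (auto simp: eventually_sequentially)
    then show "\<exists>z. dist z x < e \<and> F differentiable at z \<and> dist (transpose (jacobian F (at z))) M < e"
      using u(2) by blast
  qed
next
  assume R: ?R
  define e where "e i = inverse (real (Suc i))" for i
  have "\<forall>i. \<exists>z. dist z x < e i \<and> F differentiable at z \<and> dist (transpose (jacobian F (at z))) M < e i"
    using R by (simp add: e_def)
  then obtain u where u: "\<And>i. dist (u i) x < e i" "\<And>i. F differentiable at (u i)"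
      "\<And>i. dist (transpose (jacobian F (at (u i)))) M < e i" by metis
  have e: "e \<longlonglongrightarrow> 0" unfolding e_def[abs_def] by (rule LIMSEQ_inverse_real_of_nat)
  have "u \<longlonglongrightarrow> x"
    by (rule metric_tendsto_imp_tendsto[OF e]) (auto intro!: eventuallyI less_imp_le[OF less_le_trans[OF u(1)]])
  moreover have "(\<lambda>i. transpose (jacobian F (at (u i)))) \<longlonglongrightarrow> M"
    by (rule metric_tendsto_imp_tendsto[OF e]) (auto intro!: eventuallyI less_imp_le[OF less_le_trans[OF u(3)]])
  ultimately show "M \<in> limiting_jacobians F x"
    using u(2) by (auto simp: limiting_jacobians_def)
qed

lemma closed_limiting_jacobians: "closed (limiting_jacobians F x)"
proof -
  have "M \<in> limiting_jacobians F x" if M: "M \<in> closure (limiting_jacobians F x)" for M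
    unfolding limiting_jacobians_iff
  proof (intro allI impI)
    fix e :: real assume e: "0 < e"
    obtain M' where M': "M' \<in> limiting_jacobians F x" "dist M' M < e / 2"
      using M e by (meson closure_approachable half_gt_zero)
    then obtain z where "dist z x < e / 2" "F differentiable at z" "dist (transpose (jacobian F (at z))) M' < e / 2"
      using e limiting_jacobians_iff by (meson half_gt_zero)
    moreover from this have "dist (transpose (jacobian F (at z))) M < e"
      using M'(2) dist_triangle[of "transpose (jacobian F (at z))" M M'] by linarith
    ultimately show "\<exists>z. dist z x < e \<and> F differentiable at z \<and> dist (transpose (jacobian F (at z))) M < e"
      using e by (intro exI[of _ z]) auto
  qed
  then show ?thesis using closure_subset_eq by blast
qed

text \<open>Each row of the transposed Jacobian is a derivative along a coordinate axis and has norm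
  at most \<open>L\<close>. The bound is uniform over \<open>S\<close>, as the extraction of
  convergent subsequences requires.\<close>

lemma jacobian_bounded:
  fixes F :: "(real^'m) \<Rightarrow> (real^'n)"
  assumes lip: "L-lipschitz_on S F" and S: "open S"
  obtains B where "\<And>z. z \<in> S \<Longrightarrow> F differentiable at z \<Longrightarrow> norm (transpose (jacobian F (at z))) \<le> B"
proof -
  have "norm (transpose (jacobian F (at z))) \<le> (\<Sum>i\<in>(UNIV :: 'm set). L)"
    if z: "z \<in> S" "F differentiable at z" for z
  proof -
    have "norm (transpose (jacobian F (at z)) $ i) \<le> L" for i
    proof -
      have "transpose (jacobian F (at z)) $ i = frechet_derivative F (at z) (axis i 1)"
        by (simp add: vec_eq_iff transpose_def jacobian_def matrix_def)
      moreover have "norm (frechet_derivative F (at z) (axis i 1)) \<le> L * norm (axis i (1::real))"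
        using z by (intro norm_derivative_le_lipschitz[OF lip S]) (simp_all add: frechet_derivative_works)
      ultimately show ?thesis by simp
    qed
    then have "(\<Sum>i\<in>UNIV. norm (transpose (jacobian F (at z)) $ i)) \<le> (\<Sum>i\<in>(UNIV :: 'm set). L)"
      by (intro sum_mono)
    then show ?thesis
      using L2_set_le_sum[of UNIV "\<lambda>i. norm (transpose (jacobian F (at z)) $ i)"]
      by (simp add: norm_vec_def[of "transpose (jacobian F (at z))"])
  qed
  then show thesis by (rule that)
qed

lemma limiting_jacobians_bounded:
  assumes lip: "L-lipschitz_on S F" and S: "open S" "x \<in> S"
  shows "bounded (limiting_jacobians F x)"
proof -
  obtain B where B: "\<And>z. z \<in> S \<Longrightarrow> F differentiable at z \<Longrightarrow> norm (transpose (jacobian F (at z))) \<le> B"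
    using jacobian_bounded[OF lip S(1)] by blast
  obtain d where d: "0 < d" "ball x d \<subseteq> S" using S openE by blast
  have "norm M \<le> B + 1" if M: "M \<in> limiting_jacobians F x" for M
  proof -
    obtain z where z: "dist z x < min d 1" "F differentiable at z" "dist (transpose (jacobian F (at z))) M < min d 1"
      using M[unfolded limiting_jacobians_iff, rule_format, of "min d 1"] d(1) by auto
    then have "norm (transpose (jacobian F (at z))) \<le> B" using B d by (auto simp: dist_commute subset_iff)
    moreover have "norm M \<le> norm (transpose (jacobian F (at z))) + dist (transpose (jacobian F (at z))) M"
      using norm_triangle_sub[of M "transpose (jacobian F (at z))"] by (simp add: dist_norm norm_minus_commute)
    ultimately show ?thesis using z(3) by linarith
  qed
  then show ?thesis by (auto simp: bounded_iff)
qed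

text \<open>Otherwise there are points converging to \<open>x\<close> whose Jacobians keep distance
  \<eta> from every limiting one. These Jacobians are bounded, so a subsequence converges, and its
  limit is itself a limiting Jacobian.\<close>

lemma jacobians_near_limiting:
  fixes F :: "(real^'m) \<Rightarrow> (real^'n)"
  assumes lip: "L-lipschitz_on S F" and S: "open S" "x \<in> S" and \<eta>: "0 < \<eta>"
  obtains \<epsilon> where "0 < \<epsilon>" "\<And>z. z \<in> ball x \<epsilon> \<Longrightarrow> F differentiable at z \<Longrightarrow>
      \<exists>M\<in>limiting_jacobians F x. dist (transpose (jacobian F (at z))) M < \<eta>"
proof (rule ccontr)
  assume no: "\<not> thesis"
  define e where "e i = inverse (real (Suc i))" for i
  have "\<exists>z. dist z x < e i \<and> F differentiable at z \<and>
        (\<forall>M\<in>limiting_jacobians F x. \<not> dist (transpose (jacobian F (at z))) M < \<eta>)" for i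
  proof (rule ccontr)
    assume "\<not> ?thesis"
    then have "thesis" by (intro that[of "e i"]) (auto simp: e_def dist_commute)
    then show False using no by blast
  qed
  then obtain u where u: "\<And>i. dist (u i) x < e i" "\<And>i. F differentiable at (u i)"
      "\<And>i M. M \<in> limiting_jacobians F x \<Longrightarrow> \<not> dist (transpose (jacobian F (at (u i)))) M < \<eta>" by metis
  have e: "e \<longlonglongrightarrow> 0" unfolding e_def[abs_def] by (rule LIMSEQ_inverse_real_of_nat)
  have ux: "u \<longlonglongrightarrow> x"
    by (rule metric_tendsto_imp_tendsto[OF e]) (auto intro!: eventuallyI less_imp_le[OF less_le_trans[OF u(1)]])
  then obtain N where N: "\<And>i. N \<le> i \<Longrightarrow> u i \<in> S"
    using S topological_tendstoD by (metis eventually_sequentially)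
  \<comment> \<open>The shift by \<open>N\<close> discards the points outside \<open>S\<close>,
    where no bound on the Jacobians is available.\<close>
  define J where "J i = transpose (jacobian F (at (u (i + N))))" for i
  obtain B where B: "\<And>z. z \<in> S \<Longrightarrow> F differentiable at z \<Longrightarrow> norm (transpose (jacobian F (at z))) \<le> B"
    using jacobian_bounded[OF lip S(1)] by blast
  have "bounded (range J)" by (rule boundedI[of _ B]) (use B N u(2) in \<open>auto simp: J_def\<close>)
  then obtain M k where M: "strict_mono k" "(J \<circ> k) \<longlonglongrightarrow> M"
    using bounded_imp_convergent_subsequence by blast
  have "M \<in> limiting_jacobians F x"
    unfolding limiting_jacobians_def
  proof (intro CollectI exI conjI allI)
    have "strict_mono (\<lambda>i. k i + N)" using M(1) by (simp add: strict_mono_def)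
    from LIMSEQ_subseq_LIMSEQ[OF ux this] show "(u \<circ> (\<lambda>i. k i + N)) \<longlonglongrightarrow> x" .
    show "F differentiable at ((u \<circ> (\<lambda>i. k i + N)) i)" for i using u(2) by simp
    show "(\<lambda>i. transpose (jacobian F (at ((u \<circ> (\<lambda>i. k i + N)) i)))) \<longlonglongrightarrow> M"
      using M(2) by (simp add: J_def o_def)
  qed
  from u(3)[OF this] have "\<not> dist (J (k i)) M < \<eta>" for i by (simp add: J_def)
  then show False using tendstoD[OF M(2) \<eta>] by (simp add: o_def)
qed

text \<open>A neighbourhood of the compact convex set of generalized Jacobians still consists of invertible
  matrices and contains all Jacobians at nearby points of differentiability. For a direction \<open>h\<close> the
  images of \<open>h\<close> under this neighbourhood form a convex set that a unit functional \<open>c\<close> separates from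
  a ball of radius proportional to \<open>norm h\<close>; the mean value inequality for \<open>c\<close> gives the bound.\<close>

theorem clarke_lower_lipschitz:
  fixes F :: "(real^'m) \<Rightarrow> (real^'m)"
  assumes lip: "L-lipschitz_on (cball x \<epsilon>0) F" and \<epsilon>0: "0 < \<epsilon>0"
    and det: "\<And>M. M \<in> clarke_subdifferential F x \<Longrightarrow> det M \<noteq> 0"
  obtains \<epsilon> \<delta> where "0 < \<epsilon>" "\<epsilon> \<le> \<epsilon>0" "0 < \<delta>"
    "\<And>y z. y \<in> ball x \<epsilon> \<Longrightarrow> z \<in> ball x \<epsilon> \<Longrightarrow> \<delta> * dist y z \<le> dist (F y) (F z)"
proof -
  define P where "P = limiting_jacobians F x"
  have lipb: "L-lipschitz_on (ball x \<epsilon>0) F" using lip by (rule lipschitz_on_subset) auto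
  have x: "x \<in> ball x \<epsilon>0" using \<epsilon>0 by simp
  have "compact P"
    using limiting_jacobians_bounded[OF lipb open_ball x] closed_limiting_jacobians
    by (simp add: P_def compact_eq_bounded_closed)
  then have hP: "compact (convex hull P)" by (rule compact_convex_hull)
  have "open {M :: real^'m^'m. det M \<noteq> 0}"
    unfolding det_def by (intro open_Collect_neq continuous_intros)
  moreover have "convex hull P \<subseteq> {M. det M \<noteq> 0}"
    using det by (auto simp: P_def clarke_subdifferential_eq)
  ultimately obtain \<eta> where \<eta>: "0 < \<eta>" "(\<Union>M\<in>convex hull P. cball M \<eta>) \<subseteq> {M. det M \<noteq> 0}"
    using compact_subset_open_imp_cball_epsilon_subset[OF hP] by blast
  \<comment> \<open>Written as a Minkowski sum, the closed \<eta>-neighbourhood of the hull inherits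
    compactness and convexity from its two summands.\<close>
  define K where "K = (\<Union>M\<in>convex hull P. \<Union>D\<in>cball 0 \<eta>. {M + D})"
  have Kc: "compact K" "convex K"
    unfolding K_def by (intro compact_sums' hP compact_cball convex_sums convex_convex_hull convex_cball)+
  have Kdet: "det M \<noteq> 0" if "M \<in> K" for M
  proof -
    obtain M' D where "M' \<in> convex hull P" "D \<in> cball 0 \<eta>" "M = M' + D"
      using \<open>M \<in> K\<close> by (auto simp: K_def)
    then have "M \<in> (\<Union>M\<in>convex hull P. cball M \<eta>)"
      by (intro UN_I[of M']) (auto simp: dist_norm)
    then show ?thesis using \<eta>(2) by blast
  qed
  obtain \<epsilon>1 where \<epsilon>1: "0 < \<epsilon>1" "\<And>z. z \<in> ball x \<epsilon>1 \<Longrightarrow> F differentiable at z \<Longrightarrow>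
      \<exists>M\<in>P. dist (transpose (jacobian F (at z))) M < \<eta>"
    using jacobians_near_limiting[OF lipb open_ball x \<eta>(1)] unfolding P_def by blast
  define \<epsilon> where "\<epsilon> = min \<epsilon>0 \<epsilon>1"
  have JK: "transpose (jacobian F (at z)) \<in> K" if "z \<in> ball x \<epsilon>" "F differentiable at z" for z
  proof -
    have "z \<in> ball x \<epsilon>1" using that(1) by (simp add: \<epsilon>_def)
    from \<epsilon>1(2)[OF this that(2)]
    obtain M where M: "M \<in> P" "dist (transpose (jacobian F (at z))) M < \<eta>" by blast
    then have "transpose (jacobian F (at z)) - M \<in> cball 0 \<eta>" by (simp add: dist_norm norm_minus_commute)
    moreover have "M \<in> convex hull P" using M(1) by (rule hull_inc)
    ultimately show ?thesis unfolding K_def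
      by (intro UN_I[of M] UN_I[of "transpose (jacobian F (at z)) - M"]) auto
  qed
  have lin: "linear (\<lambda>M :: real^'m^'m. h v* M)" for h
    by (rule linearI)
       (simp_all add: vector_matrix_mult_def vec_eq_iff distrib_left sum.distrib sum_distrib_left mult_ac)
  \<comment> \<open>\<delta> is the minimum of \<open>norm (h v* M)\<close> over \<open>K\<close>
    and the unit sphere, positive because no matrix in \<open>K\<close> has a left kernel. If
    \<open>K\<close> is empty the bound is vacuous and 1 is taken.\<close>
  obtain \<delta> where \<delta>: "0 < \<delta>" "\<And>M h. M \<in> K \<Longrightarrow> norm h = 1 \<Longrightarrow> \<delta> \<le> norm (h v* M)"
  proof (cases "K = {}")
    case False
    define g where "g p = norm (snd p v* fst p)" for p :: "(real^'m^'m) \<times> (real^'m)"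
    have "compact (K \<times> sphere (0 :: real^'m) 1)" using Kc(1) compact_sphere by (rule compact_Times)
    moreover have "continuous_on (K \<times> sphere 0 1) g"
      unfolding g_def vector_matrix_mult_def by (intro continuous_intros)
    moreover have "sphere (0 :: real^'m) 1 \<noteq> {}" by simp
    ultimately obtain q where q: "q \<in> K \<times> sphere 0 1" "\<And>p. p \<in> K \<times> sphere 0 1 \<Longrightarrow> g q \<le> g p"
      using continuous_attains_inf[of "K \<times> sphere 0 1" g] False by blast
    have "0 < g q"
    proof -
      have "det (transpose (fst q)) \<noteq> 0" using Kdet q(1) by (auto simp: det_transpose)
      then have "invertible (transpose (fst q))" by (simp add: invertible_det_nz)
      then have "transpose (fst q) *v snd q \<noteq> 0"
      proof -
        have "\<forall>h. transpose (fst q) *v h = 0 \<longrightarrow> h = 0"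
          using \<open>invertible (transpose (fst q))\<close> matrix_left_invertible_ker
          unfolding invertible_def by blast
        moreover have "snd q \<noteq> 0" using q(1) by auto
        ultimately show ?thesis by blast
      qed
      then show ?thesis by (simp add: g_def)
    qed
    then show thesis using that[of "g q"] q(2) by (force simp: g_def)
  qed (use that[of 1] in auto)
  have "\<delta> * dist y z \<le> dist (F y) (F z)" if yz: "y \<in> ball x \<epsilon>" "z \<in> ball x \<epsilon>" for y z
  proof (cases "y = z")
    case False
    define h where "h = z - y"
    have h: "0 < norm h" using False by (simp add: h_def)
    define C where "C = (\<lambda>M. h v* M) ` K"
    have C: "convex C" "closed C"
      unfolding C_def using Kc lin
      by (auto intro!: convex_linear_image compact_imp_closed compact_continuous_image linear_continuous_on
          simp: linear_conv_bounded_linear)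
    have "\<delta> * norm h \<le> norm w" if "w \<in> C" for w
    proof -
      obtain M where M: "M \<in> K" "w = h v* M" using \<open>w \<in> C\<close> by (auto simp: C_def)
      have "\<delta> \<le> norm ((h /\<^sub>R norm h) v* M)" using \<delta>(2)[OF M(1)] h by simp
      also have "(h /\<^sub>R norm h) v* M = (1 / norm h) *\<^sub>R w"
        by (simp add: M(2) vector_matrix_mult_def vec_eq_iff sum_distrib_left mult_ac divide_inverse)
      finally show ?thesis using h by (simp add: field_simps)
    qed
    then obtain c where c: "norm c = 1" "\<And>w. w \<in> C \<Longrightarrow> \<delta> * norm h \<le> c \<bullet> w"
      using separate_from_ball[OF C, of "\<delta> * norm h"] h \<delta>(1) by auto
    have "\<delta> * norm h \<le> c \<bullet> (F z - F y)"
    proof (rule lipschitz_mean_value_ge[OF _ yz])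
      show "L-lipschitz_on (cball x \<epsilon>) F" using lip by (rule lipschitz_on_subset) (auto simp: \<epsilon>_def)
      fix w assume w: "w \<in> ball x \<epsilon>" "F differentiable at w"
      show "\<delta> * norm h \<le> c \<bullet> frechet_derivative F (at w) (z - y)"
        unfolding frechet_derivative_eq_vector_matrix[OF w(2)] h_def[symmetric]
        using imageI[OF JK[OF w], of "\<lambda>M. h v* M"] by (intro c(2)) (simp only: C_def)
    qed
    also have "\<dots> \<le> norm c * norm (F z - F y)" by (rule norm_cauchy_schwarz)
    finally show ?thesis using c(1) by (simp add: h_def dist_norm norm_minus_commute)
  qed simp
  then show thesis using that[of \<epsilon> \<delta>] \<epsilon>0 \<epsilon>1(1) \<delta>(1) by (simp add: \<epsilon>_def)
qed

subsection \<open>Calculus of \<open>C_lip_on\<close> functions\<close>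

lemma locally_lipschitz_on_subset:
  assumes "locally_lipschitz_on W f" "W' \<subseteq> W"
  shows "locally_lipschitz_on W' f"
  using assms unfolding locally_lipschitz_on_def
  by (meson Int_mono order_refl lipschitz_on_subset subsetD)

lemma C_lip_on_subset:
  assumes "C_lip_on r W f" "W' \<subseteq> W"
  shows "C_lip_on r W' f"
  using assms(1)
proof (induction r arbitrary: f)
  case 0
  then show ?case using locally_lipschitz_on_subset assms(2) by simp
next
  case (Suc r)
  then show ?case using assms(2) by (simp add: subset_iff)
qed

lemma C_lip_on_le:
  assumes "open W" "C_lip_on r W f" "k \<le> r"
  shows "C_lip_on k W f"
  using assms(3,2)
proof (induction r rule: dec_induct)
  case (step n)
  show ?case by (rule step.IH[OF C_lip_on_Suc_imp[OF assms(1) step.prems]])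
qed

lemma C_lip_on_cong:
  assumes "open W" "\<And>x. x \<in> W \<Longrightarrow> f x = g x" "C_lip_on r W f"
  shows "C_lip_on r W g"
  using assms(2,3)
proof (induction r arbitrary: f g)
  case 0
  have "lipschitz_on L S g \<longleftrightarrow> lipschitz_on L S f" if "S \<subseteq> W" for L S
    using that 0(1) unfolding lipschitz_on_def by (metis subsetD)
  then show ?case using 0(2) by (simp add: locally_lipschitz_on_def)
next
  case (Suc r)
  have iff: "(f has_derivative D) (at x) \<longleftrightarrow> (g has_derivative D) (at x)" if "x \<in> W" for x D
    by (rule iffI; erule has_derivative_transform_within_open[OF _ assms(1) that]) (simp_all only: Suc.prems(1))
  then have eq: "frechet_derivative f (at x) = frechet_derivative g (at x)" if "x \<in> W" for x
    using that by (simp only: frechet_derivative_def)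
  have f: "C_lip_on r W (\<lambda>x. frechet_derivative f (at x) v)" "\<forall>x\<in>W. f differentiable at x" for v
    using Suc.prems(2) by simp_all
  have "g differentiable at x" if "x \<in> W" for x
    using f(2) that iff unfolding differentiable_def by blast
  moreover have "C_lip_on r W (\<lambda>x. frechet_derivative g (at x) v)" for v
    by (rule Suc.IH[OF _ f(1)]) (simp add: eq)
  ultimately show ?case
    by simp
qed

text \<open>The choice operator in \<open>frechet_derivative\<close> is traded for an explicit
  formula \<open>D\<close> that need only be valid on \<open>W\<close>. Openness of \<open>W\<close>
  allows the exchange, since higher derivatives at a point depend only on values nearby.\<close>

lemma C_lip_on_SucI:
  assumes W: "open W" and d: "\<And>x. x \<in> W \<Longrightarrow> (f has_derivative D x) (at x)"
    and C: "\<And>v. C_lip_on r W (\<lambda>x. D x v)"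
  shows "C_lip_on (Suc r) W f"
proof -
  have D: "D x = frechet_derivative f (at x)" if "x \<in> W" for x
    using frechet_derivative_at d that by blast
  then have "C_lip_on r W (\<lambda>x. frechet_derivative f (at x) v)" for v
    by (intro C_lip_on_cong[OF W _ C[of v]]) (simp add: D)
  then show ?thesis using d by (auto simp: differentiable_def)
qed

lemma C_lip_on_SucD:
  assumes "C_lip_on (Suc r) W f"
  shows "x \<in> W \<Longrightarrow> (f has_derivative frechet_derivative f (at x)) (at x)"
    and "C_lip_on r W (\<lambda>x. frechet_derivative f (at x) v)"
  using assms frechet_derivative_works by auto

lemma locally_lipschitz_onE:
  assumes "locally_lipschitz_on W f" "open W" "x \<in> W"
  obtains V L where "open V" "x \<in> V" "V \<subseteq> W" "L-lipschitz_on V f"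
proof -
  obtain V L where "open V" "x \<in> V" "L-lipschitz_on (V \<inter> W) f"
    using assms unfolding locally_lipschitz_on_def by blast
  then show thesis using that[of "V \<inter> W" L] assms by auto
qed

lemma locally_lipschitz_onI:
  assumes "\<And>x. x \<in> W \<Longrightarrow> \<exists>V L. open V \<and> x \<in> V \<and> L-lipschitz_on V f"
  shows "locally_lipschitz_on W f"
  using assms unfolding locally_lipschitz_on_def by (meson Int_lower1 lipschitz_on_subset)

lemma C_lip_on_const: "C_lip_on r W (\<lambda>x. c)"
proof (induction r arbitrary: c)
  case 0
  have "0-lipschitz_on UNIV (\<lambda>x. c)" by (rule lipschitz_onI) auto
  then show ?case by (auto intro!: locally_lipschitz_onI)
next
  case (Suc r)
  have "frechet_derivative (\<lambda>x. c) (at x) = (\<lambda>h. 0)" for x :: 'a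
    by (rule frechet_derivative_at[symmetric]) simp
  then show ?case using Suc by simp
qed

lemma C_lip_on_linear:
  fixes f :: "'a::euclidean_space \<Rightarrow> 'b::euclidean_space"
  assumes "linear f"
  shows "C_lip_on r W f"
proof (cases r)
  case 0
  obtain B where B: "\<And>x. norm (f x) \<le> norm x * B" "0 < B"
    using linear_conv_bounded_linear[THEN iffD1, OF assms] bounded_linear.pos_bounded by blast
  have "B-lipschitz_on UNIV f"
    using B by (intro lipschitz_onI) (auto simp: dist_norm linear_diff[OF assms, symmetric] mult.commute)
  then show ?thesis using 0 by (auto intro!: locally_lipschitz_onI)
next
  case (Suc k)
  have "(f has_derivative f) (at x)" for x
    using assms by (simp add: linear_conv_bounded_linear bounded_linear_imp_has_derivative)
  moreover from this have "frechet_derivative f (at x) = f" for x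
    by (rule frechet_derivative_at[symmetric])
  ultimately show ?thesis
    using Suc C_lip_on_const by (auto simp: differentiable_def)
qed

lemma C_lip_on_linear_comp:
  fixes f :: "'a::euclidean_space \<Rightarrow> 'b::euclidean_space" and l :: "'b \<Rightarrow> 'c::euclidean_space"
  assumes W: "open W" and l: "linear l" and "C_lip_on r W f"
  shows "C_lip_on r W (\<lambda>x. l (f x))"
  using assms(3)
proof (induction r arbitrary: f)
  case 0
  obtain B where B: "\<And>x. norm (l x) \<le> norm x * B" "0 < B"
    using linear_conv_bounded_linear[THEN iffD1, OF l] bounded_linear.pos_bounded by blast
  show ?case unfolding C_lip_on.simps
  proof (rule locally_lipschitz_onI)
    fix x assume x: "x \<in> W"
    obtain A L where 1: "open A" "x \<in> A" "L-lipschitz_on A f"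
      using 0 W x locally_lipschitz_onE by (metis C_lip_on.simps(1))
    have "B-lipschitz_on UNIV l"
      using B by (intro lipschitz_onI) (auto simp: dist_norm linear_diff[OF l, symmetric] mult.commute)
    then have "(B * L)-lipschitz_on A (\<lambda>x. l (f x))"
      using 1(3) by (intro lipschitz_on_compose2) (auto intro: lipschitz_on_subset)
    then show "\<exists>V L. open V \<and> x \<in> V \<and> L-lipschitz_on V (\<lambda>x. l (f x))" using 1 by blast
  qed
next
  case (Suc r)
  show ?case
  proof (rule C_lip_on_SucI[OF W])
    fix x assume x: "x \<in> W"
    show "((\<lambda>x. l (f x)) has_derivative (\<lambda>h. l (frechet_derivative f (at x) h))) (at x)"
      by (rule bounded_linear.has_derivative[OF linear_conv_bounded_linear[THEN iffD1, OF l] C_lip_on_SucD(1)[OF Suc.prems x]])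
  qed (rule Suc.IH[OF C_lip_on_SucD(2)[OF Suc.prems]])
qed

lemma C_lip_on_add:
  assumes W: "open W" and "C_lip_on r W f" "C_lip_on r W g"
  shows "C_lip_on r W (\<lambda>x. f x + g x)"
  using assms(2,3)
proof (induction r arbitrary: f g)
  case 0
  show ?case unfolding C_lip_on.simps
  proof (rule locally_lipschitz_onI)
    fix x assume x: "x \<in> W"
    obtain V L where 1: "open V" "x \<in> V" "V \<subseteq> W" "L-lipschitz_on V f"
      using 0(1) W x locally_lipschitz_onE by (metis C_lip_on.simps(1))
    obtain V' L' where 2: "open V'" "x \<in> V'" "V' \<subseteq> W" "L'-lipschitz_on V' g"
      using 0(2) W x locally_lipschitz_onE by (metis C_lip_on.simps(1))
    have "(L + L')-lipschitz_on (V \<inter> V') (\<lambda>x. f x + g x)"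
      using 1 2 by (intro lipschitz_on_add) (auto intro: lipschitz_on_subset)
    then show "\<exists>V L. open V \<and> x \<in> V \<and> L-lipschitz_on V (\<lambda>x. f x + g x)"
      using 1 2 by (meson IntI open_Int)
  qed
next
  case (Suc r)
  show ?case
  proof (rule C_lip_on_SucI[OF W])
    fix x assume x: "x \<in> W"
    show "((\<lambda>x. f x + g x) has_derivative
        (\<lambda>h. frechet_derivative f (at x) h + frechet_derivative g (at x) h)) (at x)"
      by (rule has_derivative_add[OF C_lip_on_SucD(1)[OF Suc.prems(1) x] C_lip_on_SucD(1)[OF Suc.prems(2) x]])
  next
    fix v
    show "C_lip_on r W (\<lambda>x. frechet_derivative f (at x) v + frechet_derivative g (at x) v)"
      by (rule Suc.IH[OF C_lip_on_SucD(2)[OF Suc.prems(1)] C_lip_on_SucD(2)[OF Suc.prems(2)]])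
  qed
qed

lemma C_lip_on_sum:
  assumes "open W" "\<And>i. i \<in> I \<Longrightarrow> C_lip_on r W (f i)"
  shows "C_lip_on r W (\<lambda>x. \<Sum>i\<in>I. f i x)"
  using assms(2)
proof (induction I rule: infinite_finite_induct)
  case (insert i I)
  then have "C_lip_on r W (\<lambda>x. f i x + (\<Sum>i\<in>I. f i x))"
    by (intro C_lip_on_add[OF assms(1)]) blast+
  then show ?case using insert.hyps by simp
qed (simp_all add: C_lip_on_const)

text \<open>A product of Lipschitz functions is Lipschitz where both factors are also bounded;
  shrinking to a unit ball secures the bound.\<close>

lemma locally_lipschitz_on_bounded_nbhd:
  fixes f :: "'a::euclidean_space \<Rightarrow> 'b::euclidean_space"
  assumes "locally_lipschitz_on W f" "open W" "x \<in> W"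
  obtains V L B where "open V" "x \<in> V" "V \<subseteq> W" "L-lipschitz_on V f" "\<And>y. y \<in> V \<Longrightarrow> norm (f y) \<le> B"
proof -
  obtain V L where V: "open V" "x \<in> V" "V \<subseteq> W" "L-lipschitz_on V f"
    using assms locally_lipschitz_onE by blast
  have "norm (f y) \<le> norm (f x) + L" if "y \<in> V \<inter> ball x 1" for y
  proof -
    have "dist (f y) (f x) \<le> L * dist y x" using V that lipschitz_onD by blast
    also have "\<dots> \<le> L" using that lipschitz_on_nonneg[OF V(4)] by (intro mult_left_le) (auto simp: dist_commute)
    finally show ?thesis using norm_triangle_sub[of "f y" "f x"] by (simp add: dist_norm)
  qed
  then show thesis using that[of "V \<inter> ball x 1" L "norm (f x) + L"] V by (auto intro: lipschitz_on_subset)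
qed

lemma C_lip_on_scaleR:
  fixes f :: "'a::euclidean_space \<Rightarrow> real" and g :: "'a \<Rightarrow> 'b::euclidean_space"
  assumes W: "open W" and "C_lip_on r W f" "C_lip_on r W g"
  shows "C_lip_on r W (\<lambda>x. f x *\<^sub>R g x)"
  using assms(2,3)
proof (induction r arbitrary: f g)
  case 0
  show ?case unfolding C_lip_on.simps
  proof (rule locally_lipschitz_onI)
    fix x assume x: "x \<in> W"
    obtain V L B where 1: "open V" "x \<in> V" "V \<subseteq> W" "L-lipschitz_on V f" "\<And>y. y \<in> V \<Longrightarrow> norm (f y) \<le> B"
      using 0(1) W x locally_lipschitz_on_bounded_nbhd by (metis C_lip_on.simps(1))
    obtain V' L' B' where 2: "open V'" "x \<in> V'" "V' \<subseteq> W" "L'-lipschitz_on V' g" "\<And>y. y \<in> V' \<Longrightarrow> norm (g y) \<le> B'"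
      using 0(2) W x locally_lipschitz_on_bounded_nbhd by (metis C_lip_on.simps(1))
    have B: "0 \<le> B" "0 \<le> B'" using 1 2 norm_ge_zero order_trans by blast+
    have L: "0 \<le> L" "0 \<le> L'" using 1 2 lipschitz_on_nonneg by blast+
    have "(B * L' + L * B')-lipschitz_on (V \<inter> V') (\<lambda>x. f x *\<^sub>R g x)"
    proof (rule lipschitz_onI)
      fix y z assume yz: "y \<in> V \<inter> V'" "z \<in> V \<inter> V'"
      have "f y *\<^sub>R g y - f z *\<^sub>R g z = f y *\<^sub>R (g y - g z) + (f y - f z) *\<^sub>R g z"
        by (simp add: algebra_simps)
      also have "norm \<dots> \<le> norm (f y) * norm (g y - g z) + norm (f y - f z) * norm (g z)"
        by (rule order_trans[OF norm_triangle_ineq]) simp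
      also have "\<dots> \<le> B * (L' * dist y z) + (L * dist y z) * B'"
        using yz 1 2 B L lipschitz_onD[OF 1(4), of y z] lipschitz_onD[OF 2(4), of y z]
        by (intro add_mono mult_mono) (auto simp: dist_norm)
      also have "\<dots> = (B * L' + L * B') * dist y z" by (simp add: algebra_simps)
      finally show "dist (f y *\<^sub>R g y) (f z *\<^sub>R g z) \<le> (B * L' + L * B') * dist y z" by (simp add: dist_norm)
    qed (use B L in simp)
    then show "\<exists>V L. open V \<and> x \<in> V \<and> L-lipschitz_on V (\<lambda>x. f x *\<^sub>R g x)"
      using 1 2 by (meson IntI open_Int)
  qed
next
  case (Suc r)
  \<comment> \<open>The product rule multiplies a derivative by an undifferentiated factor, which
    therefore also has to be known in class \<open>r\<close>.\<close>
  have fg: "C_lip_on r W f" "C_lip_on r W g" using Suc.prems C_lip_on_Suc_imp[OF W] by blast+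
  show ?case
  proof (rule C_lip_on_SucI[OF W])
    fix x assume x: "x \<in> W"
    show "((\<lambda>x. f x *\<^sub>R g x) has_derivative
        (\<lambda>h. f x *\<^sub>R frechet_derivative g (at x) h + frechet_derivative f (at x) h *\<^sub>R g x)) (at x)"
      by (rule has_derivative_scaleR[OF C_lip_on_SucD(1)[OF Suc.prems(1) x] C_lip_on_SucD(1)[OF Suc.prems(2) x]])
  next
    fix v
    show "C_lip_on r W (\<lambda>x. f x *\<^sub>R frechet_derivative g (at x) v + frechet_derivative f (at x) v *\<^sub>R g x)"
      by (rule C_lip_on_add[OF W Suc.IH[OF fg(1) C_lip_on_SucD(2)[OF Suc.prems(2)]]
            Suc.IH[OF C_lip_on_SucD(2)[OF Suc.prems(1)] fg(2)]])
  qed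
qed

lemma C_lip_on_mult:
  fixes f g :: "'a::euclidean_space \<Rightarrow> real"
  assumes "open W" "C_lip_on r W f" "C_lip_on r W g"
  shows "C_lip_on r W (\<lambda>x. f x * g x)"
  using C_lip_on_scaleR[OF assms] by simp

lemma C_lip_on_prod:
  fixes f :: "'i \<Rightarrow> 'a::euclidean_space \<Rightarrow> real"
  assumes "open W" "\<And>i. i \<in> I \<Longrightarrow> C_lip_on r W (f i)"
  shows "C_lip_on r W (\<lambda>x. \<Prod>i\<in>I. f i x)"
  using assms(2)
proof (induction I rule: infinite_finite_induct)
  case (insert i I)
  then have "C_lip_on r W (\<lambda>x. f i x * (\<Prod>i\<in>I. f i x))"
    by (intro C_lip_on_mult[OF assms(1)]) blast+
  then show ?case using insert.hyps by simp
qed (simp_all add: C_lip_on_const)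

text \<open>\<open>C_lip_on\<close> speaks of derivatives in fixed directions, whereas the chain
  rule differentiates \<open>g\<close> in a direction that moves with \<open>x\<close>. Expanding
  this direction in the basis turns the derivative into a sum of products of a component of the
  derivative of \<open>f\<close> with a composite of lower class.\<close>

lemma C_lip_on_compose:
  fixes f :: "'a::euclidean_space \<Rightarrow> 'b::euclidean_space" and g :: "'b \<Rightarrow> 'c::euclidean_space"
  assumes W: "open W" and V: "open V" and fW: "f ` W \<subseteq> V" and "C_lip_on r W f" "C_lip_on r V g"
  shows "C_lip_on r W (\<lambda>x. g (f x))"
  using assms(4,5)
proof (induction r arbitrary: g)
  case 0
  show ?case unfolding C_lip_on.simps
  proof (rule locally_lipschitz_onI)
    fix x assume x: "x \<in> W"
    obtain A L where 1: "open A" "x \<in> A" "A \<subseteq> W" "L-lipschitz_on A f"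
      using 0(1) W x locally_lipschitz_onE by (metis C_lip_on.simps(1))
    obtain A' L' where 2: "open A'" "f x \<in> A'" "A' \<subseteq> V" "L'-lipschitz_on A' g"
      using 0(2) V x fW locally_lipschitz_onE by (metis C_lip_on.simps(1) image_subset_iff)
    define U where "U = A \<inter> f -` A'"
    have "open U" unfolding U_def
      using continuous_on_open_vimage[OF 1(1)] lipschitz_on_continuous_on[OF 1(4)] 2(1)
      by (metis Int_commute)
    moreover have "(L' * L)-lipschitz_on U (\<lambda>x. g (f x))"
      by (rule lipschitz_on_compose2[OF lipschitz_on_subset[OF 1(4)] lipschitz_on_subset[OF 2(4)]])
         (auto simp: U_def)
    moreover have "x \<in> U" using 1 2 by (simp add: U_def)
    ultimately show "\<exists>V L. open V \<and> x \<in> V \<and> L-lipschitz_on V (\<lambda>x. g (f x))" by blast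
  qed
next
  case (Suc r)
  have f: "C_lip_on r W f" using Suc.prems C_lip_on_Suc_imp[OF W] by blast
  show ?case
  proof (rule C_lip_on_SucI[OF W])
    fix x assume x: "x \<in> W"
    then have fx: "f x \<in> V" using fW by blast
    have "((\<lambda>x. g (f x)) has_derivative
        (\<lambda>h. frechet_derivative g (at (f x)) (frechet_derivative f (at x) h))) (at x)"
      by (rule has_derivative_compose[OF C_lip_on_SucD(1)[OF Suc.prems(1) x] C_lip_on_SucD(1)[OF Suc.prems(2) fx]])
    moreover have "frechet_derivative g (at (f x)) w =
        (\<Sum>b\<in>Basis. (w \<bullet> b) *\<^sub>R frechet_derivative g (at (f x)) b)" for w
    proof -
      have lin: "linear (frechet_derivative g (at (f x)))"
        by (rule has_derivative_linear[OF C_lip_on_SucD(1)[OF Suc.prems(2) fx]])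
      show ?thesis
        by (subst (1) euclidean_representation[symmetric]) (simp add: linear_sum[OF lin] linear_cmul[OF lin])
    qed
    ultimately show "((\<lambda>x. g (f x)) has_derivative
        (\<lambda>h. \<Sum>b\<in>Basis. (frechet_derivative f (at x) h \<bullet> b) *\<^sub>R frechet_derivative g (at (f x)) b)) (at x)"
      by (rule has_derivative_eq_rhs[OF _ ext])
  next
    fix v
    have "C_lip_on r W (\<lambda>x. frechet_derivative f (at x) v \<bullet> b)" for b
    proof -
      have A: "C_lip_on r W (\<lambda>x. frechet_derivative f (at x) v)" by (rule C_lip_on_SucD(2)[OF Suc.prems(1)])
      have "linear (\<lambda>w::'b. w \<bullet> b)" by (rule linearI) (simp_all add: inner_left_distrib)
      from C_lip_on_linear_comp[OF W this A] show ?thesis .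
    qed
    moreover have "C_lip_on r W (\<lambda>x. frechet_derivative g (at (f x)) b)" for b
      by (rule Suc.IH[OF f C_lip_on_SucD(2)[OF Suc.prems(2)]])
    ultimately show "C_lip_on r W (\<lambda>x. \<Sum>b\<in>Basis. (frechet_derivative f (at x) v \<bullet> b) *\<^sub>R frechet_derivative g (at (f x)) b)"
      by (intro C_lip_on_sum[OF W] C_lip_on_scaleR[OF W])
  qed
qed

text \<open>The derivative is a constant times a product of two copies of the function itself, so
  each class yields the next; the start comes from continuity of the derivative.\<close>

lemma C_lip_on_inverse_real: "C_lip_on r (- {0}) (inverse :: real \<Rightarrow> real)"
proof -
  have open0: "open (- {0 :: real})" by auto
  have der: "((inverse :: real \<Rightarrow> real) has_derivative (\<lambda>h. - (inverse x * h * inverse x))) (at x)"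
    if "x \<in> - {0}" for x
    using that by (intro has_derivative_inverse') simp
  show ?thesis
  proof (induction r)
    case 0
    have "locally_lipschitz_on (- {0 :: real}) inverse"
    proof (rule locally_lipschitz_on_if_derivs[OF open0])
      fix x :: real assume "x \<in> - {0}"
      then show "inverse differentiable at x" using der differentiable_def by blast
    next
      fix v x :: real assume x: "x \<in> - {0}"
      have "isCont (\<lambda>x. - (inverse x * v * inverse x)) x"
        using x by (intro continuous_intros) auto
      moreover have "\<forall>\<^sub>F y in nhds x. - (inverse y * v * inverse y) = frechet_derivative inverse (at y) v"
        using eventually_nhds_in_open[OF open0 x]
        by eventually_elim (use der frechet_derivative_at in metis)
      ultimately show "isCont (\<lambda>x. frechet_derivative inverse (at x) v) x"
        using isCont_cong by fast
    qed
    then show ?case by simp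
  next
    case (Suc r)
    show ?case
    proof (rule C_lip_on_SucI[OF open0 der])
      fix v :: real
      have "C_lip_on r (- {0}) (\<lambda>x :: real. - v * (inverse x * inverse x))"
        by (intro C_lip_on_mult[OF open0] C_lip_on_const Suc.IH)
      then show "C_lip_on r (- {0}) (\<lambda>x. - (inverse x * v * inverse x))"
        by (simp add: mult_ac)
    qed
  qed
qed

lemma C_lip_on_divide:
  fixes f g :: "'a::euclidean_space \<Rightarrow> real"
  assumes W: "open W" and "C_lip_on r W f" "C_lip_on r W g" and nz: "\<And>x. x \<in> W \<Longrightarrow> g x \<noteq> 0"
  shows "C_lip_on r W (\<lambda>x. f x / g x)"
proof -
  have "C_lip_on r W (\<lambda>x. inverse (g x))"
    by (rule C_lip_on_compose[OF W _ _ assms(3) C_lip_on_inverse_real]) (use nz in auto)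
  from C_lip_on_mult[OF W assms(2) this] show ?thesis by (simp add: divide_inverse)
qed

lemma C_lip_on_vec_nth:
  fixes f :: "'a::euclidean_space \<Rightarrow> real^'n"
  assumes "open W" "C_lip_on r W f"
  shows "C_lip_on r W (\<lambda>x. f x $ i)"
  by (rule C_lip_on_linear_comp[OF assms(1) _ assms(2)]) (simp add: linear_iff)

lemma C_lip_on_vec_lambda:
  fixes f :: "'n::finite \<Rightarrow> 'a::euclidean_space \<Rightarrow> real"
  assumes W: "open W" and "\<And>i. C_lip_on r W (f i)"
  shows "C_lip_on r W (\<lambda>x. \<chi> i. f i x)"
proof -
  have "(\<chi> i. f i x) = (\<Sum>i\<in>UNIV. f i x *\<^sub>R axis i 1)" for x
    by (simp add: vec_eq_iff axis_def if_distrib[of "(*) _"] cong: if_cong)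
  then show ?thesis
    using assms(2) by (simp only:) (intro C_lip_on_sum[OF W] C_lip_on_scaleR[OF W] C_lip_on_const)
qed

lemma C_lip_on_det:
  fixes A :: "'a::euclidean_space \<Rightarrow> real^'n^'n"
  assumes W: "open W" and "\<And>i j. C_lip_on r W (\<lambda>x. A x $ i $ j)"
  shows "C_lip_on r W (\<lambda>x. det (A x))"
  unfolding det_def
  by (intro C_lip_on_sum[OF W] C_lip_on_mult[OF W] C_lip_on_prod[OF W] C_lip_on_const assms(2))

section \<open>Regularity of the inverse of an expanding map\<close>

text \<open>Along a kernel vector of \<open>D\<close> the map moves by less than any fixed fraction
  of the step, in particular by at most \<delta>/2 times a short step, while expansion demands
  \<delta> times that step.\<close>

lemma derivative_injective_if_expanding:
  fixes \<Phi> :: "'a::euclidean_space \<Rightarrow> 'b::euclidean_space"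
  assumes d: "(\<Phi> has_derivative D) (at x)" and S: "open S" "x \<in> S"
    and \<delta>: "0 < \<delta>" "\<And>y z. y \<in> S \<Longrightarrow> z \<in> S \<Longrightarrow> \<delta> * dist y z \<le> dist (\<Phi> y) (\<Phi> z)"
  shows "inj D"
proof -
  have lin: "linear D" using d by (rule has_derivative_linear)
  have "h = 0" if h: "D h = 0" for h
  proof (rule ccontr)
    assume "h \<noteq> 0"
    obtain d' where d': "0 < d'" "\<And>y. norm (y - x) < d' \<Longrightarrow> norm (\<Phi> y - \<Phi> x - D (y - x)) \<le> \<delta> / 2 * norm (y - x)"
      using d \<delta>(1) unfolding has_derivative_at_alt by (meson half_gt_zero)
    obtain b where b: "0 < b" "ball x b \<subseteq> S" using S openE by blast
    define t where "t = min b d' / (2 * norm h)"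
    have t: "0 < t" "t * norm h < b" "t * norm h < d'"
      using \<open>h \<noteq> 0\<close> b(1) d'(1) by (auto simp: t_def min_def)
    have "x + t *\<^sub>R h \<in> S" using t b(2) by (auto simp: subset_iff dist_norm)
    then have "\<delta> * (t * norm h) \<le> norm (\<Phi> (x + t *\<^sub>R h) - \<Phi> x)"
      using \<delta>(2)[of "x + t *\<^sub>R h" x] S(2) t(1) by (simp add: dist_norm)
    also have "\<dots> \<le> \<delta> / 2 * (t * norm h)"
      using d'(2)[of "x + t *\<^sub>R h"] t h by (simp add: linear_cmul[OF lin])
    finally show False using \<delta>(1) t(1) \<open>h \<noteq> 0\<close> by simp
  qed
  then show ?thesis using linear_injective_0[OF lin] by blast
qed

text \<open>The expansion bound serves twice: it is the Lipschitz bound \<open>1 / \<delta>\<close>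
  for \<Psi>, which settles the lowest class, and it makes the derivative of \<Phi> invertible at
  every point of \<open>W\<close>.\<close>

lemma C_lip_on_inverse_map:
  fixes \<Phi> \<Psi> :: "real^'m \<Rightarrow> real^'m"
  assumes W: "open W" and V: "open V" and hom: "homeomorphism W V \<Phi> \<Psi>" and C: "C_lip_on r W \<Phi>"
    and \<delta>: "0 < \<delta>" "\<And>y z. y \<in> W \<Longrightarrow> z \<in> W \<Longrightarrow> \<delta> * dist y z \<le> dist (\<Phi> y) (\<Phi> z)"
  shows "C_lip_on r V \<Psi>"
proof -
  have \<Psi>W: "\<Psi> y \<in> W" "\<Phi> (\<Psi> y) = y" if "y \<in> V" for y
    using hom that by (auto simp: homeomorphism_def)
  have lip: "locally_lipschitz_on V \<Psi>"
  proof (rule locally_lipschitz_onI)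
    fix y assume "y \<in> V"
    have "(1 / \<delta>)-lipschitz_on V \<Psi>"
    proof (rule lipschitz_onI)
      fix y z assume "y \<in> V" "z \<in> V"
      then show "dist (\<Psi> y) (\<Psi> z) \<le> 1 / \<delta> * dist y z"
        using \<delta>(2)[of "\<Psi> y" "\<Psi> z"] \<Psi>W \<delta>(1) by (simp add: field_simps)
    qed (use \<delta>(1) in simp)
    then show "\<exists>A L. open A \<and> y \<in> A \<and> L-lipschitz_on A \<Psi>" using V \<open>y \<in> V\<close> by blast
  qed
  \<comment> \<open>Knowing \<Psi> in class \<open>j\<close> puts the matrix \<open>A y\<close> in
    class \<open>j\<close> by composition, and with it the derivative of \<Psi>, so that \<Psi> is
    in class \<open>Suc j\<close>.\<close>
  have "C_lip_on j V \<Psi>" if "j \<le> r" for j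
    using that
  proof (induction j)
    case 0
    then show ?case using lip by simp
  next
    case (Suc j)
    have C': "C_lip_on (Suc j) W \<Phi>" by (rule C_lip_on_le[OF W C Suc.prems])
    have IH: "C_lip_on j V \<Psi>" using Suc by simp
    define A where "A y = (\<chi> i l. frechet_derivative \<Phi> (at (\<Psi> y)) (axis l 1) $ i)" for y
    have AV: "frechet_derivative \<Phi> (at (\<Psi> y)) = (*v) (A y)" if "y \<in> V" for y
    proof -
      have lin: "linear (frechet_derivative \<Phi> (at (\<Psi> y)))"
        by (rule has_derivative_linear[OF C_lip_on_SucD(1)[OF C' \<Psi>W(1)[OF that]]])
      have "A y = matrix (frechet_derivative \<Phi> (at (\<Psi> y)))" by (simp add: A_def matrix_def)
      then show ?thesis using lin by (simp add: fun_eq_iff matrix_works linear_matrix_vector_mul_eq)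
    qed
    have der: "(\<Phi> has_derivative (*v) (A y)) (at (\<Psi> y))" if "y \<in> V" for y
      using C_lip_on_SucD(1)[OF C' \<Psi>W(1)[OF that]] AV[OF that] by simp
    have det: "det (A y) \<noteq> 0" if "y \<in> V" for y
    proof -
      have "inj ((*v) (A y))"
        by (rule derivative_injective_if_expanding[OF der[OF that] W \<Psi>W(1)[OF that] \<delta>])
      then show ?thesis
        by (simp only: invertible_det_nz[symmetric] invertible_left_inverse matrix_left_invertible_injective)
    qed
    \<comment> \<open>These are quotients of polynomials in the entries of \<open>A y\<close> and
      \<open>v\<close> with nonvanishing denominator, so the calculus of \<open>C_lip_on\<close>
      applies to them directly.\<close>
    define D where "D y v = (\<chi> k. det (\<chi> i l. if l = k then v $ i else A y $ i $ l) / det (A y))" for y v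
    have AD: "A y *v x = v \<longleftrightarrow> x = D y v" if "y \<in> V" for y x v
      unfolding D_def by (rule cramer[OF det[OF that]])
    show ?case
    proof (rule C_lip_on_SucI[OF V, where D=D])
      fix y assume y: "y \<in> V"
      \<comment> \<open>The inverse matrix \<open>B\<close> supplies the bounded linear inverse for
        the inverse function rule; uniqueness of the solution in \<open>AD\<close> identifies it
        with \<open>D y\<close>.\<close>
      obtain B where B: "A y ** B = mat 1" "B ** A y = mat 1"
        using det[OF y] unfolding invertible_det_nz[symmetric] invertible_def by blast
      have "D y = (*v) B"
      proof
        fix v
        have "A y *v (B *v v) = v"
          using B(1) by (simp add: matrix_vector_mul_assoc)
        then show "D y v = B *v v" using AD[OF y] by simp
      qed
      moreover have "(\<Psi> has_derivative (*v) B) (at y)"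
      proof (rule has_derivative_inverse_basic[where f=\<Phi> and g=\<Psi>, OF der[OF y] _ _ _ V y])
        show "bounded_linear ((*v) B)"
          by (simp add: linear_conv_bounded_linear[symmetric])
        show "(*v) B \<circ> (*v) (A y) = id"
          using B(2) by (simp add: fun_eq_iff matrix_vector_mul_assoc)
        show "continuous (at y) \<Psi>"
          using hom V y by (auto simp: homeomorphism_def continuous_on_eq_continuous_at)
      qed (use \<Psi>W in blast)
      ultimately show "(\<Psi> has_derivative D y) (at y)" by simp
    next
      fix v
      have A: "C_lip_on j V (\<lambda>y. A y $ i $ l)" for i l
      proof -
        have "\<Psi> ` V \<subseteq> W" using \<Psi>W by blast
        from C_lip_on_compose[OF V W this IH C_lip_on_SucD(2)[OF C'], of "axis l 1"]
        have "C_lip_on j V (\<lambda>y. frechet_derivative \<Phi> (at (\<Psi> y)) (axis l 1) $ i)"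
          by (rule C_lip_on_vec_nth[OF V])
        then show ?thesis by (simp add: A_def)
      qed
      have "C_lip_on j V (\<lambda>y. (\<chi> i l. if l = k then v $ i else A y $ i $ l) $ i $ l)" for i l k
        by (cases "l = k") (simp_all add: A C_lip_on_const)
      then show "C_lip_on j V (\<lambda>y. D y v)"
        unfolding D_def
        by (intro C_lip_on_vec_lambda[OF V] C_lip_on_divide[OF V] C_lip_on_det[OF V] A det)
    qed
  qed
  then show ?thesis by blast
qed

subsection \<open>Level sets at nondegenerate points\<close>

text \<open>A basis of the row space can be chosen among the rows, and it has
  \<open>CARD('n)\<close> elements. The injection \<iota> indexes these rows, so the resulting
  square matrix has full rank.\<close>

lemma full_rank_minor:
  fixes M :: "real^'n^'m"
  assumes "\<not> rank M < CARD('n)"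
  obtains \<iota> :: "'n \<Rightarrow> 'm" where "inj \<iota>" "det (\<chi> i j. M $ \<iota> i $ j) \<noteq> 0"
proof -
  have rk: "dim (rows M) = CARD('n)"
    using assms rank_bound[of M] by (simp add: row_rank_def)
  obtain C where C: "C \<subseteq> rows M" "independent C" "rows M \<subseteq> span C" "card C = dim (rows M)"
    using basis_exists by blast
  have "finite C" using C(2) by (rule independent_imp_finite)
  then obtain f :: "'n \<Rightarrow> real^'n" where f: "bij_betw f UNIV C"
    using finite_same_card_bij[of "UNIV :: 'n set" C] C(4) rk by auto
  have "\<forall>i. \<exists>k. f i = row k M"
    using f C(1) unfolding bij_betw_def rows_def by blast
  then obtain \<iota> where \<iota>: "\<And>i. f i = row (\<iota> i) M" by metis
  have inj: "inj \<iota>"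
    using f \<iota> unfolding bij_betw_def inj_def by metis
  define A where "A = (\<chi> i j. M $ \<iota> i $ j)"
  have "rows A = C"
  proof -
    have "row i A = f i" for i by (simp add: \<iota> A_def row_def)
    then have "rows A = range f" by (auto simp: rows_def)
    then show ?thesis using f by (simp add: bij_betw_def)
  qed
  then have "rank A = CARD('n)" using C(2,4) rk by (simp add: row_rank_def dim_eq_card_independent)
  then have "inj ((*v) A)" by (simp add: full_rank_injective)
  then have "det A \<noteq> 0"
    by (simp only: invertible_det_nz[symmetric] invertible_left_inverse matrix_left_invertible_injective)
  then show thesis using that inj by (simp add: A_def)
qed

text \<open>Jacobians are stored transposed, so directions act from the left and invertibility is
  tested on left kernels.\<close>

lemma det_nonzero_if_left_kernel_trivial:
  fixes N :: "real^'n^'n"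
  assumes "\<And>h. h v* N = 0 \<Longrightarrow> h = 0"
  shows "det N \<noteq> 0"
proof -
  have "\<forall>h. transpose N *v h = 0 \<longrightarrow> h = 0" using assms by simp
  then have "invertible (transpose N)"
    by (simp only: invertible_left_inverse matrix_left_invertible_ker)
  then have "det (transpose N) \<noteq> 0" using invertible_det_nz by blast
  then show ?thesis by (simp add: det_transpose)
qed

lemma left_kernel_trivial_if_det_nonzero:
  fixes N :: "real^'n^'n"
  assumes "det N \<noteq> 0" "h v* N = 0"
  shows "h = 0"
proof -
  have "det (transpose N) \<noteq> 0" using assms(1) by (simp add: det_transpose)
  then have "\<forall>h. transpose N *v h = 0 \<longrightarrow> h = 0"
    by (simp only: invertible_det_nz[symmetric] invertible_left_inverse matrix_left_invertible_ker)
  then show ?thesis using assms(2) by simp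
qed

text \<open>The components of \<open>F\<close> overwrite coordinates in place, which spares a
  reordering of the indices; \<open>B *v z\<close> lists the coordinates of \<open>z\<close> in the
  basis formed by the rows of \<open>B\<close>. Subtracting \<open>k\<close> puts the image of the
  level set into a linear rather than an affine subspace.\<close>

definition straightening ::
  "((real^'m) \<Rightarrow> (real^'n)) \<Rightarrow> real^'m^'m \<Rightarrow> ('n \<Rightarrow> 'm) \<Rightarrow> real^'n \<Rightarrow> (real^'m) \<Rightarrow> (real^'m)" where
  "straightening F B \<iota> k z = (\<chi> i. if i \<in> range \<iota> then (F z - k) $ inv \<iota> i else (B *v z) $ i)"

text \<open>Each component of \<open>F\<close> is, up to a constant, a component of the
  straightening map, so differentiability passes back to \<open>F\<close>; sequences that are
  admissible for the limiting Jacobians of the map are then admissible for those of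
  \<open>F\<close>. The other components are linear, so their columns do not depend on
  \<open>z\<close>.\<close>

lemma straightening_jacobian:
  assumes \<iota>: "inj \<iota>" and d: "straightening F B \<iota> k differentiable at z"
  shows "F differentiable at z"
    and "transpose (jacobian F (at z)) = (\<chi> a j. transpose (jacobian (straightening F B \<iota> k) (at z)) $ a $ \<iota> j)"
    and "i \<notin> range \<iota> \<Longrightarrow> transpose (jacobian (straightening F B \<iota> k) (at z)) $ a $ i = B $ i $ a"
proof -
  define \<Phi> where "\<Phi> = straightening F B \<iota> k"
  define D where "D = frechet_derivative \<Phi> (at z)"
  have D: "(\<Phi> has_derivative D) (at z)"
    using d by (simp add: \<Phi>_def D_def frechet_derivative_works)
  have comp: "((\<lambda>z. \<Phi> z $ i) has_derivative (\<lambda>h. D h $ i)) (at z)" for i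
    using D by (rule bounded_linear.has_derivative[OF bounded_linear_vec_nth])
  have F: "F z' $ j = \<Phi> z' $ \<iota> j + k $ j" for z' j
    using \<iota> by (simp add: \<Phi>_def straightening_def)
  have "((\<lambda>z. F z $ j) has_derivative (\<lambda>h. D h $ \<iota> j)) (at z)" for j
    unfolding F using comp by (auto intro!: derivative_eq_intros)
  then have F': "(F has_derivative (\<lambda>h. \<chi> j. D h $ \<iota> j)) (at z)"
    by (subst has_derivative_componentwise_within)
       (auto simp: Basis_vec_def inner_axis)
  then show "F differentiable at z" by (rule differentiableI)
  have "frechet_derivative F (at z) = (\<lambda>h. \<chi> j. D h $ \<iota> j)"
    using F' frechet_derivative_at by metis
  then show "transpose (jacobian F (at z)) = (\<chi> a j. transpose (jacobian (straightening F B \<iota> k) (at z)) $ a $ \<iota> j)"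
    by (simp add: jacobian_def matrix_def transpose_def D_def \<Phi>_def)
  show "transpose (jacobian (straightening F B \<iota> k) (at z)) $ a $ i = B $ i $ a" if i: "i \<notin> range \<iota>"
  proof -
    have "\<Phi> z' $ i = (B *v z') $ i" for z' using i by (simp add: \<Phi>_def straightening_def)
    then have "((\<lambda>z. (B *v z) $ i) has_derivative (\<lambda>h. D h $ i)) (at z)" using comp[of i] by simp
    moreover have "((\<lambda>z. (B *v z) $ i) has_derivative (\<lambda>h. (B *v h) $ i)) (at z)"
      by (intro bounded_linear_imp_has_derivative)
         (simp add: linear_conv_bounded_linear[symmetric] linear_iff matrix_vector_right_distrib matrix_vector_mult_scaleR)
    ultimately have "(\<lambda>h. D h $ i) = (\<lambda>h. (B *v h) $ i)" by (rule has_derivative_unique)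
    then have "D (axis a 1) $ i = (B *v axis a 1) $ i" by metis
    also have "\<dots> = B $ i $ a"
      by (simp add: matrix_vector_mult_def axis_def if_distrib[of "(*) _"] cong: if_cong)
    finally show ?thesis by (simp add: jacobian_def matrix_def transpose_def D_def \<Phi>_def)
  qed
qed

text \<open>Limiting Jacobians of \<Phi> satisfy two conditions: the columns picked by \<iota> form
  a generalized Jacobian of \<open>F\<close>, and the other columns are rows of \<open>B\<close>.
  Both conditions are convex and so survive in the hull, where a left kernel vector can be
  examined.\<close>

lemma straightening_clarke_nonsingular:
  fixes F :: "(real^'m) \<Rightarrow> (real^'n)"
  assumes B: "orthogonal_matrix B" and \<iota>: "inj \<iota>"
    and minor: "\<And>M. M \<in> clarke_subdifferential F x \<Longrightarrow> det (\<chi> i j. (B ** M) $ \<iota> i $ j) \<noteq> 0"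
    and N: "N \<in> clarke_subdifferential (straightening F B \<iota> k) x"
  shows "det N \<noteq> 0"
proof -
  define \<Phi> where "\<Phi> = straightening F B \<iota> k"
  define l :: "real^'m^'m \<Rightarrow> real^'n^'m" where "l N = (\<chi> a j. N $ a $ \<iota> j)" for N
  define T where "T = {N :: real^'m^'m. \<forall>i a. i \<notin> range \<iota> \<longrightarrow> N $ a $ i = B $ i $ a}"
  have "linear l" by (rule linearI) (simp_all add: l_def vec_eq_iff)
  then have conv: "convex (l -` clarke_subdifferential F x \<inter> T)"
  proof (intro convex_Int convex_linear_vimage)
    show "convex T"
    proof (rule convexI)
      fix M N :: "real^'m^'m" and s t :: real
      assume *: "M \<in> T" "N \<in> T" "0 \<le> s" "0 \<le> t" "s + t = 1"
      have "s * B $ i $ a + t * B $ i $ a = B $ i $ a" for i a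
        using *(5) by (simp add: distrib_right[symmetric])
      then show "s *\<^sub>R M + t *\<^sub>R N \<in> T" using *(1,2) by (simp add: T_def)
    qed
  qed (auto simp: clarke_subdifferential_eq)
  have "limiting_jacobians \<Phi> x \<subseteq> l -` clarke_subdifferential F x \<inter> T"
  proof
    fix N assume "N \<in> limiting_jacobians \<Phi> x"
    then obtain u where u: "u \<longlonglongrightarrow> x" "\<And>i. \<Phi> differentiable at (u i)"
        "(\<lambda>i. transpose (jacobian \<Phi> (at (u i)))) \<longlonglongrightarrow> N"
      by (auto simp: limiting_jacobians_def)
    have entry: "(\<lambda>n. transpose (jacobian \<Phi> (at (u n))) $ a $ i) \<longlonglongrightarrow> N $ a $ i" for a i
      by (intro tendsto_vec_nth u(3))
    note J = straightening_jacobian[OF \<iota> u(2)[unfolded \<Phi>_def], folded \<Phi>_def]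
    have "(\<lambda>n. transpose (jacobian F (at (u n)))) \<longlonglongrightarrow> l N"
      unfolding J(2) l_def by (intro vec_tendstoI) (simp add: entry)
    then have "l N \<in> limiting_jacobians F x"
      unfolding limiting_jacobians_def using u(1) J(1) by blast
    then have "l N \<in> clarke_subdifferential F x"
      unfolding clarke_subdifferential_eq by (rule hull_inc)
    moreover have "N \<in> T"
      unfolding T_def
    proof (intro CollectI allI impI)
      fix i a assume "i \<notin> range \<iota>"
      then have "(\<lambda>n. transpose (jacobian \<Phi> (at (u n))) $ a $ i) = (\<lambda>n. B $ i $ a)" by (simp add: J(3))
      then show "N $ a $ i = B $ i $ a" using entry[of a i] LIMSEQ_const_iff by metis
    qed
    ultimately show "N \<in> l -` clarke_subdifferential F x \<inter> T" by simp
  qed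
  then have "N \<in> l -` clarke_subdifferential F x \<inter> T"
    using N hull_minimal[where S=convex, OF _ conv] unfolding \<Phi>_def[symmetric] clarke_subdifferential_eq[of \<Phi>] by blast
  then have lN: "l N \<in> clarke_subdifferential F x" and NT: "\<And>i a. i \<notin> range \<iota> \<Longrightarrow> N $ a $ i = B $ i $ a"
    by (auto simp: T_def)
  define A where "A = (\<chi> i j. (B ** l N) $ \<iota> i $ j)"
  have A: "det A \<noteq> 0" using minor[OF lN] by (simp add: A_def)
  show ?thesis
  proof (rule det_nonzero_if_left_kernel_trivial)
    fix h assume h: "h v* N = 0"
    \<comment> \<open>In the basis of the rows of \<open>B\<close> the fixed columns of
      \<open>N\<close> say that the coordinates of \<open>h\<close> off the range of \<iota> vanish.
      Orthogonality recovers \<open>h\<close> from \<open>d\<close>.\<close>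
    define d where "d = B *v h"
    have hd: "h = d v* B"
    proof -
      have "transpose B *v (B *v h) = h"
        using B by (simp only: orthogonal_matrix matrix_vector_mul_assoc matrix_vector_mul_lid)
      then show ?thesis by (simp add: d_def)
    qed
    have hN: "(\<Sum>a\<in>UNIV. N $ a $ i * h $ a) = 0" for i
      using h by (simp add: vec_eq_iff vector_matrix_mult_def mult.commute)
    have d0: "d $ i = 0" if "i \<notin> range \<iota>" for i
      using hN[of i] NT[OF that] by (simp add: d_def matrix_vector_mult_def mult.commute)
    \<comment> \<open>The surviving coordinates only meet the rows of \<open>B ** l N\<close> picked
      by \<iota>, that is, the nonsingular minor \<open>A\<close>.\<close>
    define w where "w = (\<chi> j. d $ \<iota> j)"
    have "w v* A = 0"
    proof (subst vec_eq_iff, intro allI)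
      fix j
      have "(\<Sum>i\<in>UNIV. (B ** l N) $ i $ j * d $ i) = (d v* (B ** l N)) $ j"
        by (simp add: vector_matrix_mult_def mult.commute)
      also have "d v* (B ** l N) = h v* l N"
        by (simp only: hd vector_matrix_mul_assoc)
      also have "(h v* l N) $ j = 0"
        using hN[of "\<iota> j"] by (simp add: vector_matrix_mult_def l_def mult.commute)
      finally have "(\<Sum>i\<in>UNIV. (B ** l N) $ i $ j * d $ i) = 0" .
      moreover have "(\<Sum>i\<in>UNIV. (B ** l N) $ i $ j * d $ i) = (\<Sum>i\<in>range \<iota>. (B ** l N) $ i $ j * d $ i)"
        using d0 by (intro sum.mono_neutral_right) auto
      moreover have "\<dots> = (\<Sum>k\<in>UNIV. A $ k $ j * w $ k)"
        using \<iota> by (simp add: sum.reindex A_def w_def)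
      ultimately show "(w v* A) $ j = 0 $ j"
        by (simp add: vector_matrix_mult_def mult.commute)
    qed
    then have "w = 0" using left_kernel_trivial_if_det_nonzero[OF A] by blast
    then have "d $ \<iota> j = 0" for j by (simp add: w_def vec_eq_iff)
    then have "d $ i = 0" for i using d0[of i] by (cases "i \<in> range \<iota>") auto
    then have "d = 0" by (simp add: vec_eq_iff)
    then show "h = 0" using hd by simp
  qed
qed

lemma straightening_C_lip_on:
  assumes W: "open W" and F: "C_lip_on r W F"
  shows "C_lip_on r W (straightening F B \<iota> k)"
  unfolding straightening_def
proof (rule C_lip_on_vec_lambda[OF W])
  fix i
  show "C_lip_on r W (\<lambda>z. if i \<in> range \<iota> then (F z - k) $ inv \<iota> i else (B *v z) $ i)"
  proof (cases "i \<in> range \<iota>")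
    case True
    have "C_lip_on r W (\<lambda>z. F z $ inv \<iota> i + - k $ inv \<iota> i)"
      by (intro C_lip_on_add[OF W] C_lip_on_vec_nth[OF W F] C_lip_on_const)
    then show ?thesis using True by simp
  next
    case False
    have "C_lip_on r W (\<lambda>z. (B *v z) $ i)"
      by (intro C_lip_on_vec_nth[OF W] C_lip_on_linear) simp
    then show ?thesis using False by simp
  qed
qed

theorem clarke_regular_level_set:
  fixes F :: "(real^'m) \<Rightarrow> (real^'n)"
  assumes S: "open S" "x \<in> S" and F: "C_lip_on r S F"
    and B: "orthogonal_matrix B" and \<iota>: "inj \<iota>"
    and minor: "\<And>M. M \<in> clarke_subdifferential F x \<Longrightarrow> det (\<chi> i j. (B ** M) $ \<iota> i $ j) \<noteq> 0"
  obtains U where "open U" "x \<in> U" "U \<subseteq> S" "C_lip_submanifold r CARD('n) U {z \<in> U. F z = F x}"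
proof -
  define \<Phi> where "\<Phi> = straightening F B \<iota> (F x)"
  have C: "C_lip_on r S \<Phi>" unfolding \<Phi>_def by (rule straightening_C_lip_on[OF S(1) F])
  have "locally_lipschitz_on S \<Phi>" using C_lip_on_imp_zero[OF S(1) C] by simp
  then obtain A L where A: "open A" "x \<in> A" "A \<subseteq> S" "L-lipschitz_on A \<Phi>"
    using S locally_lipschitz_onE by blast
  obtain \<epsilon>0 where \<epsilon>0: "0 < \<epsilon>0" "cball x \<epsilon>0 \<subseteq> A" using A open_contains_cball by blast
  obtain \<epsilon> \<delta> where \<epsilon>: "0 < \<epsilon>" "\<epsilon> \<le> \<epsilon>0" and \<delta>: "0 < \<delta>"
    "\<And>y z. y \<in> ball x \<epsilon> \<Longrightarrow> z \<in> ball x \<epsilon> \<Longrightarrow> \<delta> * dist y z \<le> dist (\<Phi> y) (\<Phi> z)"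
    using clarke_lower_lipschitz[OF lipschitz_on_subset[OF A(4) \<epsilon>0(2)] \<epsilon>0(1)]
      straightening_clarke_nonsingular[OF B \<iota> minor] unfolding \<Phi>_def by blast
  define U where "U = ball x \<epsilon>"
  have U: "open U" "x \<in> U" "U \<subseteq> S"
    using \<epsilon> \<epsilon>0 A by (auto simp: U_def subset_iff)
  have CU: "C_lip_on r U \<Phi>" by (rule C_lip_on_subset[OF C U(3)])
  have cont: "continuous_on U \<Phi>"
    using C_lip_on_imp_isCont[OF CU U(1)] by (simp add: continuous_at_imp_continuous_on)
  have inj: "inj_on \<Phi> U"
  proof (rule inj_onI)
    fix y z assume "y \<in> U" "z \<in> U" "\<Phi> y = \<Phi> z"
    then have "\<delta> * dist y z \<le> 0" using \<delta>(2)[of y z] by (simp add: U_def)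
    then show "y = z" using \<delta>(1) by (simp add: mult_le_0_iff)
  qed
  obtain \<Psi> where hom: "homeomorphism U (\<Phi> ` U) \<Phi> \<Psi>"
    using invariance_of_domain_homeomorphism[OF U(1) cont _ inj] by blast
  have V: "open (\<Phi> ` U)" by (rule invariance_of_domain[OF cont U(1) inj])
  have C\<Psi>: "C_lip_on r (\<Phi> ` U) \<Psi>"
    using C_lip_on_inverse_map[OF U(1) V hom CU \<delta>(1)] \<delta>(2) by (simp add: U_def)
  \<comment> \<open>The coordinates in the range of \<iota> vanish on \<open>T\<close>. The doubly
    negated condition matches the form in which the dimension of a coordinate subspace is the number
    of its free indices.\<close>
  define T where "T = {v :: real^'m. \<forall>i. i \<notin> - range \<iota> \<longrightarrow> v $ i = 0}"
  have "subspace T" by (auto simp: T_def subspace_def)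
  moreover have "dim T + CARD('n) = DIM(real^'m)"
  proof -
    have "dim T = card (- range \<iota>)"
      unfolding T_def using dim_substandard_cart[where 'a=real, of "- range \<iota>"] by (simp add: dim_vec_eq)
    moreover have "card (range \<iota>) = CARD('n)" using \<iota> by (rule card_image)
    moreover have "card (- range \<iota>) + card (range \<iota>) = CARD('m)"
      using card_Un_disjoint[of "- range \<iota>" "range \<iota>"] by (simp add: Un_commute Compl_partition)
    ultimately show ?thesis by simp
  qed
  moreover have "\<Phi> ` (U \<inter> {z \<in> U. F z = F x}) = \<Phi> ` U \<inter> T"
  proof -
    have "\<Phi> z \<in> T \<longleftrightarrow> F z = F x" for z
    proof -
      have "\<Phi> z \<in> T \<longleftrightarrow> (\<forall>j. \<Phi> z $ \<iota> j = 0)" by (auto simp: T_def)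
      then show ?thesis using \<iota> by (simp add: \<Phi>_def straightening_def vec_eq_iff)
    qed
    then show ?thesis by blast
  qed
  \<comment> \<open>Expansion holds on the whole ball, so the single chart \<Phi> on
    \<open>U\<close> serves every point of the level set.\<close>
  ultimately have "C_lip_submanifold r CARD('n) U {z \<in> U. F z = F x}"
    unfolding C_lip_submanifold_def using U V hom CU C\<Psi> by blast
  then show thesis using that U by blast
qed

section \<open>The twice continuously differentiable case\<close>

text \<open>Jacobians near \<open>x\<close> are the matrices of \<open>D\<close>, which converge
  entry by entry to that of \<open>D x\<close>; every limiting Jacobian therefore equals it. An
  inclusion is enough because the minor condition is to hold for all elements.\<close>

lemma clarke_subset_if_continuous_derivative:
  fixes F :: "(real^'m) \<Rightarrow> (real^'n)"
  assumes S: "open S" "x \<in> S" and d: "\<And>z. z \<in> S \<Longrightarrow> (F has_derivative D z) (at z)"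
    and cont: "\<And>v. isCont (\<lambda>z. D z v) x"
  shows "clarke_subdifferential F x \<subseteq> {transpose (matrix (D x))}"
  unfolding clarke_subdifferential_eq
proof (rule hull_minimal, rule subsetI)
  fix M assume "M \<in> limiting_jacobians F x"
  then obtain u where u: "u \<longlonglongrightarrow> x" "(\<lambda>i. transpose (jacobian F (at (u i)))) \<longlonglongrightarrow> M"
    by (auto simp: limiting_jacobians_def)
  have "M $ a $ j = transpose (matrix (D x)) $ a $ j" for a j
  proof (rule LIMSEQ_unique)
    show "(\<lambda>i. transpose (jacobian F (at (u i))) $ a $ j) \<longlonglongrightarrow> M $ a $ j"
      by (intro tendsto_vec_nth u(2))
    have "(\<lambda>i. D (u i) (axis a 1) $ j) \<longlonglongrightarrow> D x (axis a 1) $ j"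
      by (intro tendsto_vec_nth isCont_tendsto_compose[OF cont u(1)])
    moreover have "\<forall>\<^sub>F i in sequentially. D (u i) (axis a 1) $ j = transpose (jacobian F (at (u i))) $ a $ j"
      using topological_tendstoD[OF u(1) S]
    proof eventually_elim
      case (elim i)
      then have "D (u i) = frechet_derivative F (at (u i))" using d frechet_derivative_at by blast
      then show ?case by (simp add: jacobian_def matrix_def transpose_def)
    qed
    ultimately show "(\<lambda>i. transpose (jacobian F (at (u i))) $ a $ j) \<longlonglongrightarrow> transpose (matrix (D x)) $ a $ j"
      by (simp add: Lim_transform_eventually matrix_def transpose_def)
  qed
  then show "M \<in> {transpose (matrix (D x))}" by (simp add: vec_eq_iff)
qed simp

lemma open_slices:
  assumes "open W"
  shows "open {x. (x, y) \<in> W}" "open {y. (x, y) \<in> W}"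
proof -
  have "open ((\<lambda>x. (x, y)) -` W)" "open ((\<lambda>y. (x, y)) -` W)"
    by (intro open_vimage[OF assms] continuous_intros)+
  then show "open {x. (x, y) \<in> W}" "open {y. (x, y) \<in> W}" by (simp_all add: vimage_def)
qed

text \<open>\<open>Y\<close> is open as a slice of an open set, so the derivative in
  \<open>y\<close> is unique and the given gradient has to be the partial derivative of
  \<open>s\<close>.\<close>

lemma y_gradient_eq_frechet_derivative:
  fixes s :: "(real^'m) \<times> (real^'n) \<Rightarrow> real"
  assumes grad: "y_gradient_on X Y s Dys" and op: "open (X \<times> Y)" and xy: "(x, y) \<in> X \<times> Y"
    and d: "s differentiable at (x, y)"
  shows "Dys (x, y) \<bullet> h = frechet_derivative s (at (x, y)) (0, h)"
proof -
  have "open Y" using open_slices(2)[OF op, of x] xy by simp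
  then have 1: "((\<lambda>y. s (x, y)) has_derivative (\<lambda>h. Dys (x, y) \<bullet> h)) (at y)"
  proof -
    have "at y within Y = at y" using at_within_open[OF _ \<open>open Y\<close>] xy by simp
    moreover have "x \<in> X" "y \<in> Y" using xy by auto
    ultimately show ?thesis using grad unfolding y_gradient_on_def by metis
  qed
  have "(s has_derivative frechet_derivative s (at (x, y))) (at (x, y))"
    using d frechet_derivative_works by blast
  moreover have "((\<lambda>y. (x, y)) has_derivative (\<lambda>h. (0, h))) (at y)"
    by (auto intro!: derivative_eq_intros)
  ultimately have 2: "((\<lambda>y. s (x, y)) has_derivative (\<lambda>h. frechet_derivative s (at (x, y)) (0, h))) (at y)"
    using diff_chain_at[of "\<lambda>y. (x, y)" "\<lambda>h. (0, h)" y s] by (simp add: o_def)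
  from fun_cong[OF has_derivative_unique[OF 1 2]] show ?thesis .
qed

text \<open>The components of \<open>Dys\<close> are the derivatives of \<open>s\<close> in the
  fixed directions \<open>(0, axis j 1)\<close>, and \<open>C_k_on 2\<close> makes exactly such
  functions differentiable with continuous directional derivatives.\<close>

lemma C2_gradient_slice_derivative:
  fixes s :: "(real^'m) \<times> (real^'n) \<Rightarrow> real"
  assumes grad: "y_gradient_on X Y s Dys" and op: "open (X \<times> Y)" and C2: "C_k_on 2 (X \<times> Y) s"
    and mem: "xb \<in> X" "yb \<in> Y"
  obtains D where "\<And>x. x \<in> X \<Longrightarrow> ((\<lambda>x. Dys (x, yb)) has_derivative D x) (at x)"
    "\<And>v. isCont (\<lambda>x. D x v) xb"
proof -
  have ds: "s differentiable at q" if "q \<in> X \<times> Y" for q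
    using C2 that unfolding numeral_2_eq_2 C_k_on.simps by blast
  define E where "E j q = frechet_derivative s (at q) (0, axis j 1)" for j q
  have dE: "E j differentiable at q" if "q \<in> X \<times> Y" for j q
    using C2 that unfolding numeral_2_eq_2 C_k_on.simps E_def[abs_def] by blast
  have cE: "continuous_on (X \<times> Y) (\<lambda>q. frechet_derivative (E j) (at q) v)" for j v
    using C2 unfolding numeral_2_eq_2 C_k_on.simps E_def[abs_def] by blast
  have X: "open X" using open_slices(1)[OF op, of yb] mem by simp
  define D where "D x h = (\<chi> j. frechet_derivative (E j) (at (x, yb)) (h, 0))" for x h
  have "((\<lambda>x. Dys (x, yb)) has_derivative D x) (at x)" if x: "x \<in> X" for x
  proof (subst has_derivative_componentwise_within, intro ballI)
    fix i :: "real^'n" assume "i \<in> Basis"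
    then obtain j where i: "i = axis j 1" by (auto simp: Basis_vec_def)
    have xy: "(x, yb) \<in> X \<times> Y" using x mem by simp
    have "(E j has_derivative frechet_derivative (E j) (at (x, yb))) (at (x, yb))"
      using dE[OF xy] frechet_derivative_works by blast
    moreover have "((\<lambda>x. (x, yb)) has_derivative (\<lambda>h. (h, 0))) (at x)"
      by (auto intro!: derivative_eq_intros)
    ultimately have "((\<lambda>x. E j (x, yb)) has_derivative (\<lambda>h. frechet_derivative (E j) (at (x, yb)) (h, 0))) (at x)"
      using diff_chain_at[of "\<lambda>x. (x, yb)" "\<lambda>h. (h, 0)" x "E j"] by (simp add: o_def)
    then have "((\<lambda>x. Dys (x, yb) \<bullet> i) has_derivative (\<lambda>h. frechet_derivative (E j) (at (x, yb)) (h, 0))) (at x)"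
    proof (rule has_derivative_transform_within_open[OF _ X x])
      fix z assume "z \<in> X"
      then have zy: "(z, yb) \<in> X \<times> Y" using mem by simp
      show "E j (z, yb) = Dys (z, yb) \<bullet> i"
        using y_gradient_eq_frechet_derivative[OF grad op zy ds[OF zy], of i] by (simp add: E_def i)
    qed
    then show "((\<lambda>x. Dys (x, yb) \<bullet> i) has_derivative (\<lambda>h. D x h \<bullet> i)) (at x)"
      by (simp add: D_def i inner_axis)
  qed
  moreover have "isCont (\<lambda>x. D x v) xb" for v
  proof -
    have "isCont (\<lambda>x. frechet_derivative (E j) (at (x, yb)) (v, 0)) xb" for j
    proof -
      have "isCont (\<lambda>q. frechet_derivative (E j) (at q) (v, 0)) (xb, yb)"
        using cE op mem by (simp add: continuous_on_eq_continuous_at)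
      moreover have "isCont (\<lambda>x. (x, yb)) xb" by (intro continuous_intros)
      ultimately show ?thesis by (rule isCont_o2[rotated])
    qed
    then show ?thesis unfolding D_def isCont_def by (intro vec_tendstoI) (simp add: isCont_def)
  qed
  ultimately show thesis using that by blast
qed

theorem proposition2:
  fixes X :: "(real^'m) set" and Y :: "(real^'n) set"
    and s :: "(real^'m) \<times> (real^'n) \<Rightarrow> real"
    and Dys :: "(real^'m) \<times> (real^'n) \<Rightarrow> real^'n"
    and r :: nat and xb :: "real^'m" and yb :: "real^'n"
  assumes "CARD('n) \<le> CARD('m)"
    and "y_gradient_on X Y s Dys"
    and "C_lip_loc r (X \<times> Y) s"
    and "C_lip_loc r (X \<times> Y) Dys"
    and "xb \<in> X" and "yb \<in> Y"
    and "\<not> degenerates r X Y s Dys xb yb"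
  shows "\<exists>U N. open U \<and> xb \<in> U \<and> C_lip_submanifold r CARD('n) U N \<and>
               indifference_set X Dys yb (Dys (xb, yb)) \<inter> U = X \<inter> N"
proof -
  \<comment> \<open>Both branches of the criterion are brought to the same data: an extension of
    class \<open>r\<close>, a basis and a choice of rows for which no generalized Jacobian has a
    vanishing minor.\<close>
  have "\<exists>W G B (\<iota> :: 'n \<Rightarrow> 'm). open W \<and> (xb, yb) \<in> W \<and> C_lip_on r W G \<and>
      (\<forall>q\<in>W \<inter> (X \<times> Y). G q = Dys q) \<and> orthogonal_matrix B \<and> inj \<iota> \<and>
      (\<forall>M\<in>clarke_subdifferential (\<lambda>x. G (x, yb)) xb. det (\<chi> i j. (B ** M) $ \<iota> i $ j) \<noteq> 0)"
  proof (cases "open (X \<times> Y) \<and> C_k_on 2 (X \<times> Y) s")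
    case False
    then show ?thesis using assms(7) unfolding degenerates_def if_not_P[OF False] by blast
  next
    case True
    \<comment> \<open>Two derivatives of \<open>s\<close> only make \<open>Dys\<close> continuously
      differentiable, so the extension of class \<open>r\<close> comes from the hypothesis on
      \<open>Dys\<close>. It agrees with \<open>Dys\<close> on an open set around
      \<open>(xb, yb)\<close> and thus has the same derivatives in \<open>x\<close> there.\<close>
    obtain W G where G: "open W" "(xb, yb) \<in> W" "C_lip_on r W G" "\<forall>q\<in>W \<inter> (X \<times> Y). G q = Dys q"
      using assms(4,5,6) unfolding C_lip_loc_def by (metis SigmaI)
    obtain D where D: "\<And>x. x \<in> X \<Longrightarrow> ((\<lambda>x. Dys (x, yb)) has_derivative D x) (at x)"
        "\<And>v. isCont (\<lambda>x. D x v) xb"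
      using C2_gradient_slice_derivative[OF assms(2) _ _ assms(5,6)] True by blast
    define S where "S = {x. (x, yb) \<in> W \<inter> (X \<times> Y)}"
    have S: "open S" "xb \<in> S"
      unfolding S_def using G(1,2) True assms(5,6) by (blast intro: open_slices open_Int)+
    have "((\<lambda>x. G (x, yb)) has_derivative D x) (at x)" if "x \<in> S" for x
      by (rule has_derivative_transform_within_open[OF D(1) S(1) that]) (use that G(4) in \<open>auto simp: S_def\<close>)
    then have cl: "clarke_subdifferential (\<lambda>x. G (x, yb)) xb \<subseteq> {transpose (matrix (D xb))}"
      by (rule clarke_subset_if_continuous_derivative[OF S _ D(2)])
    have "D xb = frechet_derivative (\<lambda>x. Dys (x, yb)) (at xb)"
      using D(1)[OF assms(5)] frechet_derivative_at by blast
    then have "\<not> rank (transpose (matrix (D xb))) < CARD('n)"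
      using assms(7) True by (simp add: degenerates_def jacobian_def)
    then obtain \<iota> :: "'n \<Rightarrow> 'm" where "inj \<iota>" "det (\<chi> i j. transpose (matrix (D xb)) $ \<iota> i $ j) \<noteq> 0"
      by (rule full_rank_minor)
    then show ?thesis
      using G cl orthogonal_matrix_id
      by (intro exI[of _ W] exI[of _ G] exI[of _ "mat 1"] exI[of _ \<iota>]) auto
  qed
  then obtain W G B and \<iota> :: "'n \<Rightarrow> 'm" where G: "open W" "(xb, yb) \<in> W" "C_lip_on r W G"
      "\<And>q. q \<in> W \<inter> (X \<times> Y) \<Longrightarrow> G q = Dys q" and B: "orthogonal_matrix B" "inj \<iota>"
      and minor: "\<And>M. M \<in> clarke_subdifferential (\<lambda>x. G (x, yb)) xb \<Longrightarrow> det (\<chi> i j. (B ** M) $ \<iota> i $ j) \<noteq> 0"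
    by blast
  define S where "S = {x. (x, yb) \<in> W}"
  have S: "open S" "xb \<in> S"
    unfolding S_def using G(1,2) by (blast intro: open_slices)+
  \<comment> \<open>The embedding of the slice is a linear map plus a constant, so restricting
    \<open>G\<close> to the slice is a composition within class \<open>r\<close>.\<close>
  have "C_lip_on r S (\<lambda>x. (x, 0) + (0, yb))"
    by (intro C_lip_on_add[OF S(1)] C_lip_on_linear C_lip_on_const) (simp add: linear_iff)
  then have slice: "C_lip_on r S (\<lambda>x. (x, yb))" by simp
  have "C_lip_on r S (\<lambda>x. G (x, yb))"
    by (rule C_lip_on_compose[OF S(1) G(1) _ slice G(3)]) (auto simp: S_def)
  from clarke_regular_level_set[OF S this B minor]
  obtain U where U: "open U" "xb \<in> U" "U \<subseteq> S"
      "C_lip_submanifold r CARD('n) U {z \<in> U. G (z, yb) = G (xb, yb)}" by blast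
  \<comment> \<open>The submanifold is a level set of the extension; since \<open>U\<close> lies in
    \<open>S\<close>, it can be compared with \<open>Dys\<close> at all points of \<open>X\<close>
    in \<open>U\<close>.\<close>
  have "G (z, yb) = Dys (z, yb)" if "z \<in> X \<inter> U" for z
    using that U(3) assms(6) by (intro G(4)) (auto simp: S_def)
  then have "indifference_set X Dys yb (Dys (xb, yb)) \<inter> U = X \<inter> {z \<in> U. G (z, yb) = G (xb, yb)}"
    using assms(5) U(2) by (auto simp: indifference_set_def)
  then show ?thesis using U by blast
qed

end
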